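(* Let $\Omega\subset\mathbb R^N$ be a bounded Lipschitz domain, $s\in(0,1)$, let $A_s=I+(-\Delta)^s$ be the positive self-adjoint operator associated with the fractional Dirichlet form on $H_0^s(\Omega)$, and let $B:=KA_s^{-1/2}$, where $K:H_0^s(\Omega)\to L^2(\Omega)$ is a bounded linear operator. Then $B:L^2(\Omega)\to L^2(\Omega)$ is bounded. Let $u^\dagger\in H_0^s(\Omega)$, and assume $y^\delta=Ku^\dagger+\eta^\delta$, where $\delta>0$ and the random noise $\eta^\delta$ (with values in $L^2(\Omega)$) satisfies $\mathbb E\|\eta^\delta\|_{L^2(\Omega)}^2\le\delta^2$. Let $z^\dagger=A_s^{1/2}u^\dagger$ and suppose that $z^\dagger=(B^*B)^\beta w$ for some $w\in L^2(\Omega)$ and $0<\beta\le1$. For $\alpha>0$ let $u_\alpha^\delta$ be the unique minimizer over $u\in H_0^s(\Omega)$ of $\frac12\|Ku-y^\delta\|_{L^2(\Omega)}^2+\frac\alpha2\|u\|_{H_0^s(\Omega)}^2$. Then, for every $\alpha>0$, $$\mathbb E\|u_\alpha^\delta-u^\dagger\|_{H_0^s(\Omega)}^2\le 2c_\beta^2\|w\|_{L^2(\Omega)}^2\,\alpha^{2\beta}+\frac{\delta^2}{2\alpha},$$ where $$c_\beta=\begin{cases}\beta^\beta(1-\beta)^{1-\beta},&0<\beta<1,\\ 1,&\beta=1.\end{cases}$$ In particular, with $C_1:=2c_\beta^2\|w\|_{L^2(\Omega)}^2$ and $C_2:=\frac12$, which are independent of $\alpha$ and $\delta$, $$\mathbb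 E\|u_\alpha^\delta-u^\dagger\|_{H_0^s(\Omega)}^2\le C_1\alpha^{2\beta}+C_2\frac{\delta^2}{\alpha}.$$
   Context: All spaces are real. $H_0^s(\Omega)$ is the space of functions $u\in H^s(\mathbb R^N)$ with $u=0$ a.e. in $\mathbb R^N\setminus\Omega$ (also regarded as functions on $\Omega$). The fractional Dirichlet form is the closed, symmetric, coercive bilinear form on $H_0^s(\Omega)$ $$a_s(u,v)=\int_\Omega uv\,dx+\frac{C_{N,s}}{2}\iint_{\mathbb R^{2N}}\frac{(u(x)-u(y))(v(x)-v(y))}{|x-y|^{N+2s}}\,dx\,dy,$$ where $C_{N,s}>0$ is the standard normalization constant of the integral fractional Laplacian, $C_{N,s}=\frac{4^s s\,\Gamma(N/2+s)}{\pi^{N/2}\Gamma(1-s)}$. $H_0^s(\Omega)$ is a Hilbert space with norm $\|u\|_{H_0^s(\Omega)}^2=a_s(u,u)$. $A_s=I+(-\Delta)^s$ is the unique positive self-adjoint operator on $L^2(\Omega)$ associated with $a_s$; powers are defined by the spectral theorem. $A_s^{1/2}$ is an isometric isomorphism of $D(A_s^{1/2})=H_0^s(\Omega)$ onto $L^2(\Omega)$ with inverse $A_s^{-1/2}:L^2(\Omega)\to H_0^s(\Omega)$. $B^*$ is the Hilbert-space adjoint of $B$ in $L^2(\Omega)$. *)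

theory Defs
  imports "HOL-Probability.Probability"
begin

section \<open>The real Hilbert space of square-integrable functions on Euclidean space\<close>

definition sq_integrable :: "('a::euclidean_space \<Rightarrow> real) \<Rightarrow> bool" where
  "sq_integrable f \<longleftrightarrow> f \<in> borel_measurable lborel \<and> integrable lborel (\<lambda>x. (f x)\<^sup>2)"

definition L2_rel :: "('a::euclidean_space \<Rightarrow> real) \<Rightarrow> ('a \<Rightarrow> real) \<Rightarrow> bool" where
  "L2_rel f g \<longleftrightarrow> sq_integrable f \<and> sq_integrable g \<and> (AE x in lborel. f x = g x)"

lemma sq_integrable_mult:
  assumes "sq_integrable f" "sq_integrable g"
  shows "integrable lborel (\<lambda>x. f x * g x)"
proof (rule Bochner_Integration.integrable_bound)
  show "integrable lborel (\<lambda>x. (f x)\<^sup>2 + (g x)\<^sup>2)"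
    using assms by (auto simp: sq_integrable_def)
  show "(\<lambda>x. f x * g x) \<in> borel_measurable lborel"
    using assms by (auto simp: sq_integrable_def)
  have "\<bar>a * b\<bar> \<le> a\<^sup>2 + b\<^sup>2" for a b :: real
  proof -
    have "2 * (\<bar>a\<bar> * \<bar>b\<bar>) \<le> a\<^sup>2 + b\<^sup>2"
      using sum_squares_bound[of "\<bar>a\<bar>" "\<bar>b\<bar>"] by simp
    moreover have "0 \<le> \<bar>a\<bar> * \<bar>b\<bar>" by simp
    ultimately show ?thesis unfolding abs_mult by linarith
  qed
  then show "AE x in lborel. norm (f x * g x) \<le> norm ((f x)\<^sup>2 + (g x)\<^sup>2)"
    by (intro AE_I2) (simp add: abs_of_nonneg)
qed

lemma sq_integrable_add:
  assumes "sq_integrable f" "sq_integrable g"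
  shows "sq_integrable (\<lambda>x. f x + g x)"
proof -
  have "integrable lborel (\<lambda>x. (f x)\<^sup>2 + (g x)\<^sup>2 + 2 * (f x * g x))"
    using assms sq_integrable_mult[OF assms] by (auto simp: sq_integrable_def)
  then have "integrable lborel (\<lambda>x. (f x + g x)\<^sup>2)"
    by (simp add: power2_sum mult.assoc)
  then show ?thesis using assms by (auto simp: sq_integrable_def)
qed

lemma sq_integrable_scale: "sq_integrable f \<Longrightarrow> sq_integrable (\<lambda>x. c * f x)"
  by (auto simp: sq_integrable_def power_mult_distrib)

lemma sq_integrable_uminus: "sq_integrable f \<Longrightarrow> sq_integrable (\<lambda>x. - f x)"
  using sq_integrable_scale[of f "-1"] by simp

lemma sq_integrable_diff:
  "sq_integrable f \<Longrightarrow> sq_integrable g \<Longrightarrow> sq_integrable (\<lambda>x. f x - g x)"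
  using sq_integrable_add[of f "\<lambda>x. - g x"] sq_integrable_uminus[of g] by simp

lemma sq_integrable_zero: "sq_integrable (\<lambda>x. 0)"
  by (simp add: sq_integrable_def)

quotient_type (overloaded) 'a L2 = "'a::euclidean_space \<Rightarrow> real" / partial: L2_rel
proof (rule part_equivpI)
  show "\<exists>x. L2_rel x x"
    by (rule exI[of _ "\<lambda>x. 0"]) (simp add: L2_rel_def sq_integrable_zero)
  show "symp L2_rel"
    by (auto simp: symp_def L2_rel_def)
  show "transp L2_rel"
    by (auto simp: transp_def L2_rel_def elim: AE_mp)
qed

instantiation L2 :: (euclidean_space) real_inner
begin

lift_definition zero_L2 :: "'a L2" is "\<lambda>x. 0"
  by (simp add: L2_rel_def sq_integrable_zero)

lift_definition plus_L2 :: "'a L2 \<Rightarrow> 'a L2 \<Rightarrow> 'a L2" is "\<lambda>f g x. f x + g x"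
  by (auto simp: L2_rel_def sq_integrable_add)

lift_definition minus_L2 :: "'a L2 \<Rightarrow> 'a L2 \<Rightarrow> 'a L2" is "\<lambda>f g x. f x - g x"
  by (auto simp: L2_rel_def sq_integrable_diff)

lift_definition uminus_L2 :: "'a L2 \<Rightarrow> 'a L2" is "\<lambda>f x. - f x"
  by (auto simp: L2_rel_def sq_integrable_uminus)

lift_definition scaleR_L2 :: "real \<Rightarrow> 'a L2 \<Rightarrow> 'a L2" is "\<lambda>c f x. c * f x"
  by (auto simp: L2_rel_def sq_integrable_scale)

lift_definition inner_L2 :: "'a L2 \<Rightarrow> 'a L2 \<Rightarrow> real" is "\<lambda>f g. LINT x|lborel. f x * g x"
proof -
  fix f f' g g' :: "'a \<Rightarrow> real"
  assume a: "L2_rel f f'" "L2_rel g g'"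
  show "(LINT x|lborel. f x * g x) = (LINT x|lborel. f' x * g' x)"
    using a by (intro integral_cong_AE) (auto simp: L2_rel_def sq_integrable_def)
qed

definition norm_L2 :: "'a L2 \<Rightarrow> real" where
  "norm_L2 u = sqrt (inner u u)"

definition dist_L2 :: "'a L2 \<Rightarrow> 'a L2 \<Rightarrow> real" where
  "dist_L2 u v = norm (u - v)"

definition sgn_L2 :: "'a L2 \<Rightarrow> 'a L2" where
  "sgn_L2 u = inverse (norm u) *\<^sub>R u"

definition uniformity_L2 :: "('a L2 \<times> 'a L2) filter" where
  "uniformity_L2 = (INF e\<in>{0<..}. principal {(x, y). dist x y < e})"

definition open_L2 :: "'a L2 set \<Rightarrow> bool" where
  "open_L2 U \<longleftrightarrow> (\<forall>x\<in>U. eventually (\<lambda>(x', y). x' = x \<longrightarrow> y \<in> U) uniformity)"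

instance
proof
  fix a b c :: "'a L2" and r r' :: real
  show "a + b + c = a + (b + c)"
    by transfer (auto simp: L2_rel_def add.assoc sq_integrable_add)
  show "a + b = b + a"
    by transfer (auto simp: L2_rel_def add.commute sq_integrable_add)
  show "0 + a = a"
    by transfer (auto simp: L2_rel_def)
  show "- a + a = 0"
    by transfer (auto simp: L2_rel_def sq_integrable_zero)
  show "a - b = a + - b"
    by transfer (auto simp: L2_rel_def sq_integrable_diff)
  show "r *\<^sub>R (a + b) = r *\<^sub>R a + r *\<^sub>R b"
    by transfer (auto simp: L2_rel_def algebra_simps
        intro: sq_integrable_add sq_integrable_scale)
  show "(r + r') *\<^sub>R a = r *\<^sub>R a + r' *\<^sub>R a"
    by transfer (auto simp: L2_rel_def algebra_simps
        intro: sq_integrable_add sq_integrable_scale)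
  show "r *\<^sub>R r' *\<^sub>R a = (r * r') *\<^sub>R a"
    by transfer (auto simp: L2_rel_def algebra_simps
        intro: sq_integrable_scale)
  show "1 *\<^sub>R a = a"
    by transfer (auto simp: L2_rel_def)
  show "dist a b = norm (a - b)" by (rule dist_L2_def)
  show "sgn a = inverse (norm a) *\<^sub>R a" by (rule sgn_L2_def)
  show "uniformity = (INF e\<in>{0<..}. principal {(x :: 'a L2, y). dist x y < e})"
    by (rule uniformity_L2_def)
  show "open U \<longleftrightarrow> (\<forall>x\<in>U. eventually (\<lambda>(x', y). x' = x \<longrightarrow> y \<in> U) uniformity)"
    for U :: "'a L2 set"
    by (rule open_L2_def)
  show "inner a b = inner b a"
    by transfer (simp add: mult.commute)
  show "inner (a + b) c = inner a c + inner b c"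
  proof transfer
    fix f g h :: "'a \<Rightarrow> real"
    assume "L2_rel f f" "L2_rel g g" "L2_rel h h"
    then show "(LINT x|lborel. (f x + g x) * h x)
        = (LINT x|lborel. f x * h x) + (LINT x|lborel. g x * h x)"
      by (simp add: L2_rel_def distrib_right sq_integrable_mult)
  qed
  show "inner (r *\<^sub>R a) b = r * inner a b"
    by transfer (simp add: mult.assoc)
  show "0 \<le> inner a a"
    by transfer simp
  show "inner a a = 0 \<longleftrightarrow> a = 0"
  proof transfer
    fix f :: "'a \<Rightarrow> real"
    assume "L2_rel f f"
    then have f: "sq_integrable f" by (simp add: L2_rel_def)
    then have "(LINT x|lborel. f x * f x) = 0 \<longleftrightarrow> (AE x in lborel. f x * f x = 0)"
      by (intro integral_nonneg_eq_0_iff_AE sq_integrable_mult) auto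
    then show "(LINT x|lborel. f x * f x) = 0 \<longleftrightarrow> L2_rel f (\<lambda>x. 0)"
      using f by (simp add: L2_rel_def sq_integrable_zero)
  qed
  show "norm a = sqrt (inner a a)" by (rule norm_L2_def)
qed

end

text \<open>
  The space \<open>L\<^sup>2(\<Omega>)\<close>, identified with the closed subspace of those elements of
  \<open>L\<^sup>2(\<real>\<^sup>N)\<close> that vanish almost everywhere outside \<open>\<Omega>\<close>; norm and inner product are
  the restrictions of those of the type.
\<close>

definition L2_on :: "'a::euclidean_space set \<Rightarrow> 'a L2 set" where
  "L2_on \<Omega> = {u. AE x in lborel. x \<notin> \<Omega> \<longrightarrow> rep_L2 u x = 0}"


section \<open>Bounded Lipschitz domains\<close>

text \<open>
  Near each boundary point the set lies strictly on one side of the graph of a Lipschitz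
  function over the hyperplane orthogonal to some unit vector \<open>e\<close>.
\<close>

definition lipschitz_domain :: "'a::euclidean_space set \<Rightarrow> bool" where
  "lipschitz_domain \<Omega> \<longleftrightarrow> open \<Omega> \<and> connected \<Omega> \<and> \<Omega> \<noteq> {} \<and>
     (\<forall>p\<in>frontier \<Omega>. \<exists>e U (\<phi> :: 'a \<Rightarrow> real) L.
        norm e = 1 \<and> open U \<and> p \<in> U \<and> L-lipschitz_on {x. inner x e = 0} \<phi> \<and>
        \<Omega> \<inter> U = {x\<in>U. \<phi> (x - inner x e *\<^sub>R e) < inner x e})"


section \<open>The fractional Dirichlet form\<close>

definition frac_const :: "nat \<Rightarrow> real \<Rightarrow> real" where
  "frac_const N s =
     4 powr s * s * Gamma (real N / 2 + s) / (pi powr (real N / 2) * Gamma (1 - s))"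

text \<open>On the diagonal the quotient is 0 by convention; the diagonal is a null set.\<close>

definition gagliardo_integrand ::
  "real \<Rightarrow> 'a::euclidean_space L2 \<Rightarrow> 'a L2 \<Rightarrow> 'a \<times> 'a \<Rightarrow> real" where
  "gagliardo_integrand s u v = (\<lambda>(x, y).
     (rep_L2 u x - rep_L2 u y) * (rep_L2 v x - rep_L2 v y)
       / norm (x - y) powr (real DIM('a) + 2 * s))"

definition frac_sobolev :: "real \<Rightarrow> 'a::euclidean_space L2 set" where
  "frac_sobolev s = {u. integrable (lborel \<Otimes>\<^sub>M lborel) (gagliardo_integrand s u u)}"

definition H0s :: "'a::euclidean_space set \<Rightarrow> real \<Rightarrow> 'a L2 set" where
  "H0s \<Omega> s = {u \<in> frac_sobolev s. AE x in lborel. x \<notin> \<Omega> \<longrightarrow> rep_L2 u x = 0}"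

definition dirichlet_form ::
  "'a::euclidean_space set \<Rightarrow> real \<Rightarrow> 'a L2 \<Rightarrow> 'a L2 \<Rightarrow> real" where
  "dirichlet_form \<Omega> s u v =
     (LINT x:\<Omega>|lborel. rep_L2 u x * rep_L2 v x) +
     frac_const DIM('a) s / 2 *
       (\<integral>p. gagliardo_integrand s u v p \<partial>(lborel \<Otimes>\<^sub>M lborel))"

definition H0s_norm :: "'a::euclidean_space set \<Rightarrow> real \<Rightarrow> 'a L2 \<Rightarrow> real" where
  "H0s_norm \<Omega> s u = sqrt (dirichlet_form \<Omega> s u u)"


section \<open>Operators on a Hilbert space and their real powers\<close>

text \<open>
  Hilbert spaces are linear subspaces \<open>H\<close> of an inner product type. Possibly unbounded
  operators in \<open>H\<close> are represented by their graphs.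
\<close>

definition bounded_linear_between ::
  "'b::real_vector set \<Rightarrow> ('b \<Rightarrow> real) \<Rightarrow> 'c::real_vector set \<Rightarrow> ('c \<Rightarrow> real) \<Rightarrow> ('b \<Rightarrow> 'c) \<Rightarrow> bool" where
  "bounded_linear_between X nX Y nY T \<longleftrightarrow>
     T ` X \<subseteq> Y \<and>
     (\<forall>x\<in>X. \<forall>y\<in>X. T (x + y) = T x + T y) \<and>
     (\<forall>c. \<forall>x\<in>X. T (c *\<^sub>R x) = c *\<^sub>R T x) \<and>
     (\<exists>C. \<forall>x\<in>X. nY (T x) \<le> C * nX x)"

definition adjoint_on :: "'h::real_inner set \<Rightarrow> ('h \<Rightarrow> 'h) \<Rightarrow> 'h \<Rightarrow> 'h" where
  "adjoint_on H T y = (THE z. z \<in> H \<and> (\<forall>x\<in>H. inner (T x) y = inner x z))"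

definition graph_on :: "'h set \<Rightarrow> ('h \<Rightarrow> 'h) \<Rightarrow> ('h \<times> 'h) set" where
  "graph_on H T = {(x, T x) | x. x \<in> H}"

definition op_apply :: "('h \<times> 'h) set \<Rightarrow> 'h \<Rightarrow> 'h" where
  "op_apply T x = (THE y. (x, y) \<in> T)"

text \<open>Resolutions of the identity: right-continuous spectral families of orthogonal projections.\<close>

definition spectral_family :: "'h::real_inner set \<Rightarrow> (real \<Rightarrow> 'h \<Rightarrow> 'h) \<Rightarrow> bool" where
  "spectral_family H E \<longleftrightarrow>
     (\<forall>t. bounded_linear_between H norm H norm (E t)) \<and>
     (\<forall>t. \<forall>x\<in>H. \<forall>y\<in>H. inner (E t x) y = inner x (E t y)) \<and>
     (\<forall>t t'. \<forall>x\<in>H. E t (E t' x) = E (min t t') x) \<and>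
     (\<forall>t. \<forall>x\<in>H. ((\<lambda>t'. E t' x) \<longlongrightarrow> E t x) (at_right t)) \<and>
     (\<forall>x\<in>H. ((\<lambda>t. E t x) \<longlongrightarrow> 0) at_bot) \<and>
     (\<forall>x\<in>H. ((\<lambda>t. E t x) \<longlongrightarrow> x) at_top)"

text \<open>The Lebesgue--Stieltjes measure \<open>d\<langle>E\<^sub>t x, x\<rangle>\<close>.\<close>

definition spectral_meas :: "(real \<Rightarrow> 'h::real_inner \<Rightarrow> 'h) \<Rightarrow> 'h \<Rightarrow> real measure" where
  "spectral_meas E x = interval_measure (\<lambda>t. inner (E t x) x)"

text \<open>
  The graph of \<open>\<integral> f(t) dE\<^sub>t\<close>. Its domain \<open>D\<close> consists of the \<open>x\<close> with
  \<open>\<integral> f(t)\<^sup>2 d\<langle>E\<^sub>t x, x\<rangle> < \<infinity>\<close>, and its value \<open>y\<close> at \<open>x\<close> is determined by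
  \<open>\<langle>y, v\<rangle> = \<integral> f(t) d\<langle>E\<^sub>t x, v\<rangle>\<close> for \<open>v\<close> in the dense subspace \<open>D\<close>, where the signed
  measure \<open>d\<langle>E\<^sub>t x, v\<rangle>\<close> is expressed by polarization.
\<close>

definition spectral_dom ::
  "'h::real_inner set \<Rightarrow> (real \<Rightarrow> 'h \<Rightarrow> 'h) \<Rightarrow> (real \<Rightarrow> real) \<Rightarrow> 'h set" where
  "spectral_dom H E f = {x\<in>H. integrable (spectral_meas E x) (\<lambda>t. (f t)\<^sup>2)}"

definition spectral_integral ::
  "'h::real_inner set \<Rightarrow> (real \<Rightarrow> 'h \<Rightarrow> 'h) \<Rightarrow> (real \<Rightarrow> real) \<Rightarrow> ('h \<times> 'h) set" where
  "spectral_integral H E f =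
     {(x, y). x \<in> spectral_dom H E f \<and> y \<in> H \<and>
        (\<forall>v\<in>spectral_dom H E f.
           inner y v = ((\<integral>t. f t \<partial>spectral_meas E (x + v))
                        - (\<integral>t. f t \<partial>spectral_meas E (x - v))) / 4)}"

text \<open>
  The spectral family \<open>E\<close> of a self-adjoint operator \<open>T\<close>, that is \<open>T = \<integral> t dE\<^sub>t\<close>; by the
  spectral theorem it exists and is uniquely determined on \<open>H\<close>.
\<close>

definition spectral_family_of ::
  "'h::real_inner set \<Rightarrow> ('h \<times> 'h) set \<Rightarrow> real \<Rightarrow> 'h \<Rightarrow> 'h" where
  "spectral_family_of H T = (SOME E. spectral_family H E \<and> T = spectral_integral H E (\<lambda>t. t))"

text \<open>
  Real powers of a positive self-adjoint operator, whose spectral measures live on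
  \<open>[0, \<infinity>)\<close>. The convention \<open>0 powr r = 0\<close> is correct for \<open>r > 0\<close> and irrelevant for
  injective operators.
\<close>

definition op_powr ::
  "'h::real_inner set \<Rightarrow> ('h \<times> 'h) set \<Rightarrow> real \<Rightarrow> ('h \<times> 'h) set" where
  "op_powr H T r = spectral_integral H (spectral_family_of H T) (\<lambda>t. t powr r)"


section \<open>Tikhonov regularization in fractional Sobolev spaces\<close>

text \<open>The operator \<open>I + (-\<Delta>)\<^sup>s\<close> in \<open>L\<^sup>2(\<Omega>)\<close> associated with the fractional Dirichlet form.\<close>

definition A_op :: "'a::euclidean_space set \<Rightarrow> real \<Rightarrow> ('a L2 \<times> 'a L2) set" where
  "A_op \<Omega> s = {(u, f). u \<in> H0s \<Omega> s \<and> f \<in> L2_on \<Omega> \<and>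
     (\<forall>v\<in>H0s \<Omega> s. dirichlet_form \<Omega> s u v = inner f v)}"

definition A_powr :: "'a::euclidean_space set \<Rightarrow> real \<Rightarrow> real \<Rightarrow> 'a L2 \<Rightarrow> 'a L2" where
  "A_powr \<Omega> s r = op_apply (op_powr (L2_on \<Omega>) (A_op \<Omega> s) r)"

definition B_op ::
  "'a::euclidean_space set \<Rightarrow> real \<Rightarrow> ('a L2 \<Rightarrow> 'a L2) \<Rightarrow> 'a L2 \<Rightarrow> 'a L2" where
  "B_op \<Omega> s K f = K (A_powr \<Omega> s (- 1 / 2) f)"

text \<open>\<open>(B\<^sup>*B)\<^sup>\<beta>\<close>\<close>

definition BB_powr ::
  "'a::euclidean_space set \<Rightarrow> real \<Rightarrow> ('a L2 \<Rightarrow> 'a L2) \<Rightarrow> real \<Rightarrow> 'a L2 \<Rightarrow> 'a L2" where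
  "BB_powr \<Omega> s K \<beta> = op_apply (op_powr (L2_on \<Omega>)
     (graph_on (L2_on \<Omega>) (\<lambda>f. adjoint_on (L2_on \<Omega>) (B_op \<Omega> s K) (B_op \<Omega> s K f))) \<beta>)"

definition tikhonov ::
  "'a::euclidean_space set \<Rightarrow> real \<Rightarrow> ('a L2 \<Rightarrow> 'a L2) \<Rightarrow> real \<Rightarrow> 'a L2 \<Rightarrow> 'a L2 \<Rightarrow> real" where
  "tikhonov \<Omega> s K \<alpha> y u = 1 / 2 * (norm (K u - y))\<^sup>2 + \<alpha> / 2 * (H0s_norm \<Omega> s u)\<^sup>2"

definition is_minimizer :: "'b set \<Rightarrow> ('b \<Rightarrow> real) \<Rightarrow> 'b \<Rightarrow> bool" where
  "is_minimizer X J u \<longleftrightarrow> u \<in> X \<and> (\<forall>v\<in>X. J u \<le> J v)"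

definition tikhonov_minimizer ::
  "'a::euclidean_space set \<Rightarrow> real \<Rightarrow> ('a L2 \<Rightarrow> 'a L2) \<Rightarrow> real \<Rightarrow> 'a L2 \<Rightarrow> 'a L2" where
  "tikhonov_minimizer \<Omega> s K \<alpha> y = (THE u. is_minimizer (H0s \<Omega> s) (tikhonov \<Omega> s K \<alpha> y) u)"

definition c_const :: "real \<Rightarrow> real" where
  "c_const \<beta> = (if \<beta> = 1 then 1 else \<beta> powr \<beta> * (1 - \<beta>) powr (1 - \<beta>))"

text \<open>
  A random element of \<open>L\<^sup>2(\<Omega>)\<close> with second moment at most \<open>\<delta>\<^sup>2\<close>. As \<open>L\<^sup>2\<close> is separable,
  Borel and strong measurability coincide.
\<close>

definition noise ::
  "'p measure \<Rightarrow> 'a::euclidean_space set \<Rightarrow> real \<Rightarrow> ('p \<Rightarrow> 'a L2) \<Rightarrow> bool" where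
  "noise M \<Omega> \<delta> \<eta> \<longleftrightarrow>
     \<eta> \<in> borel_measurable M \<and> \<eta> ` space M \<subseteq> L2_on \<Omega> \<and>
     integrable M (\<lambda>\<omega>. (norm (\<eta> \<omega>))\<^sup>2) \<and>
     (\<integral>\<omega>. (norm (\<eta> \<omega>))\<^sup>2 \<partial>M) \<le> \<delta>\<^sup>2"

end

theory Submission
  imports Defs
begin

text \<open>
  The substitution \<open>u = A\<^sup>-\<^sup>1\<^sup>/\<^sup>2 z\<close> turns the functional into ordinary Tikhonov
  regularization for \<open>B\<close>, with minimizer \<open>(B\<^sup>*B + \<alpha>)\<^sup>-\<^sup>1 B\<^sup>* y\<close>. The error splits into the
  bias \<open>\<alpha> (B\<^sup>*B + \<alpha>)\<^sup>-\<^sup>1 z\<close>, controlled on the spectrum by \<open>\<alpha> t\<^sup>\<beta> / (\<alpha> + t) \<le> c \<alpha>\<^sup>\<beta>\<close>,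
  and the noise term, for which \<open>\<parallel>(B\<^sup>*B + \<alpha>)\<^sup>-\<^sup>1 B\<^sup>* e\<parallel>\<^sup>2 \<le> \<parallel>e\<parallel>\<^sup>2 / (4 \<alpha>)\<close>.

  The spectral theorem behind the operator powers rests on an elementary description of spectral
  subspaces: for \<open>S = T (I + T)\<^sup>-\<^sup>1\<close> the subspace where \<open>T \<le> t\<close> consists of the vectors \<open>x\<close>
  whose moments \<open>\<langle>S\<^sup>n x, x\<rangle>\<close> grow at most like \<open>(t / (1 + t))\<^sup>n\<close>, and log-convexity of the
  moments shows that \<open>T \<ge> t\<close> on its orthogonal complement. The operator of the Dirichlet form is
  single-valued because Lipschitz cutoff functions make the form domain dense.
\<close>

section \<open>Symmetric positive forms\<close>

text \<open>The powers are defined through \<open>SOME\<close>, so nothing is known of a chosen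
  spectral family beyond its axioms and the operator it represents. The functional calculus is
  therefore built for an arbitrary spectral family and used three times: for the constructed family,
  which proves existence, and for the chosen families of \<open>A_op\<close> and of
  \<open>B\<^sup>*B\<close>. Positivity of these operators has to be recovered for the chosen
  families, as an almost everywhere lower bound under their spectral measures. A spectral measure
  depends quadratically on its vector. Linearity and multiplicativity of the calculus therefore
  become linear relations between finitely many finite measures, checked on half-lines, where they
  are identities for the projections, and then carried over to integrals. The bounded transform S
  replaces T because moments then exist for every vector; t / (1 + t) is the level of S that
  corresponds to the level t of T. The constants of the theorem come from |p - q|^2 <= 2|p|^2 +
  2|q|^2 for noise part p and bias part q: the bias bound is doubled and 1/(4\<alpha>) becomes
  1/(2\<alpha>).\<close>

locale semi_form =
  fixes X :: "'b::real_vector set" and a :: "'b \<Rightarrow> 'b \<Rightarrow> real"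
  assumes sub: "subspace X"
    and add: "\<And>x y z. x \<in> X \<Longrightarrow> y \<in> X \<Longrightarrow> z \<in> X \<Longrightarrow> a (x + y) z = a x z + a y z"
    and scale: "\<And>c x z. x \<in> X \<Longrightarrow> z \<in> X \<Longrightarrow> a (c *\<^sub>R x) z = c * a x z"
    and sym: "\<And>x y. x \<in> X \<Longrightarrow> y \<in> X \<Longrightarrow> a x y = a y x"
    and nonneg: "\<And>x. x \<in> X \<Longrightarrow> 0 \<le> a x x"
begin

lemma mem_add [simp]: "x \<in> X \<Longrightarrow> y \<in> X \<Longrightarrow> x + y \<in> X"
  and mem_scale [simp]: "x \<in> X \<Longrightarrow> c *\<^sub>R x \<in> X"
  and mem_diff [simp]: "x \<in> X \<Longrightarrow> y \<in> X \<Longrightarrow> x - y \<in> X"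
  and mem_zero [simp]: "0 \<in> X"
  using sub by (auto simp: subspace_add subspace_scale subspace_diff subspace_0)

lemma add_right: "x \<in> X \<Longrightarrow> y \<in> X \<Longrightarrow> z \<in> X \<Longrightarrow> a z (x + y) = a z x + a z y"
  using add[of x y z] sym by simp

lemma scale_right: "x \<in> X \<Longrightarrow> z \<in> X \<Longrightarrow> a z (c *\<^sub>R x) = c * a z x"
  using scale[of x z c] sym by simp

lemma diff: "x \<in> X \<Longrightarrow> y \<in> X \<Longrightarrow> z \<in> X \<Longrightarrow> a (x - y) z = a x z - a y z"
  using add[of "x - y" y z] by simp

lemma diff_right: "x \<in> X \<Longrightarrow> y \<in> X \<Longrightarrow> z \<in> X \<Longrightarrow> a z (x - y) = a z x - a z y"
  using diff[of x y z] sym by simp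

lemma square_add_scale:
  assumes "x \<in> X" "y \<in> X"
  shows "a (x + t *\<^sub>R y) (x + t *\<^sub>R y) = a x x + 2 * t * a x y + t\<^sup>2 * a y y"
  using assms sym[of y x]
  by (simp add: add add_right scale scale_right power2_eq_square algebra_simps)

text \<open>Near t = 0 the linear term dominates. The test value t = -p/k, with k > 0 not below q,
  makes the expression at most -p^2/k. This is the first-order condition in
  \<open>riesz\<close>.\<close>

lemma quadratic_nonneg_zero:
  fixes p q :: real
  assumes "\<And>t. 0 \<le> 2 * t * p + t\<^sup>2 * q"
  shows "p = 0"
proof (rule ccontr)
  assume p: "p \<noteq> 0"
  define k where "k = \<bar>q\<bar> + 1"
  have k: "k > 0" "q \<le> k" unfolding k_def by auto
  have "0 \<le> 2 * (- p / k) * p + (- p / k)\<^sup>2 * q" by (rule assms)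
  also have "\<dots> \<le> 2 * (- p / k) * p + (- p / k)\<^sup>2 * k"
    using k by (intro add_left_mono mult_left_mono) auto
  also have "\<dots> = - (p\<^sup>2 / k)"
    using k by (simp add: field_simps power2_eq_square)
  also have "\<dots> < 0" using p k by simp
  finally show False by simp
qed

lemma Cauchy_Schwarz:
  assumes "x \<in> X" "y \<in> X"
  shows "(a x y)\<^sup>2 \<le> a x x * a y y"
proof (cases "a y y = 0")
  case True
  have "a x y = 0"
  proof (rule ccontr)
    assume n: "a x y \<noteq> 0"
    \<comment> \<open>The form may vanish at y without y being 0. Along y the square is then affine
      in the multiplier, and this multiplier brings it to -1.\<close>
    have "0 \<le> a (x + (- (a x x + 1) / (2 * a x y)) *\<^sub>R y) (x + (- (a x x + 1) / (2 * a x y)) *\<^sub>R y)"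
      using assms by (intro nonneg) simp
    then show False using n True assms by (simp add: square_add_scale field_simps)
  qed
  then show ?thesis using True by simp
next
  case False
  then have pos: "a y y > 0" using nonneg[OF assms(2)] by simp
  have "0 \<le> a (x + (- a x y / a y y) *\<^sub>R y) (x + (- a x y / a y y) *\<^sub>R y)"
    using assms by (intro nonneg) simp
  also have "\<dots> = a x x - (a x y)\<^sup>2 / a y y"
    unfolding square_add_scale[OF assms] using pos by (simp add: field_simps power2_eq_square)
  finally show ?thesis using pos by (simp add: field_simps)
qed

lemma abs_le_sqrt: "x \<in> X \<Longrightarrow> y \<in> X \<Longrightarrow> \<bar>a x y\<bar> \<le> sqrt (a x x) * sqrt (a y y)"
  using Cauchy_Schwarz[of x y] by (metis real_le_rsqrt real_sqrt_mult power2_abs)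

lemma parallelogram:
  assumes "x \<in> X" "y \<in> X"
  shows "a (x + y) (x + y) + a (x - y) (x - y) = 2 * a x x + 2 * a y y"
  using assms sym[of x y] by (simp add: add add_right diff diff_right)

text \<open>Completeness is meant in the norm of the form, which differs from the norm of the
  ambient type; hence explicit sequences instead of \<open>complete\<close>.\<close>

definition form_complete :: bool where
  "form_complete \<longleftrightarrow> (\<forall>f. (\<forall>n::nat. f n \<in> X) \<longrightarrow>
     (\<forall>e>0. \<exists>N. \<forall>m\<ge>N. \<forall>n\<ge>N. a (f m - f n) (f m - f n) < e) \<longrightarrow>
     (\<exists>x\<in>X. (\<lambda>n. a (f n - x) (f n - x)) \<longlonglongrightarrow> 0))"

lemma form_completeD:
  assumes "form_complete" "\<And>n::nat. f n \<in> X"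
    "\<And>e. e > 0 \<Longrightarrow> \<exists>N. \<forall>m\<ge>N. \<forall>n\<ge>N. a (f m - f n) (f m - f n) < e"
  obtains x where "x \<in> X" "(\<lambda>n. a (f n - x) (f n - x)) \<longlonglongrightarrow> 0"
  using assms unfolding form_complete_def by blast

lemma tendsto_form:
  assumes "\<And>n::nat. f n \<in> X" "x \<in> X" "v \<in> X" "(\<lambda>n. a (f n - x) (f n - x)) \<longlonglongrightarrow> 0"
  shows "(\<lambda>n. a (f n) v) \<longlonglongrightarrow> a x v"
proof -
  have "(\<lambda>n. sqrt (a (f n - x) (f n - x)) * sqrt (a v v)) \<longlonglongrightarrow> 0"
    using tendsto_mult[OF tendsto_real_sqrt[OF assms(4)] tendsto_const] by simp
  then have "(\<lambda>n. a (f n - x) v) \<longlonglongrightarrow> 0"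
    by (rule Lim_null_comparison[rotated]) (use assms in \<open>auto intro!: always_eventually abs_le_sqrt\<close>)
  then have "(\<lambda>n. a (f n) v - a x v) \<longlonglongrightarrow> 0" using assms by (simp add: diff)
  then show ?thesis by (simp add: LIM_zero_iff)
qed

text \<open>Energy minimization: \<open>J\<close> is bounded below by -C^2, a minimizing sequence is
  Cauchy by the parallelogram law, and the vanishing first variation at its limit is the
  representation.\<close>

lemma riesz:
  assumes compl: form_complete
    and l_add: "\<And>v w. v \<in> X \<Longrightarrow> w \<in> X \<Longrightarrow> l (v + w) = l v + l w"
    and l_scale: "\<And>c v. v \<in> X \<Longrightarrow> l (c *\<^sub>R v) = c * l v"
    and l_bound: "\<And>v. v \<in> X \<Longrightarrow> \<bar>l v\<bar> \<le> C * sqrt (a v v)"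
  obtains u where "u \<in> X" "\<And>v. v \<in> X \<Longrightarrow> a u v = l v"
proof -
  define J where "J v = a v v - 2 * l v" for v
  have J_lower: "- C\<^sup>2 \<le> J v" if "v \<in> X" for v
  proof -
    have "l v \<le> C * sqrt (a v v)" using l_bound[OF that] by simp
    moreover have "(sqrt (a v v) - C)\<^sup>2 = a v v - 2 * (C * sqrt (a v v)) + C\<^sup>2"
      using nonneg[OF that] by (simp add: power2_diff)
    moreover have "0 \<le> (sqrt (a v v) - C)\<^sup>2" by simp
    ultimately show ?thesis unfolding J_def by linarith
  qed
  define d where "d = Inf (J ` X)"
  have bdd: "bdd_below (J ` X)" using J_lower by (auto intro!: bdd_belowI2[where m="- C\<^sup>2"])
  have d_le: "d \<le> J v" if "v \<in> X" for v
    unfolding d_def using that bdd by (intro cInf_lower) auto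
  have "\<exists>v. v \<in> X \<and> J v < d + 1 / real (Suc n)" for n
  proof -
    have "J ` X \<noteq> {}" using mem_zero by blast
    from cInf_lessD[OF this, of "d + 1 / real (Suc n)"] show ?thesis unfolding d_def by auto
  qed
  then obtain f where fX: "\<And>n::nat. f n \<in> X" and fJ: "\<And>n. J (f n) < d + 1 / real (Suc n)"
    by metis
  \<comment> \<open>The linear part of \<open>J\<close> cancels, so two near-minimizers are close
    because their midpoint has value at least \<open>d\<close>.\<close>
  have J_mid: "a (x - y) (x - y) = 2 * J x + 2 * J y - 4 * J ((1/2) *\<^sub>R (x + y))"
    if "x \<in> X" "y \<in> X" for x y
    using that sym[of x y]
    by (simp add: J_def scale scale_right add add_right diff diff_right l_add l_scale algebra_simps)
  have cau: "a (f m - f n) (f m - f n) \<le> 2 * (1 / real (Suc m)) + 2 * (1 / real (Suc n))" for m n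
    using J_mid[OF fX fX, of m n] fJ[of m] fJ[of n] d_le[of "(1/2) *\<^sub>R (f m + f n)"] fX[of m] fX[of n] by fastforce
  have "\<exists>N. \<forall>m\<ge>N. \<forall>n\<ge>N. a (f m - f n) (f m - f n) < e" if "e > 0" for e
  proof -
    obtain N where N: "1 / real (Suc N) < e / 4"
      using nat_approx_posE[of "e / 4"] \<open>e > 0\<close> by auto
    have "a (f m - f n) (f m - f n) < e" if "m \<ge> N" "n \<ge> N" for m n
    proof -
      have "1 / real (Suc m) \<le> 1 / real (Suc N)" "1 / real (Suc n) \<le> 1 / real (Suc N)"
        using that by (auto simp: field_simps)
      then show ?thesis using cau[of m n] N by linarith
    qed
    then show ?thesis by blast
  qed
  from form_completeD[OF compl fX this]
  obtain u where u: "u \<in> X" and lim: "(\<lambda>n. a (f n - u) (f n - u)) \<longlonglongrightarrow> 0" by blast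
  have l_diff: "l (v - w) = l v - l w" if "v \<in> X" "w \<in> X" for v w
    using l_add[of "v - w" w] that by simp
  have "(\<lambda>n. C * sqrt (a (f n - u) (f n - u))) \<longlonglongrightarrow> 0"
    using tendsto_mult[OF tendsto_const tendsto_real_sqrt[OF lim]] by simp
  then have "(\<lambda>n. l (f n - u)) \<longlonglongrightarrow> 0"
    by (rule Lim_null_comparison[rotated]) (use fX u l_bound in \<open>auto intro!: always_eventually\<close>)
  then have liml: "(\<lambda>n. l (f n)) \<longlonglongrightarrow> l u" using fX u by (simp add: l_diff LIM_zero_iff)
  have "a (f n) (f n) = a (f n - u) (f n - u) + 2 * a (f n) u - a u u" for n
    using fX u sym[of u "f n"] by (simp add: diff diff_right)
  moreover have "(\<lambda>n. a (f n - u) (f n - u) + 2 * a (f n) u - a u u) \<longlonglongrightarrow> 0 + 2 * a u u - a u u"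
    by (intro tendsto_intros lim tendsto_form fX u)
  ultimately have "(\<lambda>n. J (f n)) \<longlonglongrightarrow> J u"
    unfolding J_def using liml by (auto intro!: tendsto_intros)
  moreover have "(\<lambda>n. d + 1 / real (Suc n)) \<longlonglongrightarrow> d + 0"
    by (intro tendsto_intros LIMSEQ_Suc lim_1_over_n)
  ultimately have "J u \<le> d"
    using LIMSEQ_le[of "\<lambda>n. J (f n)" "J u" "\<lambda>n. d + 1 / real (Suc n)" d] fJ by (auto intro: less_imp_le)
  have "a u v = l v" if v: "v \<in> X" for v
  proof -
    have "0 \<le> 2 * t * (a u v - l v) + t\<^sup>2 * a v v" for t
    proof -
      have "J u \<le> J (u + t *\<^sub>R v)" using \<open>J u \<le> d\<close> d_le[of "u + t *\<^sub>R v"] u v by simp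
      then show ?thesis unfolding J_def square_add_scale[OF u v]
        using u v by (simp add: l_add l_scale algebra_simps)
    qed
    from quadratic_nonneg_zero[OF this] show ?thesis by simp
  qed
  with u that show ?thesis by blast
qed

end

section \<open>Complete subspaces of an inner product space\<close>

locale hilbert =
  fixes H :: "'h::real_inner set"
  assumes subH: "subspace H" and completeH: "Topological_Spaces.complete H"
begin

lemma H_add [simp]: "x \<in> H \<Longrightarrow> y \<in> H \<Longrightarrow> x + y \<in> H"
  and H_scale [simp]: "x \<in> H \<Longrightarrow> c *\<^sub>R x \<in> H"
  and H_diff [simp]: "x \<in> H \<Longrightarrow> y \<in> H \<Longrightarrow> x - y \<in> H"
  and H_zero [simp]: "0 \<in> H"
  using subH by (auto simp: subspace_add subspace_scale subspace_diff subspace_0)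

lemma H_closed: "closed H" using completeH by (rule complete_imp_closed)

lemma H_limit: "(\<And>n::nat. f n \<in> H) \<Longrightarrow> f \<longlonglongrightarrow> x \<Longrightarrow> x \<in> H"
  using H_closed closed_sequentially by blast

lemma H_Cauchy:
  assumes "\<And>n::nat. f n \<in> H" "Cauchy f"
  obtains x where "x \<in> H" "f \<longlonglongrightarrow> x"
  using completeH assms unfolding complete_def by blast

lemma semi_form_inner: "semi_form H inner"
  by unfold_locales (simp_all add: subH inner_add_left, rule inner_commute)

lemma eqI: "x \<in> H \<Longrightarrow> y \<in> H \<Longrightarrow> (\<And>v. v \<in> H \<Longrightarrow> inner x v = inner y v) \<Longrightarrow> x = y"
  by (metis H_diff inner_diff_left inner_eq_zero_iff eq_iff_diff_eq_0)

lemma Cauchy_inner: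
  fixes f :: "nat \<Rightarrow> 'h"
  assumes "\<And>e. e > 0 \<Longrightarrow> \<exists>N. \<forall>m\<ge>N. \<forall>n\<ge>N. inner (f m - f n) (f m - f n) < e"
  shows "Cauchy f"
proof (rule metric_CauchyI)
  fix e :: real assume "e > 0"
  then obtain N where N: "\<forall>m\<ge>N. \<forall>n\<ge>N. inner (f m - f n) (f m - f n) < e\<^sup>2"
    using assms[of "e\<^sup>2"] by auto
  have "dist (f m) (f n) < e" if "m \<ge> N" "n \<ge> N" for m n
  proof -
    have "(norm (f m - f n))\<^sup>2 < e\<^sup>2" using N that by (simp add: power2_norm_eq_inner)
    then show ?thesis using \<open>e > 0\<close> unfolding dist_norm by (simp add: power2_less_imp_less)
  qed
  then show "\<exists>M. \<forall>m\<ge>M. \<forall>n\<ge>M. dist (f m) (f n) < e" by blast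
qed

text \<open>The two bounds make the form norm equivalent to the norm of \<open>H\<close>, so
  completeness is inherited. This serves perturbations of the identity such as I + S^(2n) and I +
  B^*B.\<close>

lemma riesz_dominating_form:
  assumes "semi_form H a" and "\<And>x. x \<in> H \<Longrightarrow> inner x x \<le> a x x"
    and "\<And>x. x \<in> H \<Longrightarrow> a x x \<le> D * inner x x"
    and "\<And>v w. v \<in> H \<Longrightarrow> w \<in> H \<Longrightarrow> l (v + w) = l v + l w"
    and "\<And>c v. v \<in> H \<Longrightarrow> l (c *\<^sub>R v) = c * l v"
    and "\<And>v. v \<in> H \<Longrightarrow> \<bar>l v\<bar> \<le> C * norm v"
  obtains u where "u \<in> H" "\<And>v. v \<in> H \<Longrightarrow> a u v = l v"
proof -
  interpret semi_form H a by fact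
  have "form_complete"
    unfolding form_complete_def
  proof (intro allI impI)
    fix f :: "nat \<Rightarrow> 'h"
    assume f: "\<forall>n. f n \<in> H" and c: "\<forall>e>0. \<exists>N. \<forall>m\<ge>N. \<forall>n\<ge>N. a (f m - f n) (f m - f n) < e"
    have "Cauchy f"
    proof (rule Cauchy_inner)
      fix e :: real assume "e > 0"
      with c obtain N where "\<forall>m\<ge>N. \<forall>n\<ge>N. a (f m - f n) (f m - f n) < e" by blast
      then show "\<exists>N. \<forall>m\<ge>N. \<forall>n\<ge>N. inner (f m - f n) (f m - f n) < e"
        using f assms(2) by (intro exI[of _ N]) (meson H_diff order_le_less_trans)
    qed
    with f obtain x where x: "x \<in> H" "f \<longlonglongrightarrow> x" using H_Cauchy by blast
    then have "(\<lambda>n. D * inner (f n - x) (f n - x)) \<longlonglongrightarrow> D * inner (x - x) (x - x)"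
      by (intro tendsto_intros)
    then have "(\<lambda>n. D * inner (f n - x) (f n - x)) \<longlonglongrightarrow> 0" by simp
    then have "(\<lambda>n. a (f n - x) (f n - x)) \<longlonglongrightarrow> 0"
      by (rule Lim_null_comparison[rotated])
        (use f x assms(3) nonneg in \<open>auto intro!: always_eventually\<close>)
    with x show "\<exists>x\<in>H. (\<lambda>n. a (f n - x) (f n - x)) \<longlonglongrightarrow> 0" by blast
  qed
  moreover have "\<bar>l v\<bar> \<le> \<bar>C\<bar> * sqrt (a v v)" if "v \<in> H" for v
  proof -
    have "\<bar>l v\<bar> \<le> C * norm v" using assms(6) that by blast
    also have "\<dots> \<le> \<bar>C\<bar> * norm v" by (intro mult_right_mono) auto
    also have "\<dots> \<le> \<bar>C\<bar> * sqrt (a v v)"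
      using assms(2)[OF that] by (intro mult_left_mono) (auto simp: norm_eq_sqrt_inner)
    finally show ?thesis .
  qed
  ultimately show ?thesis using riesz[OF _ assms(4,5)] that by blast
qed

lemma riesz:
  assumes "\<And>v w. v \<in> H \<Longrightarrow> w \<in> H \<Longrightarrow> l (v + w) = l v + l w"
    and "\<And>c v. v \<in> H \<Longrightarrow> l (c *\<^sub>R v) = c * l v"
    and "\<And>v. v \<in> H \<Longrightarrow> \<bar>l v\<bar> \<le> C * norm v"
  obtains u where "u \<in> H" "\<And>v. v \<in> H \<Longrightarrow> inner u v = l v"
  by (rule riesz_dominating_form[of inner 1 l C]) (use assms semi_form_inner in auto)

text \<open>The projection represents the functional v -> <x, v> on \<open>M\<close>, which is
  itself complete.\<close>

lemma projection_exists:
  assumes "subspace M" "closed M" "M \<subseteq> H" "x \<in> H"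
  obtains p where "p \<in> M" "\<And>v. v \<in> M \<Longrightarrow> inner p v = inner x v"
proof -
  have "Topological_Spaces.complete M" using completeH assms by (meson complete_closed_subset)
  then interpret M: hilbert M using assms by unfold_locales
  show ?thesis
    by (rule M.riesz[of "inner x" "norm x"])
      (use that in \<open>auto simp: inner_add_right Cauchy_Schwarz_ineq2\<close>)
qed

text \<open>Stands in for weak compactness of bounded sets. Elements of \<open>V n\<close> of almost
  minimal norm form a Cauchy sequence: the minimal norms increase to a finite limit, and the
  midpoint of two such elements stays in the larger of the two sets.\<close>

lemma nested_convex_nonempty:
  fixes V :: "nat \<Rightarrow> 'h set"
  assumes ne: "\<And>n. V n \<noteq> {}" and conv: "\<And>n. convex (V n)" and cl: "\<And>n. closed (V n)"
    and VH: "\<And>n. V n \<subseteq> H" and dec: "\<And>m n. m \<le> n \<Longrightarrow> V n \<subseteq> V m"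
    and bd: "\<And>n x. x \<in> V n \<Longrightarrow> norm x \<le> B"
  obtains p where "\<And>n. p \<in> V n"
proof -
  define d where "d n = Inf (norm ` V n)" for n
  have bdd: "bdd_below (norm ` V n)" for n by (auto intro!: bdd_belowI2[where m=0])
  have d_le: "d n \<le> norm x" if "x \<in> V n" for n x
    unfolding d_def using that bdd by (intro cInf_lower) auto
  have d0: "0 \<le> d n" for n unfolding d_def using ne by (intro cInf_greatest) auto
  have dB: "d n \<le> B" for n using ne[of n] d_le bd by (meson equals0I order_trans)
  have "incseq d"
    unfolding incseq_def d_def using ne dec bdd
    by (auto intro!: cInf_superset_mono image_mono)
  then obtain L where L: "d \<longlonglongrightarrow> L" using incseq_convergent[of d B] dB by blast
  have dL: "d n \<le> L" for n using \<open>incseq d\<close> L by (simp add: incseq_le)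
  have "\<exists>v. v \<in> V n \<and> norm v < d n + 1 / real (Suc n)" for n
  proof -
    have "norm ` V n \<noteq> {}" using ne by blast
    from cInf_lessD[OF this, of "d n + 1 / real (Suc n)"] show ?thesis unfolding d_def by auto
  qed
  then obtain f where fV: "\<And>n::nat. f n \<in> V n" and fd: "\<And>n. norm (f n) < d n + 1 / real (Suc n)"
    by metis
  define g where "g n = (L + 1 / real (Suc n))\<^sup>2 - (d n)\<^sup>2" for n
  have "g \<longlonglongrightarrow> (L + 0)\<^sup>2 - L\<^sup>2" unfolding g_def
    by (intro tendsto_intros LIMSEQ_Suc lim_1_over_n L)
  then have g0: "g \<longlonglongrightarrow> 0" by simp
  have key: "inner (f m - f n) (f m - f n) \<le> 4 * g n" if "n \<le> m" for m n
  proof -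
    have "(1/2) *\<^sub>R f m + (1/2) *\<^sub>R f n \<in> V n"
      using fV[of n] fV[of m] dec[OF that] conv[of n] by (auto intro!: convexD)
    then have "d n \<le> norm ((1/2) *\<^sub>R f m + (1/2) *\<^sub>R f n)" by (rule d_le)
    then have 1: "(d n)\<^sup>2 \<le> inner ((1/2) *\<^sub>R f m + (1/2) *\<^sub>R f n) ((1/2) *\<^sub>R f m + (1/2) *\<^sub>R f n)"
      unfolding power2_norm_eq_inner[symmetric] using d0 by (intro power_mono) auto
    have "norm (f m) \<le> L + 1 / real (Suc n)"
    proof -
      have "1 / real (Suc m) \<le> 1 / real (Suc n)" using that by (auto simp: field_simps)
      then show ?thesis using fd[of m] dL[of m] by linarith
    qed
    then have 2: "inner (f m) (f m) \<le> (L + 1 / real (Suc n))\<^sup>2"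
      unfolding power2_norm_eq_inner[symmetric] by (intro power_mono) auto
    have "norm (f n) \<le> L + 1 / real (Suc n)" using fd[of n] dL[of n] by linarith
    then have 3: "inner (f n) (f n) \<le> (L + 1 / real (Suc n))\<^sup>2"
      unfolding power2_norm_eq_inner[symmetric] by (intro power_mono) auto
    from 1 2 3 show ?thesis unfolding g_def
      by (simp add: inner_add_left inner_add_right inner_diff_left inner_diff_right
          inner_commute algebra_simps)
  qed
  have "Cauchy f"
  proof (rule Cauchy_inner)
    fix e :: real assume "e > 0"
    then have "\<forall>\<^sub>F n in sequentially. g n < e / 4" using order_tendstoD(2)[OF g0, of "e/4"] by simp
    then obtain N where N: "\<And>n. n \<ge> N \<Longrightarrow> g n < e / 4" unfolding eventually_sequentially by blast
    have "inner (f m - f n) (f m - f n) < e" if "m \<ge> N" "n \<ge> N" for m n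
    proof (cases "n \<le> m")
      case True then show ?thesis using key[OF True] N[of n] that by simp
    next
      case False
      then have "inner (f n - f m) (f n - f m) < e" using key[of m n] N[of m] that by simp
      then show ?thesis
        by (simp add: inner_diff_left inner_diff_right inner_commute algebra_simps)
    qed
    then show "\<exists>N. \<forall>m\<ge>N. \<forall>n\<ge>N. inner (f m - f n) (f m - f n) < e" by blast
  qed
  then obtain p where p: "p \<in> H" "f \<longlonglongrightarrow> p" using H_Cauchy fV VH by blast
  have "p \<in> V n" for n
  proof (rule closed_sequentially[OF cl])
    show "(\<lambda>k. f (k + n)) \<longlonglongrightarrow> p" using p by (simp add: LIMSEQ_ignore_initial_segment)
    show "f (k + n) \<in> V n" for k using fV[of "k + n"] dec[of n "k + n"] by auto
  qed
  with that show ?thesis by blast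
qed

end

section \<open>Log-convex sequences\<close>

text \<open>Log-convexity makes the ratios of consecutive terms nondecreasing. The form without
  division covers vanishing terms, after which everything vanishes.\<close>

lemma logconvex_ratio_mono:
  fixes m :: "nat \<Rightarrow> real"
  assumes nonneg: "\<And>n. 0 \<le> m n" and lc: "\<And>n. (m (Suc n))\<^sup>2 \<le> m n * m (Suc (Suc n))"
    and k: "r * m k \<le> m (Suc k)" "k \<le> n"
  shows "r * m n \<le> m (Suc n)"
  using k(2)
proof (induction n rule: dec_induct)
  case base
  show ?case by (rule k)
next
  case (step n)
  show ?case
  proof (cases "m n = 0")
    case True
    then have "m (Suc n) = 0" using lc[of n] by simp
    then show ?thesis using nonneg by simp
  next
    case False
    then have pos: "0 < m n" using nonneg[of n] by simp
    have "m n * (r * m (Suc n)) = (r * m n) * m (Suc n)" by simp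
    also have "\<dots> \<le> m (Suc n) * m (Suc n)" using step.IH nonneg by (intro mult_right_mono)
    also have "\<dots> \<le> m n * m (Suc (Suc n))" using lc[of n] by (simp add: power2_eq_square)
    finally show ?thesis using pos by simp
  qed
qed

text \<open>A single ratio above \<mu> would persist and produce geometric growth at a rate r >
  \<mu>, beating C \<mu>^n. An asymptotic bound thus controls every ratio, in particular the
  first.\<close>

lemma logconvex_growth_ratio:
  fixes m :: "nat \<Rightarrow> real"
  assumes nonneg: "\<And>n. 0 \<le> m n" and lc: "\<And>n. (m (Suc n))\<^sup>2 \<le> m n * m (Suc (Suc n))"
    and bound: "\<And>n. m n \<le> C * \<mu> ^ n" and "0 \<le> \<mu>"
  shows "m (Suc k) \<le> \<mu> * m k"
proof (rule ccontr)
  assume "\<not> ?thesis"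
  then have gt: "\<mu> * m k < m (Suc k)" by simp
  have "m k \<noteq> 0"
  proof
    assume "m k = 0"
    then have "m (Suc k) = 0" using lc[of k] by simp
    with gt \<open>m k = 0\<close> show False by simp
  qed
  then have pos: "0 < m k" using nonneg[of k] by simp
  define r where "r = m (Suc k) / m k"
  have r: "r * m k = m (Suc k)" "\<mu> < r" using pos gt by (auto simp: r_def field_simps)
  have grow: "r ^ j * m k \<le> m (k + j)" for j
  proof (induction j)
    case (Suc j)
    have "r ^ Suc j * m k = r * (r ^ j * m k)" by simp
    also have "\<dots> \<le> r * m (k + j)" using Suc r \<open>0 \<le> \<mu>\<close> by (intro mult_left_mono) auto
    also have "\<dots> \<le> m (k + Suc j)"
      using logconvex_ratio_mono[where m=m, OF nonneg lc, of r k "k + j"] r by simp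
    finally show ?case .
  qed simp
  show False
  proof (cases "\<mu> = 0")
    case True
    then show False using bound[of "Suc k"] gt by simp
  next
    case False
    then have "1 < r / \<mu>" using r \<open>0 \<le> \<mu>\<close> by simp
    then obtain j where j: "C * \<mu> ^ k / m k < (r / \<mu>) ^ j" using real_arch_pow by blast
    have "C * \<mu> ^ k * \<mu> ^ j < r ^ j * m k"
      using j pos False \<open>0 \<le> \<mu>\<close> by (simp add: field_simps power_divide)
    also have "\<dots> \<le> C * \<mu> ^ (k + j)" using grow[of j] bound[of "k + j"] by linarith
    finally show False by (simp add: power_add)
  qed
qed

text \<open>A log-convex sequence that once fails to decrease is nondecreasing from there on, so its
  largest value sits at one of the two ends.\<close>

lemma logconvex_le_max:
  fixes m :: "nat \<Rightarrow> real"
  assumes nonneg: "\<And>n. 0 \<le> m n" and lc: "\<And>n. (m (Suc n))\<^sup>2 \<le> m n * m (Suc (Suc n))"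
    and "j \<le> n"
  shows "m j \<le> max (m 0) (m n)"
proof (cases "\<exists>i<j. m i \<le> m (Suc i)")
  case True
  then obtain i where i: "i < j" "1 * m i \<le> m (Suc i)" by auto
  have "m j \<le> m n" using \<open>j \<le> n\<close>
  proof (induction n rule: dec_induct)
    case (step k)
    then show ?case using logconvex_ratio_mono[where m=m, OF nonneg lc i(2), of k] i(1) by simp
  qed simp
  then show ?thesis by simp
next
  case False
  have "m i \<le> m 0" if "i \<le> j" for i
    using that
  proof (induction i)
    case (Suc i)
    then have "m (Suc i) \<le> m i" using False by (meson Suc_le_lessD linear)
    then show ?case using Suc by simp
  qed simp
  then show ?thesis by (simp add: max.coboundedI1)
qed

text \<open>If the last ratio were below \<rho>, all earlier ones would be too, and m n could not
  exceed \<rho>^n m 0.\<close>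

lemma logconvex_last_ratio:
  fixes m :: "nat \<Rightarrow> real"
  assumes nonneg: "\<And>n. 0 \<le> m n" and lc: "\<And>n. (m (Suc n))\<^sup>2 \<le> m n * m (Suc (Suc n))"
    and "0 \<le> \<rho>" and big: "\<rho> ^ n * m 0 < m n"
  shows "\<rho> * m n \<le> m (Suc n)"
proof (rule ccontr)
  assume n: "\<not> ?thesis"
  have step: "m (Suc i) \<le> \<rho> * m i" if "i \<le> n" for i
    using logconvex_ratio_mono[where m=m, OF nonneg lc, of \<rho> i n] n that by linarith
  have "m i \<le> \<rho> ^ i * m 0" if "i \<le> n" for i
    using that
  proof (induction i)
    case (Suc i)
    have "m (Suc i) \<le> \<rho> * m i" using step[of i] Suc by simp
    also have "\<dots> \<le> \<rho> * (\<rho> ^ i * m 0)" using Suc \<open>0 \<le> \<rho>\<close> by (intro mult_left_mono) auto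
    finally show ?case by (simp add: mult.assoc)
  qed simp
  from this[of n] big show False by simp
qed

section \<open>Orthogonal projections\<close>

context hilbert
begin

definition proj :: "'h set \<Rightarrow> 'h \<Rightarrow> 'h" where
  "proj M x = (SOME p. p \<in> M \<and> (\<forall>v\<in>M. inner p v = inner x v))"

definition closed_sub :: "'h set \<Rightarrow> bool" where
  "closed_sub M \<longleftrightarrow> subspace M \<and> closed M \<and> M \<subseteq> H"

lemma closed_subD: "closed_sub M \<Longrightarrow> x \<in> M \<Longrightarrow> x \<in> H"
  unfolding closed_sub_def by blast

lemma
  assumes "closed_sub M" "x \<in> H"
  shows proj_in: "proj M x \<in> M"
    and inner_proj: "v \<in> M \<Longrightarrow> inner (proj M x) v = inner x v"
proof -
  obtain p where "p \<in> M" "\<And>v. v \<in> M \<Longrightarrow> inner p v = inner x v"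
    using projection_exists[of M x] assms unfolding closed_sub_def by blast
  then have "\<exists>p. p \<in> M \<and> (\<forall>v\<in>M. inner p v = inner x v)" by blast
  from someI_ex[OF this]
  show "proj M x \<in> M" "v \<in> M \<Longrightarrow> inner (proj M x) v = inner x v"
    unfolding proj_def by auto
qed

lemma proj_in_H: "closed_sub M \<Longrightarrow> x \<in> H \<Longrightarrow> proj M x \<in> H"
  using proj_in closed_subD by blast

lemma inner_proj_right: "closed_sub M \<Longrightarrow> x \<in> H \<Longrightarrow> v \<in> M \<Longrightarrow> inner v (proj M x) = inner v x"
  using inner_proj by (metis inner_commute)

lemma proj_unique:
  assumes "closed_sub M" "x \<in> H" "p \<in> M" "\<And>v. v \<in> M \<Longrightarrow> inner p v = inner x v"
  shows "proj M x = p"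
proof -
  have "proj M x - p \<in> M"
    using assms proj_in unfolding closed_sub_def by (blast intro: subspace_diff)
  then have "inner (proj M x - p) (proj M x - p) = 0"
    using assms by (simp add: inner_diff_left inner_proj)
  then show ?thesis by simp
qed

lemma proj_id: "closed_sub M \<Longrightarrow> x \<in> M \<Longrightarrow> proj M x = x"
  by (rule proj_unique) (auto dest: closed_subD)

lemma proj_add: "closed_sub M \<Longrightarrow> x \<in> H \<Longrightarrow> y \<in> H \<Longrightarrow> proj M (x + y) = proj M x + proj M y"
  by (rule proj_unique, assumption)
    (simp, metis closed_sub_def proj_in subspace_add, simp add: inner_add_left inner_proj)

lemma proj_scale: "closed_sub M \<Longrightarrow> x \<in> H \<Longrightarrow> proj M (c *\<^sub>R x) = c *\<^sub>R proj M x"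
  by (rule proj_unique, assumption)
    (simp, metis closed_sub_def proj_in subspace_scale, simp add: inner_proj)

lemma proj_sym: "closed_sub M \<Longrightarrow> x \<in> H \<Longrightarrow> y \<in> H \<Longrightarrow> inner (proj M x) y = inner x (proj M y)"
  by (metis inner_proj inner_proj_right proj_in)

lemma inner_proj_self: "closed_sub M \<Longrightarrow> x \<in> H \<Longrightarrow> inner (proj M x) x = (norm (proj M x))\<^sup>2"
  by (metis inner_proj_right power2_norm_eq_inner proj_in)

lemma norm_proj_le: "closed_sub M \<Longrightarrow> x \<in> H \<Longrightarrow> norm (proj M x) \<le> norm x"
proof -
  assume a: "closed_sub M" "x \<in> H"
  have "(norm (proj M x))\<^sup>2 \<le> norm (proj M x) * norm x"
    using Cauchy_Schwarz_ineq2[of "proj M x" x] inner_proj_self[OF a] by simp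
  then show ?thesis by (cases "norm (proj M x) = 0") (auto simp: power2_eq_square)
qed

lemma proj_nested:
  assumes "closed_sub M" "closed_sub N" "M \<subseteq> N" "x \<in> H"
  shows "proj M (proj N x) = proj M x" "proj N (proj M x) = proj M x"
proof -
  show "proj M (proj N x) = proj M x"
    using assms by (intro proj_unique) (auto simp: proj_in_H proj_in inner_proj subset_iff)
  show "proj N (proj M x) = proj M x"
    using assms by (intro proj_id) (auto simp: proj_in subset_iff)
qed

end

section \<open>Growth subspaces of a positive bounded operator\<close>

locale pos_op = hilbert H for H :: "'h::real_inner set" +
  fixes S :: "'h \<Rightarrow> 'h" and D :: real
  assumes S_in [simp]: "x \<in> H \<Longrightarrow> S x \<in> H"
    and S_add: "x \<in> H \<Longrightarrow> y \<in> H \<Longrightarrow> S (x + y) = S x + S y"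
    and S_scale: "x \<in> H \<Longrightarrow> S (c *\<^sub>R x) = c *\<^sub>R S x"
    and S_sym: "x \<in> H \<Longrightarrow> y \<in> H \<Longrightarrow> inner (S x) y = inner x (S y)"
    and S_pos: "x \<in> H \<Longrightarrow> 0 \<le> inner (S x) x"
    and S_le: "x \<in> H \<Longrightarrow> inner (S x) x \<le> D * inner x x"
    and D_nonneg: "0 \<le> D"
begin

lemma S_diff: "x \<in> H \<Longrightarrow> y \<in> H \<Longrightarrow> S (x - y) = S x - S y"
  using S_add[of "x - y" y] by simp

lemma pow_in [simp]: "x \<in> H \<Longrightarrow> (S ^^ n) x \<in> H" by (induction n) auto

lemma pow_add: "x \<in> H \<Longrightarrow> y \<in> H \<Longrightarrow> (S ^^ n) (x + y) = (S ^^ n) x + (S ^^ n) y"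
  by (induction n) (auto simp: S_add)

lemma pow_scale: "x \<in> H \<Longrightarrow> (S ^^ n) (c *\<^sub>R x) = c *\<^sub>R (S ^^ n) x"
  by (induction n) (auto simp: S_scale)

lemma pow_sym: "x \<in> H \<Longrightarrow> y \<in> H \<Longrightarrow> inner ((S ^^ n) x) y = inner x ((S ^^ n) y)"
proof (induction n arbitrary: y)
  case (Suc n)
  then show ?case by (simp add: S_sym) (metis S_in funpow_swap1)
qed simp

lemma inner_pow_split:
  "x \<in> H \<Longrightarrow> y \<in> H \<Longrightarrow> inner ((S ^^ i) x) ((S ^^ j) y) = inner ((S ^^ (i + j)) x) y"
  using pow_sym[of "(S ^^ i) x" y j] by (simp add: funpow_add add.commute[of i j])

text \<open>Even powers give a squared norm, odd powers the positive form of \<open>S\<close> at S^k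
  x.\<close>

lemma pow_pos: "x \<in> H \<Longrightarrow> 0 \<le> inner ((S ^^ n) x) x"
proof -
  assume x: "x \<in> H"
  show ?thesis
  proof (cases "even n")
    case True
    then obtain k where "n = k + k" by (metis evenE mult_2)
    then show ?thesis using inner_pow_split[OF x x, of k k] by (metis inner_ge_zero)
  next
    case False
    then obtain k where "n = Suc k + k" by (metis oddE mult_2 add_Suc Suc_eq_plus1)
    then have "inner ((S ^^ n) x) x = inner (S ((S ^^ k) x)) ((S ^^ k) x)"
      using inner_pow_split[OF x x, of "Suc k" k] by simp
    then show ?thesis using S_pos x by simp
  qed
qed

lemma semi_form_pow: "semi_form H (\<lambda>x y. inner ((S ^^ n) x) y)"
proof
  show "inner ((S ^^ n) x) y = inner ((S ^^ n) y) x" if "x \<in> H" "y \<in> H" for x y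
    using pow_sym[OF that] by (simp add: inner_commute)
qed (simp_all add: subH pow_add pow_scale inner_add_left pow_pos)

lemma semi_form_S: "semi_form H (\<lambda>x y. inner (S x) y)"
  using semi_form_pow[of 1] by simp

text \<open>Cauchy-Schwarz for the form <S x, y> at the pair x, S x, followed by the upper bound at
  S x. It turns the bound on the quadratic form into a bound on the operator.\<close>

lemma norm_S_sq_le: "x \<in> H \<Longrightarrow> inner (S x) (S x) \<le> D * inner (S x) x"
proof -
  assume x: "x \<in> H"
  have "(inner (S x) (S x))\<^sup>2 \<le> inner (S x) x * inner (S (S x)) (S x)"
    using semi_form.Cauchy_Schwarz[OF semi_form_S, of x "S x"] x by simp
  also have "\<dots> \<le> inner (S x) x * (D * inner (S x) (S x))"
    using x S_le[of "S x"] S_pos by (intro mult_left_mono) auto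
  finally have "inner (S x) (S x) * inner (S x) (S x) \<le> (D * inner (S x) x) * inner (S x) (S x)"
    by (simp add: power2_eq_square algebra_simps)
  then show ?thesis
    using S_pos[OF x] D_nonneg by (cases "S x = 0") auto
qed

lemma norm_S_le: "x \<in> H \<Longrightarrow> norm (S x) \<le> D * norm x"
proof -
  assume x: "x \<in> H"
  have "(norm (S x))\<^sup>2 \<le> D * (D * inner x x)"
    using norm_S_sq_le[OF x] mult_left_mono[OF S_le[OF x] D_nonneg]
    by (simp add: power2_norm_eq_inner)
  also have "\<dots> = (D * norm x)\<^sup>2"
    by (simp add: power_mult_distrib power2_norm_eq_inner) (simp add: power2_eq_square)
  finally show ?thesis by (rule power2_le_imp_le) (simp add: D_nonneg)
qed

lemma norm_pow_le: "x \<in> H \<Longrightarrow> norm ((S ^^ n) x) \<le> D ^ n * norm x"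
proof (induction n)
  case (Suc n)
  have "norm ((S ^^ Suc n) x) \<le> D * norm ((S ^^ n) x)" using norm_S_le Suc by simp
  also have "\<dots> \<le> D * (D ^ n * norm x)" using Suc D_nonneg by (intro mult_left_mono) auto
  finally show ?case by (simp add: mult.assoc)
qed simp

lemma S_tendsto:
  assumes "\<And>n. f n \<in> H" "x \<in> H" "(f \<longlongrightarrow> x) F"
  shows "((\<lambda>n. S (f n)) \<longlongrightarrow> S x) F"
proof -
  have "((\<lambda>n. f n - x) \<longlongrightarrow> 0) F" using assms(3) by (rule LIM_zero)
  then have "((\<lambda>n. D * norm (f n - x)) \<longlongrightarrow> 0) F"
    by (intro tendsto_mult_right_zero) (rule tendsto_norm_zero)
  then have "((\<lambda>n. S (f n - x)) \<longlongrightarrow> 0) F"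
    by (rule Lim_null_comparison[rotated]) (use assms in \<open>auto intro!: always_eventually norm_S_le\<close>)
  then show ?thesis using assms by (simp add: S_diff LIM_zero_iff)
qed

lemma pow_tendsto:
  assumes "\<And>n. f n \<in> H" "x \<in> H" "(f \<longlongrightarrow> x) F"
  shows "((\<lambda>n. (S ^^ k) (f n)) \<longlongrightarrow> (S ^^ k) x) F"
  using assms by (induction k) (auto intro!: S_tendsto)

text \<open>The exponents are split as evenly as possible between the two arguments; the parity of n
  decides between Cauchy-Schwarz for the inner product and for the form of \<open>S\<close>.\<close>

lemma moments_logconvex:
  assumes x: "x \<in> H"
  shows "(inner ((S ^^ Suc n) x) x)\<^sup>2 \<le> inner ((S ^^ n) x) x * inner ((S ^^ Suc (Suc n)) x) x"
proof (cases "even n")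
  case True
  then obtain k where k: "n = k + k" by (metis evenE mult_2)
  show ?thesis
    using Cauchy_Schwarz_ineq[of "(S ^^ k) x" "(S ^^ Suc k) x"]
    unfolding inner_pow_split[OF x x] by (simp add: k)
next
  case False
  then obtain k where k: "n = Suc k + k" by (metis oddE mult_2 add_Suc Suc_eq_plus1)
  have e: "inner (S ((S ^^ i) x)) ((S ^^ j) x) = inner ((S ^^ (Suc i + j)) x) x" for i j
    using inner_pow_split[OF x x, of "Suc i" j] by simp
  show ?thesis
    using semi_form.Cauchy_Schwarz[OF semi_form_S, of "(S ^^ k) x" "(S ^^ Suc k) x"] x
    unfolding e by (simp add: k)
qed

text \<open>In terms of a spectral measure the moments are integrals of u^n, so the bound says that
  x carries no mass above \<mu>. The constant is left free for each x, which makes closure under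
  addition visible.\<close>

definition growth :: "real \<Rightarrow> 'h set" where
  "growth \<mu> = {x\<in>H. \<exists>C. \<forall>n. inner ((S ^^ n) x) x \<le> C * \<mu> ^ n}"

lemma growth_step:
  assumes "0 \<le> \<mu>" "x \<in> growth \<mu>"
  shows "inner ((S ^^ Suc n) x) x \<le> \<mu> * inner ((S ^^ n) x) x"
proof -
  from assms obtain C where x: "x \<in> H" and C: "\<And>n. inner ((S ^^ n) x) x \<le> C * \<mu> ^ n"
    unfolding growth_def by blast
  show ?thesis
    by (rule logconvex_growth_ratio[where C=C])
      (use x C assms(1) pow_pos moments_logconvex in auto)
qed

lemma growth_upper: "0 \<le> \<mu> \<Longrightarrow> x \<in> growth \<mu> \<Longrightarrow> inner (S x) x \<le> \<mu> * inner x x"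
  using growth_step[of \<mu> x 0] by simp

text \<open>The bound on all ratios brings the free constant down to <x, x>. In this form the
  condition passes to limits, as closedness requires.\<close>

lemma growth_alt:
  assumes "0 \<le> \<mu>"
  shows "growth \<mu> = {x\<in>H. \<forall>n. inner ((S ^^ n) x) x \<le> \<mu> ^ n * inner x x}"
proof (intro equalityI subsetI)
  fix x assume x: "x \<in> growth \<mu>"
  have "inner ((S ^^ n) x) x \<le> \<mu> ^ n * inner x x" for n
  proof (induction n)
    case (Suc n)
    have "inner ((S ^^ Suc n) x) x \<le> \<mu> * (\<mu> ^ n * inner x x)"
      using growth_step[OF assms x, of n] mult_left_mono[OF Suc assms] by linarith
    then show ?case by (simp add: mult.assoc)
  qed simp
  with x show "x \<in> {x\<in>H. \<forall>n. inner ((S ^^ n) x) x \<le> \<mu> ^ n * inner x x}"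
    unfolding growth_def by blast
next
  fix x assume "x \<in> {x\<in>H. \<forall>n. inner ((S ^^ n) x) x \<le> \<mu> ^ n * inner x x}"
  then show "x \<in> growth \<mu>" unfolding growth_def
    by (auto intro!: exI[of _ "inner x x"] simp: mult.commute)
qed

lemma closed_sub_growth:
  assumes mu: "0 \<le> \<mu>"
  shows "closed_sub (growth \<mu>)"
  unfolding closed_sub_def
proof (intro conjI)
  show "growth \<mu> \<subseteq> H" by (auto simp: growth_def)
  show "closed (growth \<mu>)"
    unfolding closed_sequential_limits
  proof (intro allI impI, elim conjE)
    fix f x assume f: "\<forall>n. f n \<in> growth \<mu>" and lim: "f \<longlonglongrightarrow> x"
    have fH: "f n \<in> H" for n using f by (auto simp: growth_def)
    then have x: "x \<in> H" using H_limit lim by blast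
    have "inner ((S ^^ n) x) x \<le> \<mu> ^ n * inner x x" for n
    proof (rule LIMSEQ_le)
      show "(\<lambda>k. inner ((S ^^ n) (f k)) (f k)) \<longlonglongrightarrow> inner ((S ^^ n) x) x"
        by (intro tendsto_inner pow_tendsto fH x lim)
      show "(\<lambda>k. \<mu> ^ n * inner (f k) (f k)) \<longlonglongrightarrow> \<mu> ^ n * inner x x"
        by (intro tendsto_intros lim)
      show "\<exists>N. \<forall>k\<ge>N. inner ((S ^^ n) (f k)) (f k) \<le> \<mu> ^ n * inner (f k) (f k)"
        using f unfolding growth_alt[OF mu] by blast
    qed
    with x show "x \<in> growth \<mu>" unfolding growth_alt[OF mu] by blast
  qed
  show "subspace (growth \<mu>)"
    unfolding subspace_def
  proof (intro conjI ballI allI)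
    show "0 \<in> growth \<mu>" unfolding growth_def by (auto intro!: exI[of _ 0])
  next
    fix x y assume "x \<in> growth \<mu>" "y \<in> growth \<mu>"
    then obtain C C' where x: "x \<in> H" "\<And>n. inner ((S ^^ n) x) x \<le> C * \<mu> ^ n"
      and y: "y \<in> H" "\<And>n. inner ((S ^^ n) y) y \<le> C' * \<mu> ^ n"
      unfolding growth_def by blast
    \<comment> \<open>Parallelogram law for the form of S^n, with the nonnegative term of x - y
      dropped.\<close>
    have "inner ((S ^^ n) (x + y)) (x + y) \<le> (2 * C + 2 * C') * \<mu> ^ n" for n
    proof -
      interpret f: semi_form H "\<lambda>x y. inner ((S ^^ n) x) y" by (rule semi_form_pow)
      show ?thesis
        using f.parallelogram[OF x(1) y(1)] f.nonneg[OF H_diff[OF x(1) y(1)]] x(2)[of n] y(2)[of n]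
        by (simp add: algebra_simps)
    qed
    then show "x + y \<in> growth \<mu>" using x y unfolding growth_def by auto
  next
    fix c x assume "x \<in> growth \<mu>"
    then obtain C where x: "x \<in> H" "\<And>n. inner ((S ^^ n) x) x \<le> C * \<mu> ^ n"
      unfolding growth_def by blast
    have "inner ((S ^^ n) (c *\<^sub>R x)) (c *\<^sub>R x) \<le> (c\<^sup>2 * C) * \<mu> ^ n" for n
    proof -
      have "c\<^sup>2 * inner ((S ^^ n) x) x \<le> c\<^sup>2 * (C * \<mu> ^ n)" using x(2) by (intro mult_left_mono) auto
      then show ?thesis using x by (simp add: pow_scale power2_eq_square mult.assoc)
    qed
    then show "c *\<^sub>R x \<in> growth \<mu>" using x unfolding growth_def by auto
  qed
qed

text \<open>Moments of S x are moments of x two orders higher, so only the constant changes, by the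
  factor \<mu>^2.\<close>

lemma growth_invariant: "x \<in> growth \<mu> \<Longrightarrow> S x \<in> growth \<mu>"
proof -
  assume "x \<in> growth \<mu>"
  then obtain C where x: "x \<in> H" "\<And>n. inner ((S ^^ n) x) x \<le> C * \<mu> ^ n"
    unfolding growth_def by blast
  have "inner ((S ^^ n) (S x)) (S x) \<le> (C * \<mu>\<^sup>2) * \<mu> ^ n" for n
  proof -
    have "inner ((S ^^ n) (S x)) (S x) = inner ((S ^^ Suc n) x) ((S ^^ 1) x)"
      by (simp add: funpow_swap1)
    also have "\<dots> = inner ((S ^^ (Suc (Suc n))) x) x"
      unfolding inner_pow_split[OF x(1) x(1)] by simp
    finally show ?thesis using x(2)[of "Suc (Suc n)"] by (simp add: power2_eq_square mult.assoc)
  qed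
  then show ?thesis using x unfolding growth_def by auto
qed

lemma growth_pow_invariant: "x \<in> growth \<mu> \<Longrightarrow> (S ^^ n) x \<in> growth \<mu>"
  by (induction n) (auto intro: growth_invariant)

lemma growth_mono: "0 \<le> \<mu> \<Longrightarrow> \<mu> \<le> \<nu> \<Longrightarrow> growth \<mu> \<subseteq> growth \<nu>"
proof
  fix x assume mu: "0 \<le> \<mu>" "\<mu> \<le> \<nu>" and x: "x \<in> growth \<mu>"
  have "inner ((S ^^ n) x) x \<le> \<nu> ^ n * inner x x" for n
  proof -
    have "\<mu> ^ n * inner x x \<le> \<nu> ^ n * inner x x"
      using mu by (intro mult_right_mono power_mono) auto
    then show ?thesis using x mu growth_alt[of \<mu>] by (auto intro: order_trans)
  qed
  then show "x \<in> growth \<nu>" using x mu growth_alt[of \<nu>] by (auto simp: growth_def)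
qed

text \<open>
  The regularization \<open>y\<^sub>n = (I + S\<^sup>2\<^sup>n)\<^sup>-\<^sup>1 x\<close> has moments bounded up to order \<open>2 n\<close>, so
  every limit point of the \<open>y\<^sub>n\<close> has bounded moments; orthogonality of \<open>x\<close> to such vectors forces
  \<open>y\<^sub>n \<rightarrow> 0\<close> along a subsequence. The remainder \<open>x - y\<^sub>n = S\<^sup>2\<^sup>n y\<^sub>n\<close> lies far
  inside the range of the powers of \<open>S\<close>, where log-convexity bounds \<open>S\<close> from below.
\<close>

lemma growth_one_lower:
  assumes x: "x \<in> H" and orth: "\<And>v. v \<in> growth 1 \<Longrightarrow> inner x v = 0"
  shows "inner x x \<le> inner (S x) x"
proof (cases "x = 0")
  case False
  define X where "X = inner x x"
  have X: "X > 0" using False by (simp add: X_def)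
  have cs1: "closed_sub (growth 1)" by (rule closed_sub_growth) simp
  \<comment> \<open>Weak form of (I + S^(2n)) y = x; the even exponent makes the added term the
    squared norm of S^n y.\<close>
  have "\<exists>y. y \<in> H \<and> (\<forall>v\<in>H. inner y v + inner ((S ^^ n) y) ((S ^^ n) v) = inner x v)" for n
  proof -
    let ?a = "\<lambda>y v. inner y v + inner ((S ^^ (n + n)) y) v"
    have bd: "inner ((S ^^ (n + n)) y) y \<le> (D ^ n)\<^sup>2 * inner y y" if "y \<in> H" for y
    proof -
      have "inner ((S ^^ (n + n)) y) y = (norm ((S ^^ n) y))\<^sup>2"
        using inner_pow_split[OF that that, of n n] by (simp add: power2_norm_eq_inner)
      also have "\<dots> \<le> (D ^ n * norm y)\<^sup>2" using norm_pow_le[OF that] by (intro power_mono) auto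
      finally show ?thesis by (simp add: power_mult_distrib power2_norm_eq_inner)
    qed
    have sf: "semi_form H ?a"
    proof
      show "?a v w = ?a w v" if "v \<in> H" "w \<in> H" for v w
        using pow_sym[OF that, of "n + n"] by (simp add: inner_commute)
    qed (simp_all add: subH pow_add pow_scale inner_add_left pow_pos algebra_simps)
    obtain y where "y \<in> H" "\<And>v. v \<in> H \<Longrightarrow> ?a y v = inner x v"
      by (rule riesz_dominating_form[OF sf, of "1 + (D ^ n)\<^sup>2" "inner x" "norm x"])
        (use pow_pos bd Cauchy_Schwarz_ineq2[of x] in \<open>simp_all add: inner_add_right algebra_simps\<close>)
    then show ?thesis by (intro exI[of _ y]) (simp add: inner_pow_split)
  qed
  then obtain y where yH: "\<And>n. y n \<in> H"
    and yv: "\<And>n v. v \<in> H \<Longrightarrow> inner (y n) v + inner ((S ^^ n) (y n)) ((S ^^ n) v) = inner x v"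
    by metis
  have y_self: "inner (y n) (y n) + inner ((S ^^ n) (y n)) ((S ^^ n) (y n)) = inner x (y n)" for n
    by (rule yv[OF yH])
  have y_norm: "norm (y n) \<le> norm x" for n
  proof -
    have "(norm (y n))\<^sup>2 \<le> norm x * norm (y n)"
      using y_self[of n] norm_cauchy_schwarz[of x "y n"] inner_ge_zero[of "(S ^^ n) (y n)"]
      unfolding power2_norm_eq_inner by linarith
    then show ?thesis by (cases "y n = 0") (auto simp: power2_eq_square)
  qed
  have xy: "inner x (y n) \<le> X" for n
  proof -
    have "inner x (y n) \<le> norm x * norm (y n)" by (rule norm_cauchy_schwarz)
    also have "\<dots> \<le> norm x * norm x" using y_norm by (intro mult_left_mono) auto
    finally show ?thesis by (simp add: X_def power2_norm_eq_inner[symmetric] power2_eq_square)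
  qed
  have y0: "inner (y n) (y n) \<le> X" and yn: "inner ((S ^^ (n + n)) (y n)) (y n) \<le> X" for n
    using y_self[of n] xy[of n] inner_ge_zero[of "y n"] inner_ge_zero[of "(S ^^ n) (y n)"]
      inner_pow_split[OF yH yH, of n n n n] by linarith+
  \<comment> \<open>The moments of orders 0 and 2n are bounded by the equation; log-convexity bounds
    those between.\<close>
  have y_mom: "inner ((S ^^ j) (y n)) (y n) \<le> X" if "j \<le> n" for j n
    using logconvex_le_max[of "\<lambda>j. inner ((S ^^ j) (y n)) (y n)" j "n + n"]
      pow_pos[OF yH] moments_logconvex[OF yH] y0[of n] yn[of n] that by fastforce
  \<comment> \<open>Invariance of the growth subspace decouples the equation: the component p of y
    in that subspace satisfies |p|^2 + |S^n p|^2 = 0.\<close>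
  have y_orth: "inner (y n) v = 0" if v: "v \<in> growth 1" for n v
  proof -
    define p where "p = proj (growth 1) (y n)"
    define r where "r = y n - p"
    have p: "p \<in> growth 1" "p \<in> H" unfolding p_def using proj_in proj_in_H cs1 yH by auto
    then have r: "r \<in> H" by (simp add: r_def yH)
    have r0: "inner r w = 0" if "w \<in> growth 1" for w
      using inner_proj[OF cs1 yH that] by (simp add: r_def p_def inner_diff_left)
    have yr: "y n = p + r" by (simp add: r_def)
    have "inner ((S ^^ n) r) ((S ^^ n) p) = inner r ((S ^^ (n + n)) p)"
      using inner_pow_split[OF r p(2), of n n] pow_sym[OF r p(2)] by simp
    also have "\<dots> = 0" using r0 growth_pow_invariant p by blast
    finally have "inner p p + inner ((S ^^ n) p) ((S ^^ n) p) = 0"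
      using yv[OF p(2), of n] orth[OF p(1)] r0[OF p(1)] unfolding yr
      by (simp add: pow_add p r inner_add_left)
    then have "inner p p = 0" using inner_ge_zero[of p] inner_ge_zero[of "(S ^^ n) p"] by linarith
    then have "p = 0" by simp
    then show ?thesis using r0[OF v] yr by simp
  qed
  have small: "\<exists>n\<ge>k. inner x (y n) < e" if e: "e > 0" for e k
  proof (rule ccontr)
    assume "\<not> ?thesis"
    then have ge: "\<And>n. n \<ge> k \<Longrightarrow> e \<le> inner x (y n)" by (meson not_le)
    \<comment> \<open>Each set imposes finitely many moment bounds, so if the claim fails it
      contains some y of high index. A common point would have all moments bounded, hence lie in
      \<open>growth 1\<close>, be orthogonal to itself, and yet pair with x to at least e.\<close>
    define V where "V n = {v\<in>H. (\<forall>j\<le>n. inner ((S ^^ j) v) v \<le> X) \<and>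
        (\<forall>w\<in>growth 1. inner v w = 0) \<and> e \<le> inner x v}" for n
    have "\<exists>p. \<forall>n. p \<in> V n"
    proof (rule nested_convex_nonempty[of V "sqrt X"])
      fix n
      have "y (max n k) \<in> V n" unfolding V_def using yH y_mom y_orth ge by auto
      then show "V n \<noteq> {}" by blast
      show "convex (V n)"
        unfolding convex_def
      proof (intro ballI allI impI)
        fix p q and s t :: real
        assume p: "p \<in> V n" and q: "q \<in> V n" and st: "0 \<le> s" "0 \<le> t" "s + t = 1"
        have H: "p \<in> H" "q \<in> H" using p q by (auto simp: V_def)
        have "inner ((S ^^ j) (s *\<^sub>R p + t *\<^sub>R q)) (s *\<^sub>R p + t *\<^sub>R q) \<le> X" if j: "j \<le> n" for j
        proof -
          interpret f: semi_form H "\<lambda>x y. inner ((S ^^ j) x) y" by (rule semi_form_pow)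
          \<comment> \<open>The factor s + t, equal to 1, is kept so that this is a polynomial
            identity; it exhibits the convexity of the quadratic form.\<close>
          have "inner ((S ^^ j) (s *\<^sub>R p + t *\<^sub>R q)) (s *\<^sub>R p + t *\<^sub>R q)
              = s * (s + t) * inner ((S ^^ j) p) p + t * (s + t) * inner ((S ^^ j) q) q
                - s * t * inner ((S ^^ j) (p - q)) (p - q)"
            using H f.sym[of q p]
            by (simp add: pow_add pow_scale f.diff f.diff_right inner_add_left inner_add_right algebra_simps)
          also have "\<dots> \<le> s * X + t * X - 0"
            unfolding st(3) using p q j st f.nonneg[of "p - q"] H
            by (intro diff_mono add_mono) (auto simp: V_def intro!: mult_left_mono)
          also have "\<dots> = X" using st by (simp add: distrib_right[symmetric])
          finally show ?thesis .
        qed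
        moreover have "e \<le> inner x (s *\<^sub>R p + t *\<^sub>R q)"
        proof -
          have "s * e + t * e \<le> s * inner x p + t * inner x q"
            using p q st by (intro add_mono mult_left_mono) (auto simp: V_def)
          then show ?thesis using st by (simp add: inner_add_right distrib_right[symmetric])
        qed
        ultimately show "s *\<^sub>R p + t *\<^sub>R q \<in> V n"
          using H p q by (auto simp: V_def inner_add_left)
      qed
      show "closed (V n)"
        unfolding closed_sequential_limits
      proof (intro allI impI, elim conjE)
        fix f p assume f: "\<forall>k. f k \<in> V n" and lim: "f \<longlonglongrightarrow> p"
        have fH: "f k \<in> H" for k using f by (auto simp: V_def)
        then have p: "p \<in> H" using H_limit lim by blast
        have "inner ((S ^^ j) p) p \<le> X" if "j \<le> n" for j
        proof (rule LIMSEQ_le_const2)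
          show "(\<lambda>k. inner ((S ^^ j) (f k)) (f k)) \<longlonglongrightarrow> inner ((S ^^ j) p) p"
            by (intro tendsto_inner pow_tendsto fH p lim)
        qed (use f that in \<open>auto simp: V_def\<close>)
        moreover have "inner p w = 0" if "w \<in> growth 1" for w
        proof -
          have "(\<lambda>k. inner (f k) w) \<longlonglongrightarrow> inner p w" by (intro tendsto_intros lim)
          moreover have "(\<lambda>k. inner (f k) w) = (\<lambda>k. 0)" using f that by (auto simp: V_def)
          ultimately show ?thesis by (simp add: LIMSEQ_const_iff)
        qed
        moreover have "e \<le> inner x p"
        proof (rule LIMSEQ_le_const)
          show "(\<lambda>k. inner x (f k)) \<longlonglongrightarrow> inner x p" by (intro tendsto_intros lim)
        qed (use f in \<open>auto simp: V_def\<close>)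
        ultimately show "p \<in> V n" using p by (auto simp: V_def)
      qed
      show "V n \<subseteq> H" by (auto simp: V_def)
      show "norm v \<le> sqrt X" if "v \<in> V n" for v
      proof -
        have "inner ((S ^^ 0) v) v \<le> X" using that unfolding V_def by blast
        then show ?thesis by (simp add: norm_eq_sqrt_inner)
      qed
    next
      show "V n \<subseteq> V m" if "m \<le> n" for m n using that by (auto simp: V_def)
    next
      show "\<exists>p. \<forall>n. p \<in> V n" if "\<And>n. p \<in> V n" for p using that by blast
    qed
    then obtain p where p: "\<And>n. p \<in> V n" by blast
    then have "p \<in> growth 1"
      unfolding growth_def by (auto simp: V_def intro!: exI[of _ X])
    then have "inner p p = 0" using p by (auto simp: V_def)
    then show False using p[of 0] e by (auto simp: V_def)
  qed
  have lower: "\<rho> * inner x x \<le> inner (S x) x" if rho: "0 \<le> \<rho>" "\<rho> < 1" for \<rho>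
  proof -
    have "\<exists>z. z \<in> H \<and> inner (z - x) (z - x) < 1 / real (Suc k) \<and> \<rho> * inner z z \<le> inner (S z) z" for k
    proof -
      \<comment> \<open>The first bound makes z close to x. The second keeps |z|^2 at least X/4, so
        that the moment of order 2n of w, which is |z|^2, passes the threshold of
        \<open>logconvex_last_ratio\<close>.\<close>
      define e where "e = min (1 / real (Suc k)) (X / 4)"
      have e: "e > 0" using X by (simp add: e_def)
      have "(\<lambda>n. \<rho> ^ n) \<longlonglongrightarrow> 0" using rho by (intro LIMSEQ_power_zero) auto
      then have "\<forall>\<^sub>F n in sequentially. \<rho> ^ n < 1 / 4" by (rule order_tendstoD) simp
      then obtain N where N: "\<And>n. n \<ge> N \<Longrightarrow> \<rho> ^ n < 1 / 4" unfolding eventually_sequentially by blast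
      obtain n where n: "n \<ge> N" "inner x (y n) < e" using small[OF e] by blast
      define w where "w = (S ^^ n) (y n)"
      define z where "z = (S ^^ n) w"
      have w: "w \<in> H" "z \<in> H" unfolding w_def z_def using yH by auto
      have zy: "z = x - y n"
      proof (rule eqI)
        show "inner z v = inner (x - y n) v" if "v \<in> H" for v
          using yv[OF that, of n] pow_sym[OF w(1) that, of n]
          by (simp add: z_def w_def inner_diff_left)
      qed (use w x yH in auto)
      have yy: "inner (y n) (y n) < e" "inner w w \<le> X"
        using y_self[of n] n(2) xy[of n] inner_ge_zero[of "y n"] inner_ge_zero[of "(S ^^ n) (y n)"]
        unfolding w_def by linarith+
      have "X / 4 \<le> inner z z"
      proof -
        have "X = inner (z + y n) (z + y n)" by (simp add: zy X_def)
        also have "\<dots> \<le> 2 * inner z z + 2 * inner (y n) (y n)"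
          using semi_form.parallelogram[OF semi_form_inner w(2) yH, of n] inner_ge_zero[of "z - y n"]
          by linarith
        finally show ?thesis using yy(1) by (simp add: e_def)
      qed
      moreover have "\<rho> ^ (n + n) * inner w w < X / 4"
      proof -
        have "\<rho> ^ (n + n) * inner w w \<le> \<rho> ^ (n + n) * X" using yy rho by (intro mult_left_mono) auto
        also have "\<dots> < 1 / 4 * X" using N[of "n + n"] n(1) X by (intro mult_strict_right_mono) auto
        finally show ?thesis by simp
      qed
      moreover have zz: "inner ((S ^^ (n + n)) w) w = inner z z"
        unfolding z_def using inner_pow_split[OF w(1) w(1), of n n] by simp
      moreover have zz': "inner ((S ^^ Suc (n + n)) w) w = inner (S z) z"
        unfolding z_def using inner_pow_split[OF w(1) w(1), of "Suc n" n] by simp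
      ultimately have "\<rho> * inner z z \<le> inner (S z) z"
        using logconvex_last_ratio[of "\<lambda>j. inner ((S ^^ j) w) w" \<rho> "n + n"]
          pow_pos[OF w(1)] moments_logconvex[OF w(1)] rho unfolding zz zz' by simp
      moreover have "inner (z - x) (z - x) < 1 / real (Suc k)"
        using yy(1) by (simp add: zy e_def)
      ultimately show ?thesis using w by blast
    qed
    then obtain z where z: "\<And>k. z k \<in> H" "\<And>k. inner (z k - x) (z k - x) < 1 / real (Suc k)"
      "\<And>k. \<rho> * inner (z k) (z k) \<le> inner (S (z k)) (z k)" by metis
    have "(\<lambda>k. inner (z k - x) (z k - x)) \<longlonglongrightarrow> 0"
    proof (rule Lim_null_comparison)
      show "(\<lambda>k. 1 / real (Suc k)) \<longlonglongrightarrow> 0" by (intro LIMSEQ_Suc lim_1_over_n)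
      show "\<forall>\<^sub>F k in sequentially. norm (inner (z k - x) (z k - x)) \<le> 1 / real (Suc k)"
        using z(2) by (auto intro!: always_eventually less_imp_le)
    qed
    then have "(\<lambda>k. norm (z k - x)) \<longlonglongrightarrow> 0"
      using tendsto_real_sqrt by (fastforce simp: norm_eq_sqrt_inner)
    then have lim: "z \<longlonglongrightarrow> x" by (simp add: LIM_zero_iff tendsto_norm_zero_iff)
    show ?thesis
    proof (rule LIMSEQ_le)
      show "(\<lambda>k. \<rho> * inner (z k) (z k)) \<longlonglongrightarrow> \<rho> * inner x x" by (intro tendsto_intros lim)
      show "(\<lambda>k. inner (S (z k)) (z k)) \<longlonglongrightarrow> inner (S x) x"
        by (intro tendsto_inner S_tendsto lim z x)
    qed (use z in auto)
  qed
  show ?thesis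
  proof (rule LIMSEQ_le_const2)
    have "(\<lambda>n. (1 - 1 / real (Suc n)) * inner x x) \<longlonglongrightarrow> (1 - 0) * inner x x"
      by (intro tendsto_intros LIMSEQ_Suc lim_1_over_n)
    then show "(\<lambda>n. (1 - 1 / real (Suc n)) * inner x x) \<longlonglongrightarrow> inner x x" by simp
    show "\<exists>N. \<forall>n\<ge>N. (1 - 1 / real (Suc n)) * inner x x \<le> inner (S x) x"
      by (intro exI[of _ 0] allI impI lower) auto
  qed
qed simp

text \<open>Dividing \<open>S\<close> by \<mu> moves the threshold to 1; for \<mu> = 0 the claim is
  positivity of \<open>S\<close>.\<close>

lemma growth_lower:
  assumes mu: "0 \<le> \<mu>" and x: "x \<in> H" and orth: "\<And>v. v \<in> growth \<mu> \<Longrightarrow> inner x v = 0"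
  shows "\<mu> * inner x x \<le> inner (S x) x"
proof (cases "\<mu> = 0")
  case True
  then show ?thesis using S_pos x by simp
next
  case False
  with mu have pos: "\<mu> > 0" by simp
  interpret S': pos_op H "\<lambda>x. (1 / \<mu>) *\<^sub>R S x" "D / \<mu>"
  proof
    show "inner ((1 / \<mu>) *\<^sub>R S x) x \<le> D / \<mu> * inner x x" if "x \<in> H" for x
      using S_le[OF that] pos by (simp add: divide_right_mono)
  qed (use pos S_pos D_nonneg S_sym in \<open>simp_all add: S_add S_scale scaleR_add_right\<close>)
  have pow: "((\<lambda>x. (1 / \<mu>) *\<^sub>R S x) ^^ n) v = (1 / \<mu> ^ n) *\<^sub>R (S ^^ n) v" if "v \<in> H" for n v
    using that by (induction n) (auto simp: S_scale)
  have "S'.growth 1 = growth \<mu>"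
    unfolding S'.growth_def growth_def using pos
    by (intro Collect_cong conj_cong refl ex_cong1 all_cong1) (simp add: pow field_simps)
  then have "inner x x \<le> inner ((1 / \<mu>) *\<^sub>R S x) x"
    using S'.growth_one_lower[OF x] orth by simp
  then show ?thesis using pos by (simp add: field_simps)
qed

end

section \<open>Linear relations between finite measures on the line\<close>

text \<open>Dynkin argument for the signed measure with parts h i dM i. Half-lines form an
  intersection-stable generator; countable disjoint unions are reduced to increasing ones, along
  which each integral converges.\<close>

lemma sum_integrals_zero_indicator:
  fixes M :: "'i \<Rightarrow> real measure" and h :: "'i \<Rightarrow> real \<Rightarrow> real"
  assumes I: "finite I" and sets: "\<And>i. i \<in> I \<Longrightarrow> sets (M i) = sets borel"
    and h: "\<And>i. i \<in> I \<Longrightarrow> integrable (M i) (h i)"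
    and zero: "\<And>t. (\<Sum>i\<in>I. \<integral>u. indicator {..t} u * h i u \<partial>M i) = 0"
    and A: "A \<in> sets borel"
  shows "(\<Sum>i\<in>I. \<integral>u. indicator A u * h i u \<partial>M i) = 0"
proof -
  have ind: "set_integrable (M i) B (h i)" if "i \<in> I" "B \<in> sets borel" for i B
    unfolding set_integrable_def using h[OF that(1)] sets[OF that(1)] that(2)
    by (intro integrable_mult_indicator) auto
  have sigma: "sets borel = sigma_sets UNIV (range (\<lambda>a::real. {..a}))"
    by (subst borel_eq_atMost) simp
  define P where "P B \<longleftrightarrow> (\<Sum>i\<in>I. LINT u:B|M i. h i u) = 0" for B
  have cont: "(\<lambda>n. \<Sum>i\<in>I. LINT u:B n|M i. h i u) \<longlonglongrightarrow> (\<Sum>i\<in>I. LINT u:(\<Union>n. B n)|M i. h i u)"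
    if B: "\<And>n::nat. B n \<in> sets borel" "incseq B" for B
    by (intro tendsto_sum set_integral_cont_up) (use B ind sets in auto)
  have P_cont: "P (\<Union>n. B n)"
    if B: "\<And>n::nat. B n \<in> sets borel" "incseq B" "\<And>n. P (B n)" for B
    using cont[OF B(1,2)] B(3) by (simp add: P_def LIMSEQ_const_iff)
  have P_atMost: "P {..t}" for t
    using zero[of t] by (simp add: P_def set_lebesgue_integral_def)
  \<comment> \<open>The whole line is an increasing union of half-lines; closure under complements
    rests on this.\<close>
  have P_UNIV: "P UNIV"
  proof -
    have "P (\<Union>n. {..real n})" by (intro P_cont P_atMost) (auto simp: incseq_def)
    moreover have "(\<Union>n. {..real n}) = UNIV" using real_arch_simple by blast
    ultimately show ?thesis by simp
  qed
  have "P A"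
  proof (rule sigma_sets_induct_disjoint[OF _ _ A[unfolded sigma]])
    show "Int_stable (range (\<lambda>a::real. {..a}))" by (auto simp: Int_stable_def)
  next
    fix B assume "B \<in> range (\<lambda>a::real. {..a})"
    then show "P B" using P_atMost by auto
  next
    show "P {}" by (simp add: P_def set_lebesgue_integral_def)
  next
    fix B assume B: "B \<in> sigma_sets UNIV (range (\<lambda>a::real. {..a}))" and PB: "P B"
    have "(LINT u:UNIV - B|M i. h i u) = (LINT u:UNIV|M i. h i u) - (LINT u:B|M i. h i u)"
      if i: "i \<in> I" for i
      using set_integral_Un[of B "UNIV - B" "M i" "h i"] ind[OF i] B unfolding sigma[symmetric]
      by (simp add: Un_commute)
    then show "P (UNIV - B)" using PB P_UNIV by (simp add: P_def sum_subtractf)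
  next
    fix B :: "nat \<Rightarrow> real set"
    assume disj: "disjoint_family B" and B: "range B \<subseteq> sigma_sets UNIV (range (\<lambda>a::real. {..a}))"
      and PB: "\<And>i. P (B i)"
    have Bb: "B n \<in> sets borel" for n using B unfolding sigma by blast
    have "P (\<Union>n. \<Union>k<n. B k)"
    proof (rule P_cont)
      show "incseq (\<lambda>n. \<Union>k<n. B k)" by (fastforce simp: incseq_def)
      fix n :: nat
      show "(\<Union>k<n. B k) \<in> sets borel" using Bb by auto
      have "(LINT u:(\<Union>k<n. B k)|M i. h i u) = (\<Sum>k<n. LINT u:B k|M i. h i u)" if "i \<in> I" for i
        using disj Bb ind[OF that] sets[OF that]
        by (intro set_integral_finite_Union) (auto simp: disjoint_family_on_def)
      then have "(\<Sum>i\<in>I. LINT u:(\<Union>k<n. B k)|M i. h i u) = (\<Sum>i\<in>I. \<Sum>k<n. LINT u:B k|M i. h i u)"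
        by simp
      also have "\<dots> = (\<Sum>k<n. \<Sum>i\<in>I. LINT u:B k|M i. h i u)" by (rule sum.swap)
      also have "\<dots> = 0" using PB by (simp add: P_def)
      finally show "P (\<Union>k<n. B k)" by (simp add: P_def)
    qed
    moreover have "(\<Union>n. \<Union>k<n. B k) = (\<Union>n. B n)" by blast
    ultimately show "P (\<Union>n. B n)" by simp
  qed auto
  then show ?thesis by (simp add: P_def set_lebesgue_integral_def)
qed

text \<open>Simple approximations of g bounded by 2|g| reduce the claim to sets, with 2|g h i| as
  dominating functions. Densities \<open>h i\<close> instead of constants are allowed because
  multiplicativity of the calculus compares measures through a density.\<close>

lemma sum_integrals_zero:
  fixes M :: "'i \<Rightarrow> real measure" and h :: "'i \<Rightarrow> real \<Rightarrow> real"
  assumes I: "finite I" and sets: "\<And>i. i \<in> I \<Longrightarrow> sets (M i) = sets borel"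
    and h: "\<And>i. i \<in> I \<Longrightarrow> integrable (M i) (h i)"
    and zero: "\<And>t. (\<Sum>i\<in>I. \<integral>u. indicator {..t} u * h i u \<partial>M i) = 0"
    and g: "g \<in> borel_measurable borel" "\<And>i. i \<in> I \<Longrightarrow> integrable (M i) (\<lambda>u. g u * h i u)"
  shows "(\<Sum>i\<in>I. \<integral>u. g u * h i u \<partial>M i) = 0"
proof -
  obtain s where s: "\<And>k::nat. simple_function borel (s k)"
    and lim: "\<And>x. (\<lambda>k. s k x) \<longlonglongrightarrow> g x" and bd: "\<And>k x. \<bar>s k x\<bar> \<le> 2 * \<bar>g x\<bar>"
    using borel_measurable_implies_sequence_metric[OF g(1), of 0] by (auto simp: dist_real_def)
  have hm: "h i \<in> borel_measurable borel" if "i \<in> I" for i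
    using borel_measurable_integrable[OF h[OF that]] measurable_cong_sets[OF sets[OF that] refl] by auto
  have simple: "(\<Sum>i\<in>I. \<integral>u. s k u * h i u \<partial>M i) = 0" for k
  proof -
    have fin: "finite (range (s k))" using s[of k] by (simp add: simple_function_def)
    have meas: "s k -` {y} \<in> sets borel" for y
      using s[of k] borel_measurable_simple_function[OF s]
      by (intro measurable_sets_borel[of _ borel]) auto
    have rep: "s k u = (\<Sum>y\<in>range (s k). y * indicator (s k -` {y}) u)" for u
    proof -
      have "(\<Sum>y\<in>range (s k). y * indicator (s k -` {y}) u) = (\<Sum>y\<in>range (s k). if s k u = y then y else 0)"
        by (intro sum.cong) (auto simp: indicator_def)
      then show ?thesis using fin by simp
    qed
    have int: "integrable (M i) (\<lambda>u. indicator B u * h i u)" if "i \<in> I" "B \<in> sets borel" for i B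
      using integrable_mult_indicator[of B "M i" "h i"] h[OF that(1)] sets[OF that(1)] that(2) by simp
    have "(\<integral>u. s k u * h i u \<partial>M i) = (\<Sum>y\<in>range (s k). y * (\<integral>u. indicator (s k -` {y}) u * h i u \<partial>M i))"
      if i: "i \<in> I" for i
    proof -
      have "(\<integral>u. s k u * h i u \<partial>M i)
          = (\<integral>u. (\<Sum>y\<in>range (s k). y * (indicator (s k -` {y}) u * h i u)) \<partial>M i)"
        by (intro Bochner_Integration.integral_cong refl, subst rep) (simp add: sum_distrib_right mult.assoc)
      also have "\<dots> = (\<Sum>y\<in>range (s k). \<integral>u. y * (indicator (s k -` {y}) u * h i u) \<partial>M i)"
        by (intro Bochner_Integration.integral_sum integrable_mult_right int i meas)
      finally show ?thesis by simp
    qed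
    then have "(\<Sum>i\<in>I. \<integral>u. s k u * h i u \<partial>M i)
        = (\<Sum>i\<in>I. \<Sum>y\<in>range (s k). y * (\<integral>u. indicator (s k -` {y}) u * h i u \<partial>M i))" by simp
    also have "\<dots> = (\<Sum>y\<in>range (s k). y * (\<Sum>i\<in>I. \<integral>u. indicator (s k -` {y}) u * h i u \<partial>M i))"
      by (subst sum.swap) (simp add: sum_distrib_left)
    also have "\<dots> = 0"
      using sum_integrals_zero_indicator[OF I sets h zero meas] by simp
    finally show ?thesis .
  qed
  have "(\<lambda>k. \<Sum>i\<in>I. \<integral>u. s k u * h i u \<partial>M i) \<longlonglongrightarrow> (\<Sum>i\<in>I. \<integral>u. g u * h i u \<partial>M i)"
  proof (intro tendsto_sum)
    fix i assume i: "i \<in> I"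
    have [measurable]: "h i \<in> borel_measurable (M i)" using h[OF i] by auto
    have [measurable]: "g \<in> borel_measurable (M i)" "s k \<in> borel_measurable (M i)" for k
      using g(1) borel_measurable_simple_function[OF s] measurable_cong_sets[OF sets[OF i] refl] by auto
    show "(\<lambda>k. \<integral>u. s k u * h i u \<partial>M i) \<longlonglongrightarrow> (\<integral>u. g u * h i u \<partial>M i)"
    proof (rule integral_dominated_convergence[where w="\<lambda>u. 2 * \<bar>g u * h i u\<bar>"])
      show "integrable (M i) (\<lambda>u. 2 * \<bar>g u * h i u\<bar>)" using g(2)[OF i] by auto
      show "AE u in M i. (\<lambda>k. s k u * h i u) \<longlonglongrightarrow> g u * h i u"
        using lim by (auto intro!: tendsto_intros)
      show "AE u in M i. norm (s k u * h i u) \<le> 2 * \<bar>g u * h i u\<bar>" for k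
      proof (rule AE_I2)
        fix u
        show "norm (s k u * h i u) \<le> 2 * \<bar>g u * h i u\<bar>"
          using mult_right_mono[OF bd[of k u], of "\<bar>h i u\<bar>"] by (simp add: abs_mult)
      qed
    qed measurable
  qed
  then show ?thesis unfolding simple by (simp add: LIMSEQ_const_iff)
qed

text \<open>Stated for nonnegative integrals because it is the source of integrability with respect
  to the measure of a sum or a multiple, which cannot be presupposed.\<close>

lemma nn_integral_le_of_measure_le:
  assumes sets: "sets M = sets L" "sets N = sets L" "sets P = sets L"
    and le: "\<And>A. A \<in> sets L \<Longrightarrow> emeasure M A \<le> c * emeasure N A + d * emeasure P A"
    and f: "f \<in> borel_measurable L"
  shows "(\<integral>\<^sup>+u. f u \<partial>M) \<le> c * (\<integral>\<^sup>+u. f u \<partial>N) + d * (\<integral>\<^sup>+u. f u \<partial>P)"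
  using f
proof (induction rule: borel_measurable_induct)
  note [measurable_cong] = sets
  have sp: "space M = space L" "space N = space L" "space P = space L"
    using sets[THEN sets_eq_imp_space_eq] .
  {
    case (cong f g)
    then show ?case using sp nn_integral_cong[of M f g] nn_integral_cong[of N f g] nn_integral_cong[of P f g]
      by simp
  next
    case (set A)
    then show ?case using le[OF set] sets by simp
  next
    case (mult u k)
    note [measurable] = mult(2)
    have "(\<integral>\<^sup>+x. k * u x \<partial>M) = k * (\<integral>\<^sup>+x. u x \<partial>M)" by (rule nn_integral_cmult) measurable
    also have "\<dots> \<le> k * (c * (\<integral>\<^sup>+x. u x \<partial>N) + d * (\<integral>\<^sup>+x. u x \<partial>P))"
      using mult by (intro mult_left_mono) auto
    also have "\<dots> = c * (\<integral>\<^sup>+x. k * u x \<partial>N) + d * (\<integral>\<^sup>+x. k * u x \<partial>P)"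
      by (subst (1 2) nn_integral_cmult, measurable) (simp add: algebra_simps)
    finally show ?case .
  next
    case (add u v)
    note [measurable] = add(1,3)
    have "(\<integral>\<^sup>+x. v x + u x \<partial>M) = (\<integral>\<^sup>+x. v x \<partial>M) + (\<integral>\<^sup>+x. u x \<partial>M)" by (rule nn_integral_add) measurable
    also have "\<dots> \<le> (c * (\<integral>\<^sup>+x. v x \<partial>N) + d * (\<integral>\<^sup>+x. v x \<partial>P)) + (c * (\<integral>\<^sup>+x. u x \<partial>N) + d * (\<integral>\<^sup>+x. u x \<partial>P))"
      using add by (intro add_mono) auto
    also have "\<dots> = c * (\<integral>\<^sup>+x. v x + u x \<partial>N) + d * (\<integral>\<^sup>+x. v x + u x \<partial>P)"
      by (subst (1 2) nn_integral_add, measurable) (simp add: algebra_simps)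
    finally show ?case .
  next
    case (seq U)
    note [measurable] = seq(1)
    have "(\<integral>\<^sup>+x. (SUP i. U i) x \<partial>M) = (SUP i. \<integral>\<^sup>+x. U i x \<partial>M)"
      using nn_integral_monotone_convergence_SUP[OF \<open>incseq U\<close>, of M] by (simp add: image_image)
    also have "\<dots> \<le> c * (\<integral>\<^sup>+x. (SUP i. U i) x \<partial>N) + d * (\<integral>\<^sup>+x. (SUP i. U i) x \<partial>P)"
    proof (rule SUP_least)
      fix i
      have "(\<integral>\<^sup>+x. U i x \<partial>M) \<le> c * (\<integral>\<^sup>+x. U i x \<partial>N) + d * (\<integral>\<^sup>+x. U i x \<partial>P)" by (rule seq)
      also have "\<dots> \<le> c * (\<integral>\<^sup>+x. (SUP i. U i) x \<partial>N) + d * (\<integral>\<^sup>+x. (SUP i. U i) x \<partial>P)"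
        by (intro add_mono mult_left_mono nn_integral_mono) (auto intro!: SUP_upper2)
      finally show "(\<integral>\<^sup>+x. U i x \<partial>M) \<le> c * (\<integral>\<^sup>+x. (SUP i. U i) x \<partial>N) + d * (\<integral>\<^sup>+x. (SUP i. U i) x \<partial>P)" .
    qed
    finally show ?case .
  }
qed

section \<open>Functional calculus of a spectral family\<close>

definition bounded_borel :: "(real \<Rightarrow> real) \<Rightarrow> bool" where
  "bounded_borel f \<longleftrightarrow> f \<in> borel_measurable borel \<and> (\<exists>C. \<forall>t. \<bar>f t\<bar> \<le> C)"

lemma bounded_borel_measurable [measurable_dest]: "bounded_borel f \<Longrightarrow> f \<in> borel_measurable borel"
  by (simp add: bounded_borel_def)

lemma bounded_borelI: "f \<in> borel_measurable borel \<Longrightarrow> (\<And>t. \<bar>f t\<bar> \<le> C) \<Longrightarrow> bounded_borel f"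
  by (auto simp: bounded_borel_def)

lemma bounded_borelE:
  assumes "bounded_borel f" obtains C where "0 \<le> C" "\<And>t. \<bar>f t\<bar> \<le> C"
  using assms unfolding bounded_borel_def by (metis abs_ge_zero order_trans)

lemma bounded_borel_const [simp]: "bounded_borel (\<lambda>_. c)"
  by (rule bounded_borelI[of _ "\<bar>c\<bar>"]) auto

lemma bounded_borel_indicator [simp]: "A \<in> sets borel \<Longrightarrow> bounded_borel (indicator A)"
  by (rule bounded_borelI[of _ 1]) (auto simp: indicator_def)

lemma bounded_borel_mult [simp]:
  assumes "bounded_borel f" "bounded_borel g" shows "bounded_borel (\<lambda>t. f t * g t)"
proof -
  obtain C D where C: "0 \<le> C" "\<And>t. \<bar>f t\<bar> \<le> C" and D: "0 \<le> D" "\<And>t. \<bar>g t\<bar> \<le> D"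
    using assms by (meson bounded_borelE)
  show ?thesis
    by (rule bounded_borelI[of _ "C * D"])
      (use assms C D in \<open>auto simp: bounded_borel_def abs_mult intro!: mult_mono\<close>)
qed

lemma bounded_borel_diff [simp]:
  assumes "bounded_borel f" "bounded_borel g" shows "bounded_borel (\<lambda>t. f t - g t)"
proof -
  obtain C D where C: "0 \<le> C" "\<And>t. \<bar>f t\<bar> \<le> C" and D: "0 \<le> D" "\<And>t. \<bar>g t\<bar> \<le> D"
    using assms by (meson bounded_borelE)
  have "\<bar>f t - g t\<bar> \<le> C + D" for t using C(2)[of t] D(2)[of t] by linarith
  then show ?thesis
    using assms by (intro bounded_borelI[of _ "C + D"]) (auto simp: bounded_borel_def)
qed

lemma bounded_borel_power2 [simp]: "bounded_borel f \<Longrightarrow> bounded_borel (\<lambda>t. (f t)\<^sup>2)"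
  unfolding power2_eq_square by simp

locale spectral = hilbert H for H :: "'h::real_inner set" +
  fixes E :: "real \<Rightarrow> 'h \<Rightarrow> 'h"
  assumes fam: "spectral_family H E"
begin

lemma E_in [simp]: "x \<in> H \<Longrightarrow> E t x \<in> H"
  and E_add: "x \<in> H \<Longrightarrow> y \<in> H \<Longrightarrow> E t (x + y) = E t x + E t y"
  and E_scale: "x \<in> H \<Longrightarrow> E t (c *\<^sub>R x) = c *\<^sub>R E t x"
  and E_sym: "x \<in> H \<Longrightarrow> y \<in> H \<Longrightarrow> inner (E t x) y = inner x (E t y)"
  and E_mult: "x \<in> H \<Longrightarrow> E t (E t' x) = E (min t t') x"
  and E_right: "x \<in> H \<Longrightarrow> ((\<lambda>t'. E t' x) \<longlongrightarrow> E t x) (at_right t)"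
  and E_bot: "x \<in> H \<Longrightarrow> ((\<lambda>t. E t x) \<longlongrightarrow> 0) at_bot"
  and E_top: "x \<in> H \<Longrightarrow> ((\<lambda>t. E t x) \<longlongrightarrow> x) at_top"
  using fam unfolding spectral_family_def bounded_linear_between_def by (simp_all add: image_subset_iff)

lemma E_diff: "x \<in> H \<Longrightarrow> y \<in> H \<Longrightarrow> E t (x - y) = E t x - E t y"
  using E_add[of "x - y" y t] by simp

lemma inner_E_self: "x \<in> H \<Longrightarrow> inner (E t x) x = (norm (E t x))\<^sup>2"
  using E_sym[of "E t x" x t] E_mult[of x t t] by (simp add: power2_norm_eq_inner)

lemma E_mono:
  assumes x: "x \<in> H" and "s \<le> t"
  shows "inner (E s x) x \<le> inner (E t x) x"
proof -
  have "inner (E s x) x = inner (E s x) (E t x)"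
    using E_sym[OF E_in[OF x] x, of s t] E_mult[OF x, of t s] \<open>s \<le> t\<close> x
    by (metis E_in E_mult E_sym min.absorb1)
  also have "\<dots> \<le> norm (E s x) * norm (E t x)" by (rule norm_cauchy_schwarz)
  finally have "norm (E s x) * norm (E s x) \<le> norm (E s x) * norm (E t x)"
    using inner_E_self[OF x, of s] by (simp add: power2_eq_square)
  then have "norm (E s x) \<le> norm (E t x)" by (cases "E s x = 0") auto
  then show ?thesis unfolding inner_E_self[OF x] by (intro power_mono) auto
qed

abbreviation m :: "'h \<Rightarrow> real measure" where "m \<equiv> spectral_meas E"

lemma sets_m [simp, measurable_cong]: "sets (m x) = sets borel"
  by (simp add: spectral_meas_def)

lemma space_m [simp]: "space (m x) = UNIV"
  by (simp add: spectral_meas_def)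

lemma cdf_limits:
  assumes x: "x \<in> H"
  shows "continuous (at_right t) (\<lambda>t. inner (E t x) x)"
    and "((\<lambda>t. inner (E t x) x) \<longlongrightarrow> 0) at_bot"
    and "((\<lambda>t. inner (E t x) x) \<longlongrightarrow> inner x x) at_top"
proof -
  show "continuous (at_right t) (\<lambda>t. inner (E t x) x)"
    unfolding continuous_within by (intro tendsto_intros E_right x)
  have "((\<lambda>t. inner (E t x) x) \<longlongrightarrow> inner 0 x) at_bot" by (intro tendsto_intros E_bot x)
  then show "((\<lambda>t. inner (E t x) x) \<longlongrightarrow> 0) at_bot" by simp
  show "((\<lambda>t. inner (E t x) x) \<longlongrightarrow> inner x x) at_top" by (intro tendsto_intros E_top x)
qed

lemma finite_m: "x \<in> H \<Longrightarrow> finite_measure (m x)"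
  unfolding spectral_meas_def
  using finite_borel_measure_interval_measure[OF E_mono cdf_limits]
  by (simp add: finite_borel_measure_def)

lemma measure_m_atMost: "x \<in> H \<Longrightarrow> measure (m x) {..t} = inner (E t x) x"
  unfolding spectral_meas_def by (rule measure_interval_measure_Iic[OF E_mono cdf_limits(1,2)])

lemma measure_m_UNIV: "x \<in> H \<Longrightarrow> measure (m x) UNIV = inner x x"
  unfolding spectral_meas_def measure_def
  by (subst interval_measure_UNIV[OF E_mono cdf_limits]) auto

lemma integrable_m_bounded [simp]:
  assumes "x \<in> H" "bounded_borel f" shows "integrable (m x) f"
proof -
  interpret finite_measure "m x" using assms finite_m by blast
  obtain C where "\<And>t. \<bar>f t\<bar> \<le> C" using assms by (meson bounded_borelE)
  then show ?thesis
    by (intro integrable_const_bound[of _ C]) (use assms in \<open>auto simp: bounded_borel_def\<close>)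
qed

definition Q :: "(real \<Rightarrow> real) \<Rightarrow> 'h \<Rightarrow> real" where
  "Q f x = (\<integral>t. f t \<partial>m x)"

lemma Q_indicator_atMost: "x \<in> H \<Longrightarrow> Q (indicator {..t}) x = inner (E t x) x"
  by (simp add: Q_def measure_m_atMost)

lemma Q_one: "x \<in> H \<Longrightarrow> Q (\<lambda>_. 1) x = inner x x"
  by (simp add: Q_def measure_m_UNIV)

text \<open>A quadratic identity that holds for every \<open>E t\<close> passes to all integrals.
  Applications encode coefficients and vectors as lists, so that each identity is settled by
  linearity and symmetry of \<open>E t\<close>.\<close>

lemma Q_relation:
  fixes z :: "nat \<Rightarrow> 'h" and c :: "nat \<Rightarrow> real"
  assumes z: "\<And>i. i < n \<Longrightarrow> z i \<in> H"
    and rel: "\<And>t. (\<Sum>i<n. c i * inner (E t (z i)) (z i)) = 0"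
    and f: "f \<in> borel_measurable borel" "\<And>i. i < n \<Longrightarrow> integrable (m (z i)) f"
  shows "(\<Sum>i<n. c i * Q f (z i)) = 0"
proof -
  have "(\<Sum>i\<in>{..<n}. \<integral>u. f u * c i \<partial>m (z i)) = 0"
  proof (rule sum_integrals_zero)
    fix t
    show "(\<Sum>i<n. \<integral>u. indicator {..t} u * c i \<partial>m (z i)) = 0"
      using rel[of t] z by (simp add: measure_m_atMost mult.commute)
  qed (use z f in auto)
  then show ?thesis by (simp add: Q_def mult.commute)
qed

lemma measure_m_parallelogram:
  assumes "x \<in> H" "y \<in> H" "A \<in> sets borel"
  shows "measure (m (x + y)) A + measure (m (x - y)) A = 2 * measure (m x) A + 2 * measure (m y) A"
proof -
  have "(\<Sum>i<4. ([1, 1, -2, -2] ! i) * Q (indicator A) ([x + y, x - y, x, y] ! i)) = 0"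
  proof (rule Q_relation)
    show "(\<Sum>i<4. [1, 1, -2, -2] ! i * inner (E t ([x + y, x - y, x, y] ! i)) ([x + y, x - y, x, y] ! i)) = 0" for t
      using assms by (simp add: eval_nat_numeral E_add E_diff inner_simps)
  qed (use assms in \<open>auto simp: eval_nat_numeral less_Suc_eq\<close>)
  then show ?thesis using assms by (simp add: eval_nat_numeral Q_def)
qed

lemma measure_m_scale:
  assumes "x \<in> H" "A \<in> sets borel"
  shows "measure (m (c *\<^sub>R x)) A = c\<^sup>2 * measure (m x) A"
proof -
  have "(\<Sum>i<2. ([1, -c\<^sup>2] ! i) * Q (indicator A) ([c *\<^sub>R x, x] ! i)) = 0"
  proof (rule Q_relation)
    show "(\<Sum>i<2. [1, -c\<^sup>2] ! i * inner (E t ([c *\<^sub>R x, x] ! i)) ([c *\<^sub>R x, x] ! i)) = 0" for t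
      using assms by (simp add: eval_nat_numeral E_scale inner_simps)
  qed (use assms in \<open>auto simp: eval_nat_numeral less_Suc_eq\<close>)
  then show ?thesis using assms by (simp add: eval_nat_numeral Q_def)
qed

lemma emeasure_m: "x \<in> H \<Longrightarrow> emeasure (m x) A = ennreal (measure (m x) A)"
  using finite_m[of x] by (simp add: finite_measure.emeasure_eq_measure)

lemma nn_integral_m_add:
  assumes "x \<in> H" "y \<in> H" "f \<in> borel_measurable borel"
  shows "(\<integral>\<^sup>+t. f t \<partial>m (x + y)) \<le> 2 * (\<integral>\<^sup>+t. f t \<partial>m x) + 2 * (\<integral>\<^sup>+t. f t \<partial>m y)"
proof (rule nn_integral_le_of_measure_le)
  fix A :: "real set" assume A: "A \<in> sets borel"
  have "measure (m (x + y)) A \<le> 2 * measure (m x) A + 2 * measure (m y) A"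
    using measure_m_parallelogram[OF assms(1,2) A] measure_nonneg[of "m (x - y)" A] by linarith
  then have "emeasure (m (x + y)) A \<le> ennreal (2 * measure (m x) A + 2 * measure (m y) A)"
    unfolding emeasure_m[OF H_add[OF assms(1,2)]] by (rule ennreal_leI)
  then show "emeasure (m (x + y)) A \<le> 2 * emeasure (m x) A + 2 * emeasure (m y) A"
    using assms by (simp add: emeasure_m ennreal_plus ennreal_mult'')
qed (use assms in auto)

lemma nn_integral_m_scale:
  assumes "x \<in> H" "f \<in> borel_measurable borel"
  shows "(\<integral>\<^sup>+t. f t \<partial>m (c *\<^sub>R x)) \<le> ennreal (c\<^sup>2) * (\<integral>\<^sup>+t. f t \<partial>m x)"
proof -
  have "(\<integral>\<^sup>+t. f t \<partial>m (c *\<^sub>R x)) \<le> ennreal (c\<^sup>2) * (\<integral>\<^sup>+t. f t \<partial>m x) + 0 * (\<integral>\<^sup>+t. f t \<partial>m x)"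
    by (rule nn_integral_le_of_measure_le[where L=borel])
      (use assms in \<open>auto simp: emeasure_m measure_m_scale ennreal_mult\<close>)
  then show ?thesis by simp
qed

section \<open>Vectors whose spectral measure integrates a given function, and polarization\<close>

definition L1 :: "(real \<Rightarrow> real) \<Rightarrow> 'h set" where
  "L1 f = {x\<in>H. integrable (m x) f}"

lemma subspace_L1:
  assumes f: "f \<in> borel_measurable borel"
  shows "subspace (L1 f)"
  unfolding subspace_def
proof (intro conjI ballI allI)
  note [measurable] = f
  have fin: "(\<integral>\<^sup>+t. norm (f t) \<partial>m x) < \<infinity>" if "x \<in> L1 f" for x
    using that by (simp add: L1_def integrable_iff_bounded)
  show "x + y \<in> L1 f" if "x \<in> L1 f" "y \<in> L1 f" for x y
  proof -
    have H: "x \<in> H" "y \<in> H" using that by (auto simp: L1_def)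
    have "(\<integral>\<^sup>+t. norm (f t) \<partial>m (x + y)) \<le> 2 * (\<integral>\<^sup>+t. norm (f t) \<partial>m x) + 2 * (\<integral>\<^sup>+t. norm (f t) \<partial>m y)"
      by (rule nn_integral_m_add[OF H]) measurable
    also have "\<dots> < \<infinity>" using fin[OF that(1)] fin[OF that(2)] by (simp add: ennreal_mult_less_top)
    finally show ?thesis using H by (simp add: L1_def integrable_iff_bounded)
  qed
  show sc: "c *\<^sub>R x \<in> L1 f" if "x \<in> L1 f" for c x
  proof -
    have H: "x \<in> H" using that by (auto simp: L1_def)
    have "(\<integral>\<^sup>+t. norm (f t) \<partial>m (c *\<^sub>R x)) \<le> ennreal (c\<^sup>2) * (\<integral>\<^sup>+t. norm (f t) \<partial>m x)"
      by (rule nn_integral_m_scale[OF H]) measurable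
    also have "\<dots> < \<infinity>" using fin[OF that] by (simp add: ennreal_mult_less_top)
    finally show ?thesis using H by (simp add: L1_def integrable_iff_bounded)
  qed
  have "measure (m 0) UNIV = 0" by (simp add: measure_m_UNIV)
  then have "emeasure (m 0) UNIV = 0" by (simp add: emeasure_m)
  then have "(\<integral>\<^sup>+t. norm (f t) \<partial>m 0) = 0"
    by (intro nn_integral_0_iff_AE[THEN iffD2] AE_I[where N=UNIV]) auto
  then show "0 \<in> L1 f" by (simp add: L1_def integrable_iff_bounded)
qed

lemma L1_bounded [simp]: "bounded_borel f \<Longrightarrow> L1 f = H"
  by (auto simp: L1_def)

definition bil :: "(real \<Rightarrow> real) \<Rightarrow> 'h \<Rightarrow> 'h \<Rightarrow> real" where
  "bil f x v = (Q f (x + v) - Q f (x - v)) / 4"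

lemma E_cross: "x \<in> H \<Longrightarrow> y \<in> H \<Longrightarrow> inner (E t y) x = inner (E t x) y"
  using E_sym[of x y t] by (simp add: inner_commute)

text \<open>Each law is a relation between finitely many spectral measures with coefficients read
  off from polarization. Since \<open>L1 f\<close> is a subspace, all vectors involved integrate
  f.\<close>

lemma
  assumes f: "f \<in> borel_measurable borel" and x: "x \<in> L1 f" and y: "y \<in> L1 f" and v: "v \<in> L1 f"
  shows bil_add: "bil f (x + y) v = bil f x v + bil f y v"
    and bil_scale: "bil f (c *\<^sub>R x) v = c * bil f x v"
    and bil_sym: "bil f x v = bil f v x"
    and bil_self: "bil f x x = Q f x"
proof -
  have L: "a \<in> L1 f \<Longrightarrow> b \<in> L1 f \<Longrightarrow> a + b \<in> L1 f" "a \<in> L1 f \<Longrightarrow> b \<in> L1 f \<Longrightarrow> a - b \<in> L1 f"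
    "a \<in> L1 f \<Longrightarrow> r *\<^sub>R a \<in> L1 f" "0 \<in> L1 f" for a b r
    using subspace_L1[OF f] by (auto simp: subspace_add subspace_diff subspace_scale subspace_0)
  have LH: "a \<in> L1 f \<Longrightarrow> a \<in> H" for a by (simp add: L1_def)
  note H = LH[OF x] LH[OF y] LH[OF v]
  have rel: "(\<Sum>i<n. c i * Q f (z i)) = 0"
    if "\<And>i. i < n \<Longrightarrow> z i \<in> L1 f" "\<And>t. (\<Sum>i<n. c i * inner (E t (z i)) (z i)) = 0"
    for n :: nat and z c
    by (rule Q_relation) (use that f in \<open>auto simp: L1_def\<close>)
  have c: "inner (E t v) x = inner (E t x) v" "inner (E t v) y = inner (E t y) v"
    "inner (E t y) x = inner (E t x) y" for t using E_cross H by auto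
  have "(\<Sum>i<6. ([1, -1, -1, 1, -1, 1] ! i) * Q f ([x + y + v, x + y - v, x + v, x - v, y + v, y - v] ! i)) = 0"
    by (rule rel) (use x y v L H c in \<open>auto simp: eval_nat_numeral less_Suc_eq E_add E_diff E_scale inner_simps\<close>)
  then show "bil f (x + y) v = bil f x v + bil f y v"
    by (simp add: eval_nat_numeral bil_def field_simps)
  have "(\<Sum>i<4. ([1, -1, -c, c] ! i) * Q f ([c *\<^sub>R x + v, c *\<^sub>R x - v, x + v, x - v] ! i)) = 0"
    by (rule rel) (use x y v L H c in \<open>auto simp: eval_nat_numeral less_Suc_eq E_add E_diff E_scale inner_simps algebra_simps\<close>)
  then show "bil f (c *\<^sub>R x) v = c * bil f x v"
    by (simp add: eval_nat_numeral bil_def field_simps)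
  have "(\<Sum>i<2. ([1, -1] ! i) * Q f ([x - v, v - x] ! i)) = 0"
    by (rule rel) (use x y v L H c in \<open>auto simp: eval_nat_numeral less_Suc_eq E_add E_diff E_scale inner_simps\<close>)
  then show "bil f x v = bil f v x"
    by (simp add: eval_nat_numeral bil_def field_simps add.commute)
  \<comment> \<open>Polarization at v = x involves 2x and 0; the coefficient -4 reflects the
    quadratic scaling of the measures.\<close>
  have "(\<Sum>i<3. ([1, -1, -4] ! i) * Q f ([x + x, 0, x] ! i)) = 0"
    by (rule rel) (use x y v L H c E_scale[of x 0] in \<open>auto simp: eval_nat_numeral less_Suc_eq E_add E_diff E_scale inner_simps\<close>)
  then show "bil f x x = Q f x"
    by (simp add: eval_nat_numeral bil_def field_simps)
qed

lemma bil_add_right: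
  assumes "f \<in> borel_measurable borel" "x \<in> L1 f" "y \<in> L1 f" "v \<in> L1 f"
  shows "bil f v (x + y) = bil f v x + bil f v y"
proof -
  have "x + y \<in> L1 f" using assms subspace_L1 by (blast intro: subspace_add)
  then show ?thesis using assms bil_add bil_sym by metis
qed

lemma bil_scale_right:
  assumes "f \<in> borel_measurable borel" "x \<in> L1 f" "v \<in> L1 f"
  shows "bil f v (c *\<^sub>R x) = c * bil f v x"
proof -
  have "c *\<^sub>R x \<in> L1 f" using assms subspace_L1 by (blast intro: subspace_scale)
  then show ?thesis using assms bil_scale bil_sym by metis
qed

lemma Q_bound:
  assumes x: "x \<in> H" and f: "f \<in> borel_measurable borel" and C: "\<And>t. \<bar>f t\<bar> \<le> C"
  shows "\<bar>Q f x\<bar> \<le> C * inner x x"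
proof -
  have i: "integrable (m x) f" using x bounded_borelI[OF f C] by simp
  have "\<bar>Q f x\<bar> \<le> (\<integral>t. \<bar>f t\<bar> \<partial>m x)" unfolding Q_def by (rule integral_abs_bound)
  also have "\<dots> \<le> (\<integral>t. C \<partial>m x)" using i x C by (intro integral_mono) auto
  also have "\<dots> = C * inner x x" using measure_m_UNIV[OF x] by simp
  finally show ?thesis .
qed

section \<open>Bounded Borel calculus\<close>

definition Phi :: "(real \<Rightarrow> real) \<Rightarrow> 'h \<Rightarrow> 'h" where
  "Phi f x = (SOME y. y \<in> H \<and> (\<forall>v\<in>H. inner y v = bil f x v))"

text \<open>Riesz representation in v. Normalizing v and applying the parallelogram law gives the
  bound C (|x|^2 + 1) / 2, crude in x but linear in |v|, which is all that a fixed x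
  requires.\<close>

lemma
  assumes f: "bounded_borel f" and x: "x \<in> H"
  shows Phi_in [simp]: "Phi f x \<in> H"
    and inner_Phi: "v \<in> H \<Longrightarrow> inner (Phi f x) v = bil f x v"
proof -
  have fm: "f \<in> borel_measurable borel" using f by (simp add: bounded_borel_def)
  obtain C where C: "0 \<le> C" "\<And>t. \<bar>f t\<bar> \<le> C" using f by (meson bounded_borelE)
  have b: "\<bar>bil f x v\<bar> \<le> (C * (inner x x + 1) / 2) * norm v" if v: "v \<in> H" for v
  proof (cases "v = 0")
    case True
    then show ?thesis by (simp add: bil_def)
  next
    case False
    define u where "u = (1 / norm v) *\<^sub>R v"
    have u: "u \<in> H" "inner u u = 1" "v = norm v *\<^sub>R u"
      using v False by (auto simp: u_def dot_square_norm power2_eq_square)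
    have "\<bar>Q f (x + u) - Q f (x - u)\<bar> \<le> C * inner (x + u) (x + u) + C * inner (x - u) (x - u)"
      using Q_bound[OF _ fm C(2), of "x + u"] Q_bound[OF _ fm C(2), of "x - u"] x u by force
    also have "\<dots> = C * (inner (x + u) (x + u) + inner (x - u) (x - u))" by (simp only: distrib_left)
    also have "\<dots> = C * (2 * inner x x + 2 * inner u u)"
      by (simp only: semi_form.parallelogram[OF semi_form_inner x u(1)])
    finally have "\<bar>bil f x u\<bar> \<le> C * (inner x x + 1) / 2" by (simp add: bil_def u(2) field_simps)
    then have "norm v * \<bar>bil f x u\<bar> \<le> norm v * (C * (inner x x + 1) / 2)" by (intro mult_left_mono) auto
    moreover have "bil f x v = norm v * bil f x u"
      by (subst u(3), rule bil_scale_right) (use fm f x u in auto)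
    ultimately show ?thesis by (simp add: abs_mult mult.commute)
  qed
  obtain y where "y \<in> H" "\<And>v. v \<in> H \<Longrightarrow> inner y v = bil f x v"
    by (rule riesz[of "bil f x", OF _ _ b])
      (use f fm x bil_add_right bil_scale_right in auto)
  then have "\<exists>y. y \<in> H \<and> (\<forall>v\<in>H. inner y v = bil f x v)" by blast
  from someI_ex[OF this] show "Phi f x \<in> H" "v \<in> H \<Longrightarrow> inner (Phi f x) v = bil f x v"
    unfolding Phi_def by auto
qed

lemma Phi_unique:
  "bounded_borel f \<Longrightarrow> x \<in> H \<Longrightarrow> y \<in> H \<Longrightarrow> (\<And>v. v \<in> H \<Longrightarrow> inner y v = bil f x v) \<Longrightarrow> Phi f x = y"
  by (rule eqI) (auto simp: inner_Phi)

lemma bil_fun_diff: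
  assumes "x \<in> H" "v \<in> H" "bounded_borel f" "bounded_borel g"
  shows "bil (\<lambda>t. f t - g t) x v = bil f x v - bil g x v"
  using assms by (simp add: bil_def Q_def diff_divide_distrib)

lemma Phi_fun_diff:
  "x \<in> H \<Longrightarrow> bounded_borel f \<Longrightarrow> bounded_borel g \<Longrightarrow> Phi (\<lambda>t. f t - g t) x = Phi f x - Phi g x"
  by (intro Phi_unique) (auto simp: bil_fun_diff inner_diff_left inner_Phi)

lemma Phi_fun_scale: "x \<in> H \<Longrightarrow> bounded_borel f \<Longrightarrow> Phi (\<lambda>t. r * f t) x = r *\<^sub>R Phi f x"
proof (rule Phi_unique)
  fix v assume "x \<in> H" "bounded_borel f" "v \<in> H"
  moreover have "bil (\<lambda>t. r * f t) x v = r * bil f x v"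
    by (simp add: bil_def Q_def right_diff_distrib)
  ultimately show "inner (r *\<^sub>R Phi f x) v = bil (\<lambda>t. r * f t) x v" by (simp add: inner_Phi)
qed auto

lemma Phi_add: "x \<in> H \<Longrightarrow> y \<in> H \<Longrightarrow> bounded_borel f \<Longrightarrow> Phi f (x + y) = Phi f x + Phi f y"
  by (intro Phi_unique) (auto simp: inner_add_left inner_Phi bil_add bounded_borel_def[of f])

lemma Phi_scale: "x \<in> H \<Longrightarrow> bounded_borel f \<Longrightarrow> Phi f (c *\<^sub>R x) = c *\<^sub>R Phi f x"
  by (intro Phi_unique) (auto simp: inner_Phi bil_scale bounded_borel_def[of f])

lemma Phi_sym: "x \<in> H \<Longrightarrow> y \<in> H \<Longrightarrow> bounded_borel f \<Longrightarrow> inner (Phi f x) y = inner x (Phi f y)"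
  using bil_sym[of f x x y] by (simp add: inner_Phi inner_commute[of x] bounded_borel_def[of f])

lemma bil_one: "x \<in> H \<Longrightarrow> v \<in> H \<Longrightarrow> bil (\<lambda>_. 1) x v = inner x v"
  by (simp add: bil_def Q_one inner_simps inner_commute)

lemma Phi_one: "x \<in> H \<Longrightarrow> Phi (\<lambda>_. 1) x = x"
  by (intro Phi_unique) (auto simp: bil_one)

lemma bil_indicator_atMost: "x \<in> H \<Longrightarrow> v \<in> H \<Longrightarrow> bil (indicator {..t}) x v = inner (E t x) v"
  using E_cross[of x v t] by (simp add: bil_def Q_indicator_atMost E_add E_diff inner_simps)

lemma Phi_indicator_atMost: "x \<in> H \<Longrightarrow> Phi (indicator {..t}) x = E t x"
  by (intro Phi_unique) (auto simp: bil_indicator_atMost)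

lemma integral_indicator_cut:
  "(\<integral>u. indicator {..s} u * indicator {..t} u \<partial>m z) = Q (indicator {..min s t}) z"
  unfolding Q_def by (intro Bochner_Integration.integral_cong) (auto simp: indicator_def)

text \<open>On half-lines both sides reduce to E s E t = E (min s t). The weights are the signs of
  polarization, with the indicator as density on the first two measures.\<close>

lemma bil_cut:
  assumes f: "bounded_borel f" and x: "x \<in> H" and v: "v \<in> H"
  shows "bil (\<lambda>u. f u * indicator {..t} u) x v = bil f x (E t v)"
proof -
  let ?M = "\<lambda>i. m ([x + v, x - v, x + E t v, x - E t v] ! i)"
  let ?h = "\<lambda>i::nat. [indicator {..t}, (\<lambda>u. - indicator {..t} u), (\<lambda>u. -1), (\<lambda>u. 1)] ! i :: real \<Rightarrow> real"
  have bi: "bounded_borel (\<lambda>u. f u * indicator {..t} u)" using f by simp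
  have "(\<Sum>i\<in>{..<4}. \<integral>u. f u * ?h i u \<partial>?M i) = 0"
  proof (rule sum_integrals_zero)
    fix s
    have "bil (indicator {..min s t}) x v = bil (indicator {..s}) x (E t v)"
      using x v by (simp add: bil_indicator_atMost) (metis E_in E_mult E_sym min.commute)
    then show "(\<Sum>i<4. \<integral>u. indicator {..s} u * ?h i u \<partial>?M i) = 0"
      by (simp add: eval_nat_numeral integral_indicator_cut bil_def) (simp add: Q_def)
  qed (use x v f bi bounded_borel_measurable[OF f] in \<open>auto simp: eval_nat_numeral less_Suc_eq\<close>)
  then show ?thesis by (simp add: eval_nat_numeral bil_def Q_def)
qed

lemma integrable_m_mult_bounded:
  assumes "x \<in> H" "bounded_borel f" "integrable (m x) g" "g \<in> borel_measurable borel"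
  shows "integrable (m x) (\<lambda>u. g u * f u)"
proof -
  obtain C where C: "0 \<le> C" "\<And>t. \<bar>f t\<bar> \<le> C" using assms by (meson bounded_borelE)
  have [measurable]: "f \<in> borel_measurable borel" "g \<in> borel_measurable borel"
    using assms by (auto simp: bounded_borel_def)
  show ?thesis
  proof (rule Bochner_Integration.integrable_bound)
    show "integrable (m x) (\<lambda>u. C * g u)" using assms by auto
    show "AE u in m x. norm (g u * f u) \<le> norm (C * g u)"
    proof (rule AE_I2)
      fix u show "norm (g u * f u) \<le> norm (C * g u)"
        using mult_left_mono[OF C(2)[of u], of "\<bar>g u\<bar>"] C by (simp add: abs_mult mult.commute)
    qed
  qed measurable
qed

text \<open>The measure d<E Phi(f) x, v> is f d<E x, v>; on half-lines this is
  \<open>bil_cut\<close>. The function g may be unbounded, as commutation with unbounded operators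
  needs.\<close>

lemma bil_Phi_general:
  assumes f: "bounded_borel f" and x: "x \<in> H" and v: "v \<in> H"
    and g: "g \<in> borel_measurable borel"
    and gi: "integrable (m (Phi f x + v)) g" "integrable (m (Phi f x - v)) g"
      "integrable (m (x + v)) (\<lambda>u. g u * f u)" "integrable (m (x - v)) (\<lambda>u. g u * f u)"
  shows "bil g (Phi f x) v = bil (\<lambda>u. g u * f u) x v"
proof -
  let ?y = "Phi f x"
  let ?M = "\<lambda>i. m ([?y + v, ?y - v, x + v, x - v] ! i)"
  let ?h = "\<lambda>i::nat. [\<lambda>u. 1, \<lambda>u. -1, \<lambda>u. - f u, f] ! i"
  have "(\<Sum>i\<in>{..<4}. \<integral>u. g u * ?h i u \<partial>?M i) = 0"
  proof (rule sum_integrals_zero)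
    fix s
    have "bil (indicator {..s}) ?y v = bil (\<lambda>u. f u * indicator {..s} u) x v"
      using x v f by (simp add: bil_indicator_atMost bil_cut E_sym inner_Phi)
    then show "(\<Sum>i<4. \<integral>u. indicator {..s} u * ?h i u \<partial>?M i) = 0"
      by (simp add: eval_nat_numeral bil_def Q_def mult.commute)
  qed (use x v f g gi in \<open>auto simp: eval_nat_numeral less_Suc_eq\<close>)
  then show ?thesis by (simp add: eval_nat_numeral bil_def Q_def)
qed

lemma bil_Phi:
  "bounded_borel f \<Longrightarrow> bounded_borel g \<Longrightarrow> x \<in> H \<Longrightarrow> v \<in> H \<Longrightarrow>
    bil g (Phi f x) v = bil (\<lambda>u. g u * f u) x v"
  by (rule bil_Phi_general) (auto simp: bounded_borel_def[of g])

lemma Phi_mult: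
  "bounded_borel f \<Longrightarrow> bounded_borel g \<Longrightarrow> x \<in> H \<Longrightarrow> Phi g (Phi f x) = Phi (\<lambda>u. g u * f u) x"
  by (intro Phi_unique) (auto simp: bil_Phi inner_Phi)

text \<open>Two applications of the density rule, one in each argument, with symmetry in
  between.\<close>

lemma Q_Phi:
  assumes "bounded_borel f" "bounded_borel g" "x \<in> H"
  shows "Q g (Phi f x) = Q (\<lambda>u. g u * (f u)\<^sup>2) x"
proof -
  have gm: "g \<in> borel_measurable borel" using assms by (simp add: bounded_borel_def)
  have "Q g (Phi f x) = bil g (Phi f x) (Phi f x)" using assms gm by (simp add: bil_self)
  also have "\<dots> = bil (\<lambda>u. g u * f u) x (Phi f x)" using assms by (simp add: bil_Phi)
  also have "\<dots> = bil (\<lambda>u. g u * f u) (Phi f x) x"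
    using assms gm by (intro bil_sym) (simp_all add: bounded_borel_measurable)
  also have "\<dots> = bil (\<lambda>u. (g u * f u) * f u) x x" using assms by (simp add: bil_Phi)
  also have "\<dots> = Q (\<lambda>u. (g u * f u) * f u) x"
    using assms by (intro bil_self) (simp_all add: bounded_borel_measurable)
  finally show ?thesis by (simp add: power2_eq_square mult.assoc)
qed

lemma inner_Phi_self: "bounded_borel f \<Longrightarrow> x \<in> H \<Longrightarrow> inner (Phi f x) x = Q f x"
  by (simp add: inner_Phi bil_self bounded_borel_def)

lemma norm_Phi: "bounded_borel f \<Longrightarrow> x \<in> H \<Longrightarrow> inner (Phi f x) (Phi f x) = Q (\<lambda>u. (f u)\<^sup>2) x"
  using Q_Phi[of f "\<lambda>_. 1" x] by (simp add: Q_one)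

text \<open>Raises \<open>Q_Phi\<close> from integrals to measures, so that integrability of
  unbounded functions at \<open>Phi f x\<close> can be tested at x.\<close>

lemma m_Phi:
  assumes f: "bounded_borel f" and x: "x \<in> H"
  shows "m (Phi f x) = density (m x) (\<lambda>u. ennreal ((f u)\<^sup>2))"
proof (rule measure_eqI)
  have [measurable]: "f \<in> borel_measurable borel" using f by (simp add: bounded_borel_def)
  fix A assume "A \<in> sets (m (Phi f x))"
  then have A [measurable]: "A \<in> sets borel" by simp
  have "emeasure (m (Phi f x)) A = ennreal (Q (indicator A) (Phi f x))"
    using f x A by (simp add: emeasure_m Q_def)
  also have "\<dots> = ennreal (\<integral>u. indicator A u * (f u)\<^sup>2 \<partial>m x)"
    using f x A by (simp add: Q_Phi) (simp add: Q_def)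
  also have "\<dots> = (\<integral>\<^sup>+u. ennreal (indicator A u * (f u)\<^sup>2) \<partial>m x)"
    using f x by (intro nn_integral_eq_integral[symmetric]) auto
  also have "\<dots> = emeasure (density (m x) (\<lambda>u. ennreal ((f u)\<^sup>2))) A"
    by (subst emeasure_density) (auto intro!: nn_integral_cong simp: indicator_def)
  finally show "emeasure (m (Phi f x)) A = emeasure (density (m x) (\<lambda>u. ennreal ((f u)\<^sup>2))) A" .
qed simp

lemma integrable_m_Phi:
  assumes "bounded_borel f" "x \<in> H" "g \<in> borel_measurable borel"
  shows "integrable (m (Phi f x)) g \<longleftrightarrow> integrable (m x) (\<lambda>u. (f u)\<^sup>2 * g u)"
  unfolding m_Phi[OF assms(1,2)]
  by (subst integrable_density) (use assms bounded_borel_measurable in auto)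

lemma Phi_cong_AE:
  assumes "bounded_borel f" "bounded_borel g" "x \<in> H" "AE u in m x. f u = g u"
  shows "Phi f x = Phi g x"
proof -
  have [measurable]: "f \<in> borel_measurable borel" "g \<in> borel_measurable borel"
    using assms by (auto simp: bounded_borel_def)
  have "inner (Phi f x - Phi g x) (Phi f x - Phi g x) = Q (\<lambda>u. (f u - g u)\<^sup>2) x"
    using assms by (simp add: Phi_fun_diff[symmetric] norm_Phi)
  also have "\<dots> = (\<integral>u. 0 \<partial>m x)"
    unfolding Q_def by (intro integral_cong_AE) (use assms(4) in auto)
  finally show ?thesis by simp
qed

subsection \<open>Unbounded functions\<close>

abbreviation dom :: "(real \<Rightarrow> real) \<Rightarrow> 'h set" where "dom f \<equiv> spectral_dom H E f"
abbreviation SI :: "(real \<Rightarrow> real) \<Rightarrow> ('h \<times> 'h) set" where "SI f \<equiv> spectral_integral H E f"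

lemma dom_H: "x \<in> dom f \<Longrightarrow> x \<in> H" by (simp add: spectral_dom_def)

lemma dom_eq: "dom f = L1 (\<lambda>u. (f u)\<^sup>2)" by (simp add: spectral_dom_def L1_def)

text \<open>Spectral measures are finite, so square integrability implies integrability;
  \<open>bil f\<close> is thus meaningful on the domain of f.\<close>

lemma dom_subset_L1:
  assumes "f \<in> borel_measurable borel" shows "dom f \<subseteq> L1 f"
proof
  fix x assume x: "x \<in> dom f"
  then have "x \<in> H" "integrable (m x) (\<lambda>u. (f u)\<^sup>2)" by (auto simp: spectral_dom_def)
  then show "x \<in> L1 f"
    using finite_measure.square_integrable_imp_integrable[of "m x" f] finite_m[of x] assms
    by (simp add: L1_def)
qed

lemma subspace_dom: "f \<in> borel_measurable borel \<Longrightarrow> subspace (dom f)"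
  unfolding dom_eq by (rule subspace_L1) simp

lemma SI_iff: "(x, y) \<in> SI f \<longleftrightarrow> x \<in> dom f \<and> y \<in> H \<and> (\<forall>v\<in>dom f. inner y v = bil f x v)"
  by (auto simp: spectral_integral_def bil_def Q_def)

text \<open>Symbol of the spectral projection onto |f| <= n. That projection maps into the domain of
  f and tends strongly to the identity.\<close>

definition cut :: "(real \<Rightarrow> real) \<Rightarrow> nat \<Rightarrow> real \<Rightarrow> real" where
  "cut f n u = indicator {u. \<bar>f u\<bar> \<le> real n} u"

lemma cut_tendsto: "(\<lambda>n. cut f n u) \<longlonglongrightarrow> 1"
proof (rule tendsto_eventually)
  obtain N :: nat where "\<bar>f u\<bar> \<le> real N" using real_arch_simple by blast
  then show "\<forall>\<^sub>F n in sequentially. cut f n u = 1"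
    unfolding eventually_sequentially cut_def by (intro exI[of _ N]) (auto simp: indicator_def)
qed

lemma bounded_borel_cut [simp]:
  assumes "f \<in> borel_measurable borel" shows "bounded_borel (cut f n)"
proof -
  note [measurable] = assms
  have "{u. \<bar>f u\<bar> \<le> real n} \<in> sets borel" by measurable
  then show ?thesis unfolding cut_def[abs_def] by (rule bounded_borel_indicator)
qed

lemma bounded_borel_cut_mult [simp]:
  assumes "f \<in> borel_measurable borel" shows "bounded_borel (\<lambda>u. f u * cut f n u)"
proof (rule bounded_borelI)
  show "(\<lambda>u. f u * cut f n u) \<in> borel_measurable borel"
    using assms bounded_borel_measurable[OF bounded_borel_cut[OF assms, of n]] by auto
  show "\<bar>f u * cut f n u\<bar> \<le> real n" for u by (auto simp: cut_def indicator_def)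
qed

lemma Phi_cut_in_dom:
  assumes f: "f \<in> borel_measurable borel" and x: "x \<in> H"
  shows "Phi (cut f n) x \<in> dom f"
proof -
  have "bounded_borel (\<lambda>u. (f u * cut f n u)\<^sup>2)" using f by simp
  then have "integrable (m x) (\<lambda>u. (f u * cut f n u)\<^sup>2)" using x by simp
  then show ?thesis
    using f x by (simp add: spectral_dom_def integrable_m_Phi power_mult_distrib mult.commute)
qed

lemma Phi_cut_tendsto:
  assumes f: "f \<in> borel_measurable borel" and x: "x \<in> H"
  shows "(\<lambda>n. Phi (cut f n) x) \<longlonglongrightarrow> x"
proof -
  have [measurable]: "cut f n \<in> borel_measurable borel" for n
    using bounded_borel_cut[OF f] by (simp add: bounded_borel_def)
  have "(\<lambda>n. \<integral>u. (cut f n u - 1)\<^sup>2 \<partial>m x) \<longlonglongrightarrow> (\<integral>u. (1 - 1)\<^sup>2 \<partial>m x)"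
  proof (rule integral_dominated_convergence[where w="\<lambda>_. 1"])
    show "AE u in m x. (\<lambda>n. (cut f n u - 1)\<^sup>2) \<longlonglongrightarrow> (1 - 1)\<^sup>2"
      by (intro AE_I2 tendsto_intros cut_tendsto)
    show "AE u in m x. norm ((cut f n u - 1)\<^sup>2) \<le> 1" for n
      by (rule AE_I2) (auto simp: cut_def indicator_def)
  qed (use x in auto)
  moreover have "(\<integral>u. (cut f n u - 1)\<^sup>2 \<partial>m x) = (norm (Phi (cut f n) x - x))\<^sup>2" for n
    using norm_Phi[of "\<lambda>u. cut f n u - 1" x] x f
    by (simp add: Phi_fun_diff Phi_one Q_def power2_norm_eq_inner)
  ultimately have "(\<lambda>n. (norm (Phi (cut f n) x - x))\<^sup>2) \<longlonglongrightarrow> 0" by simp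
  then have "(\<lambda>n. norm (Phi (cut f n) x - x)) \<longlonglongrightarrow> 0"
    using tendsto_real_sqrt by fastforce
  then show ?thesis by (simp add: LIM_zero_iff tendsto_norm_zero_iff)
qed

text \<open>Cut vectors lie in the domain and converge to v. This makes a spectral integral
  single-valued, since its values are tested only against the domain.\<close>

lemma dom_dense:
  assumes f: "f \<in> borel_measurable borel" and yz: "y \<in> H" "z \<in> H"
    and eq: "\<And>v. v \<in> dom f \<Longrightarrow> inner y v = inner z v"
  shows "y = z"
proof (rule eqI[OF yz])
  fix v assume v: "v \<in> H"
  have 1: "(\<lambda>n. inner y (Phi (cut f n) v)) \<longlonglongrightarrow> inner y v"
    by (intro tendsto_intros Phi_cut_tendsto f v)
  have "(\<lambda>n. inner z (Phi (cut f n) v)) \<longlonglongrightarrow> inner z v"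
    by (intro tendsto_intros Phi_cut_tendsto f v)
  then show "inner y v = inner z v"
    using 1 eq[OF Phi_cut_in_dom[OF f v]] LIMSEQ_unique by auto
qed

lemma SI_unique: "f \<in> borel_measurable borel \<Longrightarrow> (x, y) \<in> SI f \<Longrightarrow> (x, z) \<in> SI f \<Longrightarrow> y = z"
  using dom_dense[of f y z] by (auto simp: SI_iff)

lemma op_apply_SI: "f \<in> borel_measurable borel \<Longrightarrow> (x, y) \<in> SI f \<Longrightarrow> op_apply (SI f) x = y"
  unfolding op_apply_def using SI_unique by (intro the_equality) auto

text \<open>The value is the limit of the truncated operators at x. The isometry between
  \<open>Phi\<close> and square integrals turns mean-square convergence of the truncations into a
  Cauchy sequence.\<close>

lemma SI_exists:
  assumes f: "f \<in> borel_measurable borel" and x: "x \<in> dom f"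
  obtains y where "(x, y) \<in> SI f"
proof -
  have xH: "x \<in> H" and fi: "integrable (m x) (\<lambda>u. (f u)\<^sup>2)" using x by (auto simp: spectral_dom_def)
  have [measurable]: "cut f n \<in> borel_measurable borel" for n
    using bounded_borel_cut[OF f] by (simp add: bounded_borel_def)
  note [measurable] = f
  let ?c = "\<lambda>n u. f u * cut f n u"
  define y where "y n = Phi (?c n) x" for n
  have yH: "y n \<in> H" for n using f xH by (simp add: y_def)
  have "(\<lambda>n. \<integral>u. (?c n u - f u)\<^sup>2 \<partial>m x) \<longlonglongrightarrow> (\<integral>u. (f u * 1 - f u)\<^sup>2 \<partial>m x)"
  proof (rule integral_dominated_convergence[where w="\<lambda>u. (f u)\<^sup>2"])
    show "AE u in m x. (\<lambda>n. (?c n u - f u)\<^sup>2) \<longlonglongrightarrow> (f u * 1 - f u)\<^sup>2"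
      by (intro AE_I2 tendsto_intros cut_tendsto)
    show "AE u in m x. norm ((?c n u - f u)\<^sup>2) \<le> (f u)\<^sup>2" for n
      by (rule AE_I2) (auto simp: cut_def indicator_def)
  qed (use fi in \<open>auto\<close>)
  then have lim0: "(\<lambda>n. \<integral>u. (?c n u - f u)\<^sup>2 \<partial>m x) \<longlonglongrightarrow> 0" by simp
  have int: "integrable (m x) (\<lambda>u. (?c n u - f u)\<^sup>2)" for n
    by (rule Bochner_Integration.integrable_bound[OF fi])
      (auto simp: cut_def indicator_def)
  have "Cauchy y"
  proof (rule Cauchy_inner)
    fix e :: real assume e: "e > 0"
    then have "\<forall>\<^sub>F n in sequentially. (\<integral>u. (?c n u - f u)\<^sup>2 \<partial>m x) < e / 4"
      using order_tendstoD(2)[OF lim0, of "e/4"] by simp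
    then obtain N where N: "\<And>n. n \<ge> N \<Longrightarrow> (\<integral>u. (?c n u - f u)\<^sup>2 \<partial>m x) < e / 4"
      unfolding eventually_sequentially by blast
    have "inner (y k - y n) (y k - y n) < e" if "k \<ge> N" "n \<ge> N" for k n
    proof -
      have "inner (y k - y n) (y k - y n) = (\<integral>u. (?c k u - ?c n u)\<^sup>2 \<partial>m x)"
        using f xH by (simp add: y_def Phi_fun_diff[symmetric] norm_Phi Q_def)
      also have "\<dots> \<le> (\<integral>u. 2 * (?c k u - f u)\<^sup>2 + 2 * (?c n u - f u)\<^sup>2 \<partial>m x)"
      proof (rule integral_mono)
        show "integrable (m x) (\<lambda>u. (?c k u - ?c n u)\<^sup>2)" using f xH by simp
        show "integrable (m x) (\<lambda>u. 2 * (?c k u - f u)\<^sup>2 + 2 * (?c n u - f u)\<^sup>2)" using int by auto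
        show "(?c k u - ?c n u)\<^sup>2 \<le> 2 * (?c k u - f u)\<^sup>2 + 2 * (?c n u - f u)\<^sup>2" for u
        proof -
          have "(p - q)\<^sup>2 \<le> 2 * (p - r)\<^sup>2 + 2 * (q - r)\<^sup>2" for p q r :: real
            using zero_le_power2[of "p + q - 2 * r"] by (simp add: power2_eq_square algebra_simps)
          then show ?thesis .
        qed
      qed
      also have "\<dots> = 2 * (\<integral>u. (?c k u - f u)\<^sup>2 \<partial>m x) + 2 * (\<integral>u. (?c n u - f u)\<^sup>2 \<partial>m x)"
        using int by simp
      also have "\<dots> < e" using N[OF that(1)] N[OF that(2)] by simp
      finally show ?thesis .
    qed
    then show "\<exists>N. \<forall>k\<ge>N. \<forall>n\<ge>N. inner (y k - y n) (y k - y n) < e" by blast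
  qed
  then obtain z where z: "z \<in> H" "y \<longlonglongrightarrow> z" using yH H_Cauchy by blast
  have "inner z v = bil f x v" if v: "v \<in> dom f" for v
  proof -
    have xv: "x + v \<in> L1 f" "x - v \<in> L1 f"
      using subspace_dom[OF f] x v dom_subset_L1[OF f] by (auto simp: subspace_add subspace_diff subset_iff)
    have lim: "(\<lambda>n. Q (?c n) w) \<longlonglongrightarrow> Q f w" if w: "w \<in> L1 f" for w
    proof -
      have "(\<lambda>n. \<integral>u. ?c n u \<partial>m w) \<longlonglongrightarrow> (\<integral>u. f u \<partial>m w)"
      proof (rule integral_dominated_convergence[where w="\<lambda>u. \<bar>f u\<bar>"])
        show "AE u in m w. (\<lambda>n. ?c n u) \<longlonglongrightarrow> f u"
        proof (rule AE_I2)
          fix u have "(\<lambda>n. ?c n u) \<longlonglongrightarrow> f u * 1" by (intro tendsto_intros cut_tendsto)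
          then show "(\<lambda>n. ?c n u) \<longlonglongrightarrow> f u" by simp
        qed
        show "AE u in m w. norm (?c n u) \<le> \<bar>f u\<bar>" for n
          by (rule AE_I2) (auto simp: cut_def indicator_def)
      qed (use w in \<open>auto simp: L1_def\<close>)
      then show ?thesis by (simp add: Q_def)
    qed
    have "(\<lambda>n. bil (?c n) x v) \<longlonglongrightarrow> bil f x v"
      unfolding bil_def by (intro tendsto_intros lim xv) auto
    moreover have "bil (?c n) x v = inner (y n) v" for n
      using f xH dom_H[OF v] by (simp add: y_def inner_Phi)
    moreover have "(\<lambda>n. inner (y n) v) \<longlonglongrightarrow> inner z v" by (intro tendsto_intros z)
    ultimately show ?thesis using LIMSEQ_unique by fastforce
  qed
  then show ?thesis using that[of z] x z by (auto simp: SI_iff)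
qed

lemma Phi_in_dom:
  assumes f: "f \<in> borel_measurable borel" and g: "bounded_borel g" and x: "x \<in> dom f"
  shows "Phi g x \<in> dom f"
proof -
  have xH: "x \<in> H" and fi: "integrable (m x) (\<lambda>u. (f u)\<^sup>2)" using x by (auto simp: spectral_dom_def)
  have "integrable (m x) (\<lambda>u. (f u)\<^sup>2 * (g u)\<^sup>2)"
    by (rule integrable_m_mult_bounded) (use xH fi f g in auto)
  then show ?thesis using f g xH by (simp add: spectral_dom_def integrable_m_Phi mult.commute)
qed

text \<open>The commutation g(T) f(T) x = (f g)(T) x. The bounded factor is moved to the test vector
  v, where \<open>bil_Phi_general\<close> absorbs it; density of the domain then removes v.\<close>

lemma SI_Phi:
  assumes f: "f \<in> borel_measurable borel" and xy: "(x, y) \<in> SI f" and g: "bounded_borel g"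
    and fg: "bounded_borel (\<lambda>u. f u * g u)"
  shows "Phi g y = Phi (\<lambda>u. f u * g u) x"
proof (rule dom_dense[OF f])
  have x: "x \<in> dom f" "x \<in> H" and y: "y \<in> H" using xy dom_H by (auto simp: SI_iff)
  show "Phi g y \<in> H" "Phi (\<lambda>u. f u * g u) x \<in> H" using x y g fg by auto
  fix v assume v: "v \<in> dom f"
  then have vH: "v \<in> H" by (rule dom_H)
  have P: "Phi g v \<in> dom f" by (rule Phi_in_dom[OF f g v])
  have L: "a \<in> dom f \<Longrightarrow> b \<in> dom f \<Longrightarrow> integrable (m (a + b)) f"
    "a \<in> dom f \<Longrightarrow> b \<in> dom f \<Longrightarrow> integrable (m (a - b)) f" for a b
    using subspace_dom[OF f] dom_subset_L1[OF f]
    by (auto simp: subspace_add subspace_diff subset_iff L1_def)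
  have "inner (Phi g y) v = inner y (Phi g v)" using g vH y by (simp add: Phi_sym)
  also have "\<dots> = bil f x (Phi g v)" using xy P by (simp add: SI_iff)
  also have "\<dots> = bil f (Phi g v) x"
    using x P dom_subset_L1[OF f] by (intro bil_sym f) auto
  also have "\<dots> = bil (\<lambda>u. f u * g u) v x"
    by (rule bil_Phi_general) (use g vH x v f fg P L in auto)
  also have "\<dots> = bil (\<lambda>u. f u * g u) x v"
    using x vH fg by (intro bil_sym) (auto simp: bounded_borel_def[of "\<lambda>u. f u * g u"])
  also have "\<dots> = inner (Phi (\<lambda>u. f u * g u) x) v" using x vH fg by (simp add: inner_Phi)
  finally show "inner (Phi g y) v = inner (Phi (\<lambda>u. f u * g u) x) v" .
qed

lemma dom_cong:
  assumes "f \<in> borel_measurable borel" "g \<in> borel_measurable borel"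
    and "\<And>x. x \<in> H \<Longrightarrow> AE u in m x. f u = g u"
  shows "dom f = dom g"
  unfolding spectral_dom_def
proof (intro Collect_cong conj_cong refl)
  fix x assume "x \<in> H"
  then show "integrable (m x) (\<lambda>u. (f u)\<^sup>2) = integrable (m x) (\<lambda>u. (g u)\<^sup>2)"
    using assms(3)[of x] assms(1,2) by (intro integrable_cong_AE) auto
qed

lemma SI_cong:
  assumes "f \<in> borel_measurable borel" "g \<in> borel_measurable borel"
    and AE: "\<And>x. x \<in> H \<Longrightarrow> AE u in m x. f u = g u"
  shows "SI f = SI g"
proof -
  have "bil f x v = bil g x v" if "x \<in> H" "v \<in> H" for x v
  proof -
    have "Q f w = Q g w" if "w \<in> H" for w
      unfolding Q_def using AE[OF that] assms(1,2) by (intro integral_cong_AE) auto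
    then show ?thesis using that by (simp add: bil_def)
  qed
  then show ?thesis
    using dom_cong[OF assms] by (auto simp: SI_iff dest!: dom_H)
qed

lemma SI_bounded:
  assumes f: "bounded_borel f" and x: "x \<in> H"
  shows "(x, Phi f x) \<in> SI f"
  using assms by (auto simp: SI_iff spectral_dom_def inner_Phi)

text \<open>If an interval below c carried mass, the projection z of x onto it would satisfy <T z,
  z> <= (c - 1/(n+1)) <z, z>, against the assumed bound. The lower end -n keeps z in the
  domain.\<close>

lemma SI_id_lower_bound:
  assumes low: "\<And>x y. (x, y) \<in> SI (\<lambda>t. t) \<Longrightarrow> c * inner x x \<le> inner y x" and x: "x \<in> H"
  shows "AE t in m x. c \<le> t"
proof -
  have null: "measure (m x) {- real n..c - 1 / real (Suc n)} = 0" for n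
  proof -
    let ?A = "{- real n..c - 1 / real (Suc n)}"
    define z where "z = Phi (indicator ?A) x"
    have b: "bounded_borel (\<lambda>t. (indicator ?A t)\<^sup>2 * t\<^sup>2)"
    proof (rule bounded_borelI)
      fix t :: real
      have "\<bar>t\<bar> \<le> real n + \<bar>c\<bar> + 1" if "t \<in> ?A"
      proof -
        have "1 / real (Suc n) \<ge> 0" by simp
        moreover have "- real n \<le> t" "t \<le> c - 1 / real (Suc n)" using that by simp_all
        ultimately show ?thesis by linarith
      qed
      then have "t \<in> ?A \<Longrightarrow> \<bar>t\<bar>\<^sup>2 \<le> (real n + \<bar>c\<bar> + 1)\<^sup>2" by (intro power_mono) auto
      then show "\<bar>(indicator ?A t)\<^sup>2 * t\<^sup>2\<bar> \<le> (real n + \<bar>c\<bar> + 1)\<^sup>2"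
        by (cases "t \<in> ?A") auto
    qed auto
    have zH: "z \<in> H" using x by (simp add: z_def)
    have "z \<in> dom (\<lambda>t. t)"
      unfolding spectral_dom_def z_def
      using x b integrable_m_Phi[of "indicator ?A" x "\<lambda>t. t\<^sup>2"] by simp
    then have zL: "z \<in> L1 (\<lambda>t. t)" and zd: "z \<in> dom (\<lambda>t. t)" using dom_subset_L1[of "\<lambda>t. t"] by auto
    obtain y where y: "(z, y) \<in> SI (\<lambda>t. t)" using SI_exists[OF _ zd] by auto
    have int: "integrable (m x) (\<lambda>t. (indicator ?A t)\<^sup>2 * t)"
    proof (rule iffD1[OF integrable_m_Phi])
      show "integrable (m (Phi (indicator ?A) x)) (\<lambda>t. t)"
        using zL unfolding L1_def z_def by blast
    qed (use x in auto)
    have "inner y z = bil (\<lambda>t. t) z z" using y zd by (simp add: SI_iff)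
    also have "\<dots> = Q (\<lambda>t. t) z" using zL by (simp add: bil_self)
    also have "\<dots> = (\<integral>t. (indicator ?A t)\<^sup>2 * t \<partial>m x)"
    proof -
      have "m z = density (m x) (\<lambda>u. ennreal ((indicator ?A u)\<^sup>2))"
        unfolding z_def by (rule m_Phi) (use x in auto)
      then show ?thesis unfolding Q_def by (simp only:) (subst integral_density, auto)
    qed
    also have "\<dots> \<le> (\<integral>t. (c - 1 / real (Suc n)) * indicator ?A t \<partial>m x)"
    proof (rule integral_mono[OF int])
      show "integrable (m x) (\<lambda>t. (c - 1 / real (Suc n)) * indicator ?A t)" using x by simp
    qed (auto simp: indicator_def)
    also have "\<dots> = (c - 1 / real (Suc n)) * measure (m x) ?A" by simp
    finally have 1: "inner y z \<le> (c - 1 / real (Suc n)) * measure (m x) ?A" .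
    have zz: "inner z z = measure (m x) ?A"
    proof -
      have "inner z z = (\<integral>t. (indicator ?A t)\<^sup>2 \<partial>m x)"
        using x by (simp add: z_def norm_Phi Q_def)
      also have "(\<lambda>t. (indicator ?A t)\<^sup>2 :: real) = indicator ?A" by (auto simp: indicator_def)
      finally show ?thesis by simp
    qed
    have "c * measure (m x) ?A \<le> (c - 1 / real (Suc n)) * measure (m x) ?A"
      using low[OF y] 1 zz by simp
    then have "measure (m x) ?A / real (Suc n) \<le> 0" by (simp add: algebra_simps)
    then have "measure (m x) ?A \<le> 0" by (simp add: divide_le_0_iff)
    then show ?thesis using measure_nonneg[of "m x" ?A] by linarith
  qed
  have "AE t in m x. \<forall>n. t \<notin> {- real n..c - 1 / real (Suc n)}"
    unfolding AE_all_countable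
  proof
    fix n
    show "AE t in m x. t \<notin> {- real n..c - 1 / real (Suc n)}"
      by (rule AE_not_in) (use null[of n] x in \<open>auto simp: null_sets_def emeasure_m\<close>)
  qed
  then show ?thesis
  proof eventually_elim
    case (elim t)
    show ?case
    proof (rule ccontr)
      assume "\<not> c \<le> t"
      then obtain k where k: "1 / real (Suc k) < c - t" using nat_approx_posE[of "c - t"] by auto
      obtain l :: nat where l: "- t \<le> real l" using real_arch_simple by blast
      let ?n = "max k l"
      have "1 / real (Suc ?n) \<le> 1 / real (Suc k)" by (auto simp: field_simps)
      then have "t \<in> {- real ?n..c - 1 / real (Suc ?n)}" using k l by auto
      then show False using elim by blast
    qed
  qed
qed

end

section \<open>The spectral theorem for positive self-adjoint operators\<close>

context hilbert
begin

lemma norm_proj_diff: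
  assumes "closed_sub M" "closed_sub N" "M \<subseteq> N" "x \<in> H"
  shows "inner (proj N x - proj M x) (proj N x - proj M x)
    = inner (proj N x) (proj N x) - inner (proj M x) (proj M x)"
proof -
  have "inner (proj N x) (proj M x) = inner (proj M x) (proj M x)"
    using assms inner_proj[of M "proj N x" "proj M x"] inner_proj[of N x "proj M x"]
      inner_proj[of M x "proj M x"] proj_in[of M x] by (auto simp: subset_iff)
  then show ?thesis by (simp add: inner_diff_left inner_diff_right inner_commute)
qed

text \<open>Meant for monotone families of projections, where squared increments are differences of
  squared norms.\<close>

lemma Cauchy_of_norm_increments:
  fixes f :: "nat \<Rightarrow> 'h"
  assumes a: "convergent a" and f: "\<And>k n. n \<le> k \<Longrightarrow> inner (f k - f n) (f k - f n) \<le> \<bar>a k - a n :: real\<bar>"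
  shows "Cauchy f"
proof (rule Cauchy_inner)
  fix e :: real assume "e > 0"
  with a have "\<exists>N. \<forall>k\<ge>N. \<forall>n\<ge>N. dist (a k) (a n) < e"
    by (metis convergent_Cauchy metric_CauchyD)
  then obtain N where N: "\<And>k n. k \<ge> N \<Longrightarrow> n \<ge> N \<Longrightarrow> \<bar>a k - a n\<bar> < e" by (auto simp: dist_real_def)
  have "inner (f k - f n) (f k - f n) < e" if "k \<ge> N" "n \<ge> N" for k n
  proof (cases "n \<le> k")
    case True then show ?thesis using f[OF True] N[OF that] by linarith
  next
    case False
    have "inner (f k - f n) (f k - f n) = inner (f n - f k) (f n - f k)"
      by (simp add: inner_diff_left inner_diff_right inner_commute)
    then show ?thesis using f[of k n] N[OF that(2,1)] False by linarith
  qed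
  then show "\<exists>N. \<forall>k\<ge>N. \<forall>n\<ge>N. inner (f k - f n) (f k - f n) < e" by blast
qed

end

text \<open>\<open>T\<close> is a linear relation. Surjectivity of I + T is the maximality that
  turns symmetry into self-adjointness, and \<open>T_single\<close> makes the relation an
  operator.\<close>

locale positive_selfadjoint = hilbert H for H :: "'h::real_inner set" +
  fixes T :: "('h \<times> 'h) set"
  assumes T_H: "(x, y) \<in> T \<Longrightarrow> x \<in> H" "(x, y) \<in> T \<Longrightarrow> y \<in> H"
    and T_add: "(x, y) \<in> T \<Longrightarrow> (x', y') \<in> T \<Longrightarrow> (x + x', y + y') \<in> T"
    and T_scale: "(x, y) \<in> T \<Longrightarrow> (c *\<^sub>R x, c *\<^sub>R y) \<in> T"
    and T_sym: "(x, y) \<in> T \<Longrightarrow> (x', y') \<in> T \<Longrightarrow> inner y x' = inner x y'"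
    and T_pos: "(x, y) \<in> T \<Longrightarrow> 0 \<le> inner y x"
    and T_range: "f \<in> H \<Longrightarrow> \<exists>x y. (x, y) \<in> T \<and> x + y = f"
    and T_single: "(0, y) \<in> T \<Longrightarrow> y = 0"
begin

lemma T_diff: "(x, y) \<in> T \<Longrightarrow> (x', y') \<in> T \<Longrightarrow> (x - x', y - y') \<in> T"
  using T_add[of x y "- x'" "- y'"] T_scale[of x' y' "-1"] by simp

section \<open>Resolvent and bounded transform\<close>

definition R :: "'h \<Rightarrow> 'h" where "R f = (THE x. (x, f - x) \<in> T)"

lemma R_eq:
  assumes "(x, f - x) \<in> T" shows "R f = x"
  unfolding R_def
proof (rule the_equality)
  fix x' assume "(x', f - x') \<in> T"
  from T_pos[OF T_diff[OF this assms]] have "0 \<le> inner (x - x') (x' - x)" by simp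
  then have "inner (x - x') (x - x') \<le> 0" by (simp add: inner_diff_right inner_diff_left)
  then show "x' = x" using inner_ge_zero[of "x - x'"] by (simp add: order_antisym)
qed (rule assms)

lemma R_T: "f \<in> H \<Longrightarrow> (R f, f - R f) \<in> T"
proof -
  assume "f \<in> H"
  then obtain x y where "(x, y) \<in> T" "x + y = f" using T_range by blast
  then have "(x, f - x) \<in> T" by auto
  then show ?thesis using R_eq by simp
qed

lemma R_in [simp]: "f \<in> H \<Longrightarrow> R f \<in> H"
  using R_T T_H by blast

lemma R_add: "f \<in> H \<Longrightarrow> g \<in> H \<Longrightarrow> R (f + g) = R f + R g"
  using T_add[OF R_T R_T, of f g] by (intro R_eq) (simp add: algebra_simps)

lemma R_scale: "f \<in> H \<Longrightarrow> R (c *\<^sub>R f) = c *\<^sub>R R f"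
  using T_scale[OF R_T, of f c] by (intro R_eq) (simp add: algebra_simps)

lemma R_sym: "f \<in> H \<Longrightarrow> g \<in> H \<Longrightarrow> inner (R f) g = inner f (R g)"
  using T_sym[OF R_T R_T, of f g] by (simp add: inner_diff_left inner_diff_right)

lemma R_pos: "f \<in> H \<Longrightarrow> inner (R f) (R f) \<le> inner (R f) f"
  using T_pos[OF R_T, of f] by (simp add: inner_diff_left inner_commute[of f])

lemma R_zero: "f \<in> H \<Longrightarrow> R f = 0 \<Longrightarrow> f = 0"
  using R_T[of f] T_single by simp

text \<open>I - R equals T (I + T)^-1 because the pair (R f, f - R f) lies in \<open>T\<close>;
  written this way no domain enters.\<close>

definition S :: "'h \<Rightarrow> 'h" where "S f = f - R f"

lemma R_le: "f \<in> H \<Longrightarrow> inner (R f) f \<le> inner f f"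
proof -
  assume f: "f \<in> H"
  have "inner (f - R f) (f - R f) = inner f f - 2 * inner (R f) f + inner (R f) (R f)"
    by (simp add: inner_diff_left inner_diff_right inner_commute)
  then show ?thesis using R_pos[OF f] inner_ge_zero[of "f - R f"] by linarith
qed

sublocale S: pos_op H S 1
proof
  show "0 \<le> inner (S x) x" if "x \<in> H" for x
    using R_le[OF that] by (simp add: S_def inner_diff_left)
  show "inner (S x) x \<le> 1 * inner x x" if "x \<in> H" for x
    using R_pos[OF that] inner_ge_zero[of "R x"] unfolding S_def inner_diff_left by linarith
  show "inner (S x) y = inner x (S y)" if "x \<in> H" "y \<in> H" for x y
    using R_sym[OF that] by (simp add: S_def inner_diff_left inner_diff_right)
qed (auto simp: S_def R_add R_scale algebra_simps)

text \<open>Translates levels of \<open>T\<close> into levels of \<open>S\<close>. The value 0 on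
  the negative half-line keeps the function bounded and monotone.\<close>

definition kap :: "real \<Rightarrow> real" where "kap t = (if t < 0 then 0 else t / (1 + t))"

lemma kap_nonneg [simp]: "0 \<le> kap t" and kap_le_one: "kap t \<le> 1"
  by (auto simp: kap_def)

lemma kap_mono: "s \<le> t \<Longrightarrow> kap s \<le> kap t"
proof (cases "s < 0")
  case False
  assume "s \<le> t"
  with False have "kap t - kap s = (t - s) / ((1 + t) * (1 + s))"
    by (simp add: kap_def field_simps)
  also have "\<dots> \<ge> 0" using False \<open>s \<le> t\<close> by simp
  finally show ?thesis by simp
qed (simp add: kap_def)

lemma kap_lipschitz: "0 \<le> s \<Longrightarrow> s \<le> t \<Longrightarrow> kap t - kap s \<le> t - s"
proof -
  assume st: "0 \<le> s" "s \<le> t"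
  have "kap t - kap s = (t - s) / ((1 + t) * (1 + s))"
    using st by (simp add: kap_def field_simps)
  also have "\<dots> \<le> (t - s) / 1"
  proof (rule divide_left_mono)
    have "1 * 1 \<le> (1 + t) * (1 + s)" using st by (intro mult_mono) auto
    then show "1 \<le> (1 + t) * (1 + s)" by simp
  qed (use st in auto)
  finally show ?thesis by simp
qed

lemma bounded_borel_kap [simp]: "bounded_borel kap"
proof (rule bounded_borelI)
  show "kap \<in> borel_measurable borel" unfolding kap_def[abs_def] by measurable
  show "\<bar>kap t\<bar> \<le> 1" for t using kap_le_one[of t] kap_nonneg[of t] by linarith
qed

section \<open>The spectral family of T\<close>

definition G :: "real \<Rightarrow> 'h set" where "G t = S.growth (kap t)"

lemma closed_sub_G [simp]: "closed_sub (G t)"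
  unfolding G_def by (rule S.closed_sub_growth) simp

lemma G_mono: "s \<le> t \<Longrightarrow> G s \<subseteq> G t"
  unfolding G_def by (intro S.growth_mono kap_mono) auto

text \<open>For t < 0 the set \<open>G t\<close> is still the kernel of \<open>S\<close>, so the
  projection has to be switched off there to obtain the limit 0 at minus infinity.\<close>

definition E :: "real \<Rightarrow> 'h \<Rightarrow> 'h" where "E t x = (if t < 0 then 0 else proj (G t) x)"

lemma E_mem: "x \<in> H \<Longrightarrow> E t x \<in> G t"
  using proj_in closed_sub_G by (auto simp: E_def closed_sub_def subspace_0)

lemma E_mem_H: "x \<in> H \<Longrightarrow> E t x \<in> H"
  using E_mem closed_subD closed_sub_G by blast

lemma E_increment:
  assumes "s \<le> t" "x \<in> H"
  shows "inner (E t x - E s x) (E t x - E s x) = inner (E t x) (E t x) - inner (E s x) (E s x)"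
  using assms norm_proj_diff[OF closed_sub_G closed_sub_G G_mono, of s t x] by (simp add: E_def)

lemma E_norm_le: "x \<in> H \<Longrightarrow> inner (E t x) (E t x) \<le> inner x x"
  using norm_proj_le[OF closed_sub_G, of x t] by (simp add: E_def norm_le)

lemma E_norm_mono: "s \<le> t \<Longrightarrow> x \<in> H \<Longrightarrow> inner (E s x) (E s x) \<le> inner (E t x) (E t x)"
  using E_increment[of s t x] inner_ge_zero[of "E t x - E s x"] by linarith

text \<open>Monotonicity makes the projections Cauchy. Their limit z lies in every
  \<open>G (s n)\<close>, and the moment inequalities with constant <z, z> pass to the level t
  itself, so z is the projection onto \<open>G t\<close>.\<close>

lemma E_right_limit:
  assumes x: "x \<in> H" and t: "0 \<le> t"
    and s: "\<And>n. t < s n" "decseq s" "s \<longlonglongrightarrow> t"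
  shows "(\<lambda>n. E (s n) x) \<longlonglongrightarrow> E t x"
proof -
  let ?y = "\<lambda>n. E (s n) x"
  have dec: "s k \<le> s n" if "n \<le> k" for k n using s(2) that by (simp add: decseq_def)
  have "Cauchy ?y"
  proof (rule Cauchy_of_norm_increments)
    have "decseq (\<lambda>n. inner (?y n) (?y n))" unfolding decseq_def using E_norm_mono dec x by blast
    from decseq_convergent[OF this, of 0]
    show "convergent (\<lambda>n. inner (?y n) (?y n))" unfolding convergent_def by (metis inner_ge_zero)
    show "inner (?y k - ?y n) (?y k - ?y n) \<le> \<bar>inner (?y k) (?y k) - inner (?y n) (?y n)\<bar>" if "n \<le> k" for k n
      using E_increment[OF dec[OF that] x] norm_minus_commute[of "?y k" "?y n"]
      by (simp add: power2_norm_eq_inner[symmetric])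
  qed
  then obtain z where z: "z \<in> H" "?y \<longlonglongrightarrow> z"
    using H_Cauchy[of ?y] E_mem_H[OF x] by metis
  have zG: "z \<in> G (s n)" for n
  proof (rule closed_sequentially)
    show "closed (G (s n))" using closed_sub_G by (auto simp: closed_sub_def)
    show "(\<lambda>k. ?y (k + n)) \<longlonglongrightarrow> z" by (rule LIMSEQ_ignore_initial_segment[OF z(2)])
    have "G (s (k + n)) \<subseteq> G (s n)" for k by (intro G_mono dec) simp
    then show "?y (k + n) \<in> G (s n)" for k using E_mem[OF x, of "s (k + n)"] by blast
  qed
  have kap_lim: "(\<lambda>n. kap (s n)) \<longlonglongrightarrow> kap t"
  proof -
    have "(\<lambda>n. s n / (1 + s n)) \<longlonglongrightarrow> t / (1 + t)" using t by (intro tendsto_intros s) auto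
    moreover have "kap (s n) = s n / (1 + s n)" for n using s(1)[of n] t by (auto simp: kap_def)
    ultimately show ?thesis using t by (simp add: kap_def)
  qed
  have "inner ((S ^^ j) z) z \<le> kap t ^ j * inner z z" for j
  proof (rule LIMSEQ_le_const)
    show "(\<lambda>n. kap (s n) ^ j * inner z z) \<longlonglongrightarrow> kap t ^ j * inner z z"
      by (intro tendsto_intros kap_lim)
    show "\<exists>N. \<forall>n\<ge>N. inner ((S ^^ j) z) z \<le> kap (s n) ^ j * inner z z"
      using zG unfolding G_def S.growth_alt[OF kap_nonneg] by blast
  qed
  then have "z \<in> G t" using z unfolding G_def S.growth_alt[OF kap_nonneg] by blast
  moreover have "inner z v = inner x v" if v: "v \<in> G t" for v
  proof (rule LIMSEQ_unique)
    show "(\<lambda>n. inner (?y n) v) \<longlonglongrightarrow> inner z v" by (intro tendsto_intros z)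
    have "inner (?y n) v = inner x v" for n
    proof -
      have "v \<in> G (s n)" using v G_mono[of t "s n"] s(1)[of n] by auto
      then show ?thesis using inner_proj[OF closed_sub_G x] s(1)[of n] t by (simp add: E_def)
    qed
    then show "(\<lambda>n. inner (?y n) v) \<longlonglongrightarrow> inner x v" by simp
  qed
  ultimately have "E t x = z" using t x by (simp add: E_def proj_unique)
  then show ?thesis using z by simp
qed

text \<open>The defect w is orthogonal to every \<open>G n\<close>, so <S w, w> dominates kap n <w,
  w> for all n and, in the limit, <w, w>. Hence <R w, w> <= 0, which gives R w = 0, and the
  resolvent is injective.\<close>

lemma E_top_limit:
  assumes x: "x \<in> H"
  shows "(\<lambda>n. E (real n) x) \<longlonglongrightarrow> x"
proof -
  let ?y = "\<lambda>n::nat. E (real n) x"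
  have "Cauchy ?y"
  proof (rule Cauchy_of_norm_increments)
    have "incseq (\<lambda>n. inner (?y n) (?y n))" unfolding incseq_def using E_norm_mono x by simp
    from incseq_convergent[OF this, of "inner x x"]
    show "convergent (\<lambda>n. inner (?y n) (?y n))" unfolding convergent_def by (metis E_norm_le[OF x])
    show "inner (?y k - ?y n) (?y k - ?y n) \<le> \<bar>inner (?y k) (?y k) - inner (?y n) (?y n)\<bar>" if "n \<le> k" for k n
      using E_increment[of "real n" "real k", OF _ x] that by simp
  qed
  then obtain z where z: "z \<in> H" "?y \<longlonglongrightarrow> z"
    using H_Cauchy[of ?y] E_mem_H[OF x] by metis
  define w where "w = x - z"
  have w: "w \<in> H" using x z by (simp add: w_def)
  have orth: "inner w v = 0" if v: "v \<in> G (real n)" for n v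
  proof -
    have "(\<lambda>k. inner (?y (k + n)) v) \<longlonglongrightarrow> inner z v"
      by (intro tendsto_intros LIMSEQ_ignore_initial_segment z)
    moreover have "inner (?y (k + n)) v = inner x v" for k
      using inner_proj[OF closed_sub_G x, of v "real (k + n)"] v G_mono[of "real n" "real (k + n)"]
      by (auto simp: E_def)
    ultimately show ?thesis by (simp add: w_def inner_diff_left LIMSEQ_const_iff)
  qed
  have "inner w w \<le> inner (S w) w"
  proof (rule LIMSEQ_le_const2)
    have "(\<lambda>n. (1 - 1 / real (Suc n)) * inner w w) \<longlonglongrightarrow> (1 - 0) * inner w w"
      by (intro tendsto_intros LIMSEQ_Suc lim_1_over_n)
    then show "(\<lambda>n. (1 - 1 / real (Suc n)) * inner w w) \<longlonglongrightarrow> inner w w" by simp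
    have "(1 - 1 / real (Suc n)) * inner w w \<le> inner (S w) w" for n
    proof -
      have "kap (real n) = 1 - 1 / real (Suc n)" by (simp add: kap_def field_simps)
      then show ?thesis
        using S.growth_lower[OF kap_nonneg w, of "real n"] orth[of _ n] by (simp add: G_def)
    qed
    then show "\<exists>N. \<forall>n\<ge>N. (1 - 1 / real (Suc n)) * inner w w \<le> inner (S w) w" by blast
  qed
  then have "inner (R w) (R w) \<le> 0" using R_pos[OF w] by (simp add: S_def inner_diff_left)
  then have "R w = 0" by (metis inner_eq_zero_iff inner_ge_zero order_antisym)
  then have "w = 0" using R_zero w by blast
  then show ?thesis using z by (simp add: w_def)
qed

lemma spectral_family_E: "spectral_family H E"
  unfolding spectral_family_def
proof (intro conjI allI ballI)
  fix t
  show "bounded_linear_between H norm H norm (E t)"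
    unfolding bounded_linear_between_def
  proof (intro conjI ballI allI)
    show "E t ` H \<subseteq> H" using E_mem_H by auto
    show "E t (x + y) = E t x + E t y" if "x \<in> H" "y \<in> H" for x y
      using that by (simp add: E_def proj_add)
    show "E t (c *\<^sub>R x) = c *\<^sub>R E t x" if "x \<in> H" for c x
      using that by (simp add: E_def proj_scale)
    show "\<exists>C. \<forall>x\<in>H. norm (E t x) \<le> C * norm x"
      using norm_proj_le[OF closed_sub_G] by (intro exI[of _ 1]) (auto simp: E_def)
  qed
  show "inner (E t x) y = inner x (E t y)" if "x \<in> H" "y \<in> H" for x y
    using that by (simp add: E_def proj_sym)
  show "E t (E t' x) = E (min t t') x" if x: "x \<in> H" for t' x
  proof (cases "t < 0 \<or> t' < 0")
    case True
    then show ?thesis using proj_scale[OF closed_sub_G H_zero, of t 0] by (auto simp: E_def)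
  next
    case False
    then show ?thesis
      using proj_nested[OF closed_sub_G closed_sub_G G_mono, of t t' x]
        proj_nested[OF closed_sub_G closed_sub_G G_mono, of t' t x] x
      by (cases "t \<le> t'") (auto simp: E_def min_def)
  qed
  show "((\<lambda>t'. E t' x) \<longlongrightarrow> E t x) (at_right t)" if x: "x \<in> H" for x
  proof (cases "t < 0")
    case True
    have "\<forall>\<^sub>F t' in at_right t. E t' x = E t x"
      using eventually_at_right[of t 0] True by (auto simp: E_def intro!: exI[of _ 0])
    then show ?thesis by (rule tendsto_eventually)
  next
    case False
    show ?thesis
      by (rule tendsto_at_right_sequentially[of t "t + 1"])
        (use False in \<open>auto intro!: E_right_limit x\<close>)
  qed
  show "((\<lambda>t. E t x) \<longlongrightarrow> 0) at_bot" if x: "x \<in> H" for x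
  proof (rule tendsto_eventually)
    show "\<forall>\<^sub>F t in at_bot. E t x = 0"
      unfolding eventually_at_bot_linorder by (intro exI[of _ "-1"]) (auto simp: E_def)
  qed
  show "((\<lambda>t. E t x) \<longlongrightarrow> x) at_top" if x: "x \<in> H" for x
  proof (rule tendstoI)
    fix e :: real assume e: "e > 0"
    have "\<forall>\<^sub>F n in sequentially. dist (E (real n) x) x < e"
      using tendstoD[OF E_top_limit[OF x] e] .
    then obtain n where n: "dist (E (real n) x) x < e" unfolding eventually_sequentially by blast
    show "\<forall>\<^sub>F t in at_top. dist (E t x) x < e"
      unfolding eventually_at_top_linorder
    proof (intro exI allI impI)
      fix t assume t: "real n \<le> t"
      \<comment> \<open>The distance from \<open>E t x\<close> to x is nonincreasing in t, so
        convergence along the integers is enough.\<close>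
      have id: "inner (x - E r x) (x - E r x) = inner x x - inner (E r x) (E r x)" if "0 \<le> r" for r
      proof -
        have "inner (E r x) x = inner (E r x) (E r x)"
          using inner_proj_self[OF closed_sub_G x, of r] that by (simp add: E_def power2_norm_eq_inner)
        then show ?thesis by (simp add: inner_diff_left inner_diff_right inner_commute)
      qed
      have "inner (x - E t x) (x - E t x) \<le> inner (x - E (real n) x) (x - E (real n) x)"
        using id[of t] id[of "real n"] E_norm_mono[OF t x] t by simp
      then have "norm (x - E t x) \<le> norm (x - E (real n) x)" by (simp add: norm_le)
      then show "dist (E t x) x < e" using n by (simp add: dist_norm norm_minus_commute)
    qed
  qed
qed

sublocale E: spectral H E
  by unfold_locales (rule spectral_family_E)

lemma AE_nonneg:
  assumes x: "x \<in> H" shows "AE t in E.m x. 0 \<le> t"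
proof -
  have "AE t in E.m x. \<forall>n. t \<notin> {..- 1 / real (Suc n)}"
    unfolding AE_all_countable
  proof
    fix n
    have "measure (E.m x) {..- 1 / real (Suc n)} = 0"
      using x by (simp add: E.measure_m_atMost E_def divide_less_0_iff)
    then show "AE t in E.m x. t \<notin> {..- 1 / real (Suc n)}"
      by (intro AE_not_in) (use x in \<open>auto simp: null_sets_def E.emeasure_m\<close>)
  qed
  then show ?thesis
  proof eventually_elim
    case (elim t)
    show ?case
    proof (rule ccontr)
      assume "\<not> 0 \<le> t"
      then obtain k where k: "1 / real (Suc k) < - t" using nat_approx_posE[of "- t"] by auto
      then have "t \<le> - 1 / real (Suc k)" by (simp add: minus_divide_left[symmetric])
      then show False using elim by auto
    qed
  qed
qed

section \<open>Comparison of the bounded transform with its spectral integral\<close>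

abbreviation K :: "'h \<Rightarrow> 'h" where "K \<equiv> E.Phi kap"

sublocale K: pos_op H K 1
proof
  show "0 \<le> inner (K x) x" if "x \<in> H" for x
    using that by (simp add: E.inner_Phi_self E.Q_def integral_nonneg_AE)
  show "inner (K x) x \<le> 1 * inner x x" if "x \<in> H" for x
    using E.Q_bound[of x kap 1] that bounded_borel_kap kap_le_one
    by (simp add: E.inner_Phi_self bounded_borel_def)
  show "inner (K x) y = inner x (K y)" if "x \<in> H" "y \<in> H" for x y
    using that by (simp add: E.Phi_sym)
qed (auto simp: E.Phi_add E.Phi_scale)

text \<open>To be shown zero: \<open>S\<close> comes from the resolvent, while \<open>K\<close>
  integrates \<open>kap\<close> against the family built from \<open>S\<close>.\<close>

definition D :: "'h \<Rightarrow> 'h" where "D x = S x - K x"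

lemma D_add: "x \<in> H \<Longrightarrow> y \<in> H \<Longrightarrow> D (x + y) = D x + D y"
  by (simp add: D_def S.S_add K.S_add)

lemma D_sym: "x \<in> H \<Longrightarrow> y \<in> H \<Longrightarrow> inner (D x) y = inner x (D y)"
  by (simp add: D_def inner_diff_left inner_diff_right S.S_sym K.S_sym)

text \<open>On the block between a and b the forms of \<open>S\<close> and \<open>K\<close> both lie
  between kap a and kap b, for \<open>S\<close> by the growth bounds and for \<open>K\<close> by
  integration. The Lipschitz bound of \<open>kap\<close> turns this into the length b - a.\<close>

lemma D_block:
  assumes x: "x \<in> H" and ab: "0 \<le> a" "a \<le> b"
  shows "\<bar>inner (D (E b x - E a x)) (E b x - E a x)\<bar> \<le> (b - a) * inner (E b x - E a x) (E b x - E a x)"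
proof -
  define p where "p = E b x - E a x"
  have p: "p \<in> H" using x by (simp add: p_def)
  let ?i = "\<lambda>u. indicator {..b} u - indicator {..a} u :: real"
  have pi: "p = E.Phi ?i x"
    unfolding p_def using x by (simp add: E.Phi_fun_diff E.Phi_indicator_atMost)
  have bi: "bounded_borel ?i" by simp
  have pp: "inner p p = (\<integral>u. (?i u)\<^sup>2 \<partial>E.m x)"
    unfolding pi using E.norm_Phi[OF bi x] by (simp add: E.Q_def)
  have Kp: "inner (K p) p = (\<integral>u. kap u * (?i u)\<^sup>2 \<partial>E.m x)"
    using E.inner_Phi_self[OF bounded_borel_kap p] E.Q_Phi[OF bi bounded_borel_kap x]
    unfolding pi by (simp add: E.Q_def)
  have int: "integrable (E.m x) (\<lambda>u. c * (?i u)\<^sup>2)" "integrable (E.m x) (\<lambda>u. kap u * (?i u)\<^sup>2)" for c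
    using x by (auto intro!: E.integrable_m_bounded bounded_borel_mult bounded_borel_power2)
  have "inner (K p) p \<le> (\<integral>u. kap b * (?i u)\<^sup>2 \<partial>E.m x)"
    unfolding Kp by (intro integral_mono int) (use ab kap_mono[of _ b] in \<open>auto simp: indicator_def\<close>)
  then have K1: "inner (K p) p \<le> kap b * inner p p" by (simp add: pp)
  have "(\<integral>u. kap a * (?i u)\<^sup>2 \<partial>E.m x) \<le> inner (K p) p"
    unfolding Kp by (intro integral_mono int) (use ab kap_mono[of a] in \<open>auto simp: indicator_def\<close>)
  then have K2: "kap a * inner p p \<le> inner (K p) p" by (simp add: pp)
  have "p \<in> G b"
    using E_mem[OF x, of b] E_mem[OF x, of a] G_mono[OF ab(2)] closed_sub_G[of b]
    by (auto simp: p_def closed_sub_def intro!: subspace_diff)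
  then have S1: "inner (S p) p \<le> kap b * inner p p"
    unfolding G_def by (intro S.growth_upper) auto
  have "inner p v = 0" if "v \<in> G a" for v
    using inner_proj[OF closed_sub_G x, of v a] inner_proj[OF closed_sub_G x, of v b]
      G_mono[OF ab(2)] that ab by (auto simp: p_def E_def inner_diff_left)
  then have S2: "kap a * inner p p \<le> inner (S p) p"
    unfolding G_def by (intro S.growth_lower p) auto
  have "(kap b - kap a) * inner p p \<le> (b - a) * inner p p"
    using kap_lipschitz[OF ab] by (intro mult_right_mono) auto
  then show ?thesis
    using K1 K2 S1 S2 unfolding p_def[symmetric] D_def inner_diff_left by (simp add: algebra_simps)
qed

text \<open>\<open>S\<close> preserves \<open>G a\<close> and \<open>K\<close> commutes with
  \<open>E a\<close>, so \<open>D\<close> sends \<open>E a x\<close> into \<open>G a\<close>, to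
  which the block is orthogonal. The form of \<open>D\<close> is therefore additive over
  blocks.\<close>

lemma D_cross:
  assumes x: "x \<in> H" and ab: "0 \<le> a" "a \<le> b"
  shows "inner (D (E b x - E a x)) (E a x) = 0"
proof -
  define p where "p = E b x - E a x"
  have p: "p \<in> H" using x by (simp add: p_def)
  have orth: "inner p v = 0" if "v \<in> G a" for v
    using inner_proj[OF closed_sub_G x, of v a] inner_proj[OF closed_sub_G x, of v b]
      G_mono[OF ab(2)] that ab by (auto simp: p_def E_def inner_diff_left)
  have "inner (S p) (E a x) = inner p (S (E a x))" using p x by (simp add: S.S_sym)
  also have "\<dots> = 0" using orth S.growth_invariant E_mem[OF x] by (simp add: G_def)
  finally have 1: "inner (S p) (E a x) = 0" .
  have "K (E a x) = E a (K x)"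
    using x E.Phi_mult[of "indicator {..a}" kap x] E.Phi_mult[of kap "indicator {..a}" x]
    by (simp add: E.Phi_indicator_atMost mult.commute)
  then have "inner (K p) (E a x) = inner p (E a (K x))" using p x by (simp add: K.S_sym)
  also have "\<dots> = 0" using orth E_mem x by simp
  finally show ?thesis using 1 by (simp add: D_def p_def[symmetric] inner_diff_left)
qed

lemma D_step:
  assumes x: "x \<in> H" and ab: "0 \<le> a" "a \<le> b"
  shows "inner (D (E b x)) (E b x)
    = inner (D (E a x)) (E a x) + inner (D (E b x - E a x)) (E b x - E a x)"
proof -
  define p where "p = E b x - E a x"
  have H: "p \<in> H" "E a x \<in> H" using x by (auto simp: p_def)
  have "inner (D p) (E a x) = 0" using D_cross[OF assms] by (simp add: p_def)
  moreover have "inner (D (E a x)) p = 0"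
    using calculation D_sym[OF H(2,1)] by (simp add: inner_commute)
  moreover have "E b x = p + E a x" by (simp add: p_def)
  ultimately show ?thesis
    unfolding p_def[symmetric] by (simp add: D_add H inner_add_left inner_add_right)
qed

text \<open>The part at level 0 belongs to no block; \<open>S\<close> vanishes on it, and so does
  \<open>kap\<close>.\<close>

lemma D_zero_start: "x \<in> H \<Longrightarrow> inner (D (E 0 x)) (E 0 x) = 0"
proof -
  assume x: "x \<in> H"
  have "inner (S (E 0 x)) (E 0 x) \<le> kap 0 * inner (E 0 x) (E 0 x)"
    using E_mem[OF x, of 0] unfolding G_def by (intro S.growth_upper) auto
  then have "inner (S (E 0 x)) (E 0 x) = 0"
    using S.S_pos[of "E 0 x"] x by (simp add: kap_def)
  moreover have "inner (K (E 0 x)) (E 0 x) = 0"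
  proof -
    have "inner (K (E 0 x)) (E 0 x) = E.Q (\<lambda>u. kap u * (indicator {..0} u)\<^sup>2) x"
      using E.inner_Phi_self[of kap "E 0 x"] E.Q_Phi[of "indicator {..0}" kap x] x
      by (simp add: E.Phi_indicator_atMost)
    also have "(\<lambda>u. kap u * (indicator {..0} u)\<^sup>2) = (\<lambda>u. 0)"
      by (auto simp: kap_def indicator_def)
    finally show ?thesis by (simp add: E.Q_def)
  qed
  ultimately show ?thesis by (simp add: D_def inner_diff_left)
qed

text \<open>Adding up blocks of length h costs h times the total squared norm, because the squared
  increments telescope.\<close>

lemma D_partition:
  assumes x: "x \<in> H" and h: "0 \<le> h"
  shows "\<bar>inner (D (E (real n * h) x)) (E (real n * h) x)\<bar> \<le> h * inner (E (real n * h) x) (E (real n * h) x)"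
proof (induction n)
  case 0
  then show ?case using D_zero_start[OF x] h by simp
next
  case (Suc n)
  have ab: "0 \<le> real n * h" "real n * h \<le> real (Suc n) * h" using h by (auto intro: mult_right_mono)
  have "h = real (Suc n) * h - real n * h" by (simp add: algebra_simps)
  then show ?case
    using Suc D_step[OF x ab] D_block[OF x ab] E_increment[OF ab(2) x]
    by (smt (verit, best) distrib_left)
qed

text \<open>A partition of [0, k] with mesh k/(n+1) removes the error as n grows; afterwards k tends
  to infinity.\<close>

lemma D_zero: "x \<in> H \<Longrightarrow> inner (D x) x = 0"
proof -
  assume x: "x \<in> H"
  have zero: "inner (D (E (real k) x)) (E (real k) x) = 0" for k
  proof -
    have "\<bar>inner (D (E (real k) x)) (E (real k) x)\<bar> \<le> (real k * inner x x) * (1 / real (Suc n))" for n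
    proof -
      define h where "h = real k / real (Suc n)"
      have h: "0 \<le> h" "real (Suc n) * h = real k" by (auto simp: h_def)
      have "\<bar>inner (D (E (real k) x)) (E (real k) x)\<bar> \<le> h * inner (E (real k) x) (E (real k) x)"
        using D_partition[OF x h(1), of "Suc n"] unfolding h(2) .
      also have "\<dots> \<le> h * inner x x" using h E_norm_le[OF x] by (intro mult_left_mono) auto
      finally show ?thesis by (simp add: h_def)
    qed
    moreover have "(\<lambda>n. (real k * inner x x) * (1 / real (Suc n))) \<longlonglongrightarrow> (real k * inner x x) * 0"
      by (intro tendsto_intros LIMSEQ_Suc lim_1_over_n)
    ultimately have "\<bar>inner (D (E (real k) x)) (E (real k) x)\<bar> \<le> (real k * inner x x) * 0"
      by (intro LIMSEQ_le_const) auto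
    then show ?thesis by simp
  qed
  have "(\<lambda>k. inner (D (E (real k) x)) (E (real k) x)) \<longlonglongrightarrow> inner (D x) x"
    unfolding D_def
    by (intro tendsto_inner tendsto_diff S.S_tendsto K.S_tendsto E_top_limit x) (use x in auto)
  then show ?thesis by (simp add: zero LIMSEQ_const_iff)
qed

lemma S_eq_K: "x \<in> H \<Longrightarrow> S x = K x"
proof (rule eqI)
  fix v assume x: "x \<in> H" and v: "v \<in> H"
  have "inner (D (x + v)) (x + v) = 0" using D_zero x v by simp
  then have "inner (D x) v = 0"
    using D_zero[OF x] D_zero[OF v] D_sym[OF v x] x v
    by (simp add: D_add inner_add_left inner_add_right inner_commute)
  then show "inner (S x) v = inner (K x) v" by (simp add: D_def inner_diff_left)
qed auto

section \<open>Recovery of T from its resolvent\<close>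

definition rho :: "real \<Rightarrow> real" where "rho t = (if t < 0 then 0 else 1 / (1 + t))"

lemma bounded_borel_rho [simp]: "bounded_borel rho"
  by (rule bounded_borelI[of _ 1]) (auto simp: rho_def[abs_def])

lemma id_rho: "t * rho t = kap t" by (simp add: rho_def kap_def)

lemma Phi_rho: "x \<in> H \<Longrightarrow> E.Phi rho x = R x"
proof -
  assume x: "x \<in> H"
  have "E.Phi rho x = E.Phi (\<lambda>t. 1 - kap t) x"
  proof (rule E.Phi_cong_AE)
    show "AE t in E.m x. rho t = 1 - kap t"
      using AE_nonneg[OF x] by eventually_elim (auto simp: rho_def kap_def field_simps)
  qed (use x in auto)
  also have "\<dots> = x - K x" using x by (simp add: E.Phi_fun_diff E.Phi_one)
  also have "\<dots> = R x" using S_eq_K[OF x] by (simp add: S_def algebra_simps)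
  finally show ?thesis .
qed

lemma R_of_SI:
  assumes "(x, y) \<in> E.SI (\<lambda>t. t)" shows "R (x + y) = x" "x \<in> H" "y \<in> H"
proof -
  show H: "x \<in> H" "y \<in> H" using assms E.dom_H by (auto simp: E.SI_iff)
  have "E.Phi rho y = E.Phi kap x"
    using E.SI_Phi[OF _ assms bounded_borel_rho] by (simp add: id_rho)
  then have "R y = x - R x" using H S_eq_K[of x] by (simp add: Phi_rho S_def)
  then show "R (x + y) = x" using H by (simp add: R_add)
qed

text \<open>Both relations have the resolvent \<open>R\<close>. A pair of \<open>T\<close> has x = R
  (x + y), and boundedness of t \<open>rho\<close> t puts the range of \<open>R\<close> into the
  domain of the integral; injectivity of \<open>R\<close> then identifies the values.\<close>

theorem T_eq_SI: "T = E.SI (\<lambda>t. t)"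
proof (intro equalityI subrelI)
  fix x y assume "(x, y) \<in> E.SI (\<lambda>t. t)"
  from R_of_SI[OF this] R_T[of "x + y"] show "(x, y) \<in> T" by simp
next
  fix x y assume T: "(x, y) \<in> T"
  have H: "x \<in> H" "y \<in> H" using T T_H by auto
  have x: "x = E.Phi rho (x + y)" using T H Phi_rho R_eq[of x "x + y"] by simp
  have "bounded_borel (\<lambda>u. (rho u)\<^sup>2 * u\<^sup>2)"
    using bounded_borel_power2[OF bounded_borel_kap]
    by (simp add: id_rho[symmetric] power_mult_distrib mult.commute)
  then have "integrable (E.m (E.Phi rho (x + y))) (\<lambda>u. u\<^sup>2)"
    using H by (intro iffD2[OF E.integrable_m_Phi]) auto
  then have "x \<in> E.dom (\<lambda>t. t)" using H x by (simp add: spectral_dom_def)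
  then obtain y' where y': "(x, y') \<in> E.SI (\<lambda>t. t)" using E.SI_exists[of "\<lambda>t. t" x] by auto
  have "R (y - y') = R (x + y) - R (x + y')"
    using R_add[of "y - y'" "x + y'"] R_of_SI[OF y'] H by (simp add: algebra_simps)
  also have "\<dots> = 0" using R_of_SI[OF y'] R_eq[of x "x + y"] T by simp
  finally have "y - y' = 0" using R_zero[of "y - y'"] R_of_SI(3)[OF y'] H by simp
  then show "(x, y) \<in> E.SI (\<lambda>t. t)" using y' by simp
qed

corollary spectral_family_of:
  "spectral_family H (spectral_family_of H T)"
  "T = spectral_integral H (spectral_family_of H T) (\<lambda>t. t)"
proof -
  have "\<exists>E. spectral_family H E \<and> T = spectral_integral H E (\<lambda>t. t)"
    using spectral_family_E T_eq_SI by blast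
  from someI_ex[OF this]
  show "spectral_family H (spectral_family_of H T)"
    "T = spectral_integral H (spectral_family_of H T) (\<lambda>t. t)"
    unfolding spectral_family_of_def by auto
qed

end

section \<open>Completeness of the space of square-integrable functions\<close>

lemma sq_integrable_rep: "sq_integrable (rep_L2 u)"
  using Quotient_rep_reflp[OF Quotient_L2, of u] by (simp add: L2_rel_def)

lemma measurable_rep [measurable]: "rep_L2 u \<in> borel_measurable borel"
  using sq_integrable_rep[of u] by (simp add: sq_integrable_def)

lemma abs_rep: "abs_L2 (rep_L2 u) = u"
  by (rule Quotient_abs_rep[OF Quotient_L2])

lemma L2_rel_refl: "sq_integrable f \<Longrightarrow> L2_rel f f"
  by (simp add: L2_rel_def)

lemma AE_rep_abs: "sq_integrable f \<Longrightarrow> AE x in lborel. rep_L2 (abs_L2 f) x = f x"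
  using Quotient_rep_abs[OF Quotient_L2, of f] by (simp add: L2_rel_def)

lemma L2_eqI: "AE x in lborel. rep_L2 u x = rep_L2 v x \<Longrightarrow> u = v"
  using Quotient_rel_rep[OF Quotient_L2, of u v] sq_integrable_rep unfolding L2_rel_def by blast

lemma abs_eqI:
  "sq_integrable f \<Longrightarrow> sq_integrable g \<Longrightarrow> AE x in lborel. f x = g x \<Longrightarrow> abs_L2 f = abs_L2 g"
  by (rule Quotient_rel_abs[OF Quotient_L2]) (simp add: L2_rel_def)

lemma AE_rep_add: "AE x in lborel. rep_L2 (u + v) x = rep_L2 u x + rep_L2 v x"
proof -
  have "u + v = abs_L2 (\<lambda>x. rep_L2 u x + rep_L2 v x)"
    using plus_L2.abs_eq[of "rep_L2 u" "rep_L2 v"] by (simp add: L2_rel_refl sq_integrable_rep abs_rep)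
  then show ?thesis
    using AE_rep_abs[OF sq_integrable_add[OF sq_integrable_rep sq_integrable_rep]] by simp
qed

lemma AE_rep_diff: "AE x in lborel. rep_L2 (u - v) x = rep_L2 u x - rep_L2 v x"
proof -
  have "u - v = abs_L2 (\<lambda>x. rep_L2 u x - rep_L2 v x)"
    using minus_L2.abs_eq[of "rep_L2 u" "rep_L2 v"] by (simp add: L2_rel_refl sq_integrable_rep abs_rep)
  then show ?thesis
    using AE_rep_abs[OF sq_integrable_diff[OF sq_integrable_rep sq_integrable_rep]] by simp
qed

lemma AE_rep_scale: "AE x in lborel. rep_L2 (c *\<^sub>R u) x = c * rep_L2 u x"
proof -
  have "c *\<^sub>R u = abs_L2 (\<lambda>x. c * rep_L2 u x)"
    using scaleR_L2.abs_eq[of "rep_L2 u" c] by (simp add: L2_rel_refl sq_integrable_rep abs_rep)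
  then show ?thesis using AE_rep_abs[OF sq_integrable_scale[OF sq_integrable_rep]] by simp
qed

lemma AE_rep_zero: "AE x in lborel. rep_L2 0 x = 0"
  using AE_rep_abs[OF sq_integrable_zero] by (simp add: zero_L2_def)

lemma inner_rep: "inner u v = (LINT x|lborel. rep_L2 u x * rep_L2 v x)"
  using inner_L2.abs_eq[of "rep_L2 u" "rep_L2 v"] by (simp add: L2_rel_refl sq_integrable_rep abs_rep)

lemma inner_abs:
  assumes "sq_integrable f" "sq_integrable g"
  shows "inner (abs_L2 f) (abs_L2 g) = (LINT x|lborel. f x * g x)"
  using assms by (simp add: inner_L2.abs_eq L2_rel_refl)

lemma nn_integral_rep_diff:
  "(\<integral>\<^sup>+x. ennreal ((rep_L2 u x - rep_L2 v x)\<^sup>2) \<partial>lborel) = ennreal ((dist u v)\<^sup>2)"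
proof -
  have "(\<integral>\<^sup>+x. ennreal ((rep_L2 u x - rep_L2 v x)\<^sup>2) \<partial>lborel)
      = (\<integral>\<^sup>+x. ennreal ((rep_L2 (u - v) x)\<^sup>2) \<partial>lborel)"
    by (intro nn_integral_cong_AE, use AE_rep_diff[of u v] in eventually_elim) simp
  also have "\<dots> = ennreal (LINT x|lborel. (rep_L2 (u - v) x)\<^sup>2)"
    using sq_integrable_rep[of "u - v"] by (intro nn_integral_eq_integral) (auto simp: sq_integrable_def)
  also have "(LINT x|lborel. (rep_L2 (u - v) x)\<^sup>2) = (dist u v)\<^sup>2"
    by (simp add: dist_norm power2_norm_eq_inner inner_rep) (simp add: power2_eq_square)
  finally show ?thesis .
qed

text \<open>Arithmetic-geometric mean with weight 2^n: 2|d| <= 2^n d^2 + 2^(-n).\<close>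

lemma summable_of_weighted_squares:
  fixes d :: "nat \<Rightarrow> real"
  assumes "summable (\<lambda>n. 2 ^ n * (d n)\<^sup>2)"
  shows "summable d"
proof (rule summable_comparison_test')
  show "summable (\<lambda>n. 2 ^ n * (d n)\<^sup>2 + (1/2) ^ n)"
    using assms by (intro summable_add summable_geometric) auto
  fix n :: nat
  define a where "a = (2::real) ^ n"
  have a: "a > 0" "(1/2) ^ n = 1 / a" by (auto simp: a_def power_one_over)
  have "0 \<le> (a * \<bar>d n\<bar> - 1)\<^sup>2 / a" using a by simp
  also have "\<dots> = a * (d n)\<^sup>2 - 2 * \<bar>d n\<bar> + 1 / a"
    using a by (simp add: power2_diff power_mult_distrib field_simps) (simp add: power2_eq_square)
  finally show "norm (d n) \<le> 2 ^ n * (d n)\<^sup>2 + (1/2) ^ n"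
    unfolding a(2) a_def[symmetric] by simp
qed

text \<open>Squared distances of order 4^(-n) leave room for the weight 2^n: the weighted squares
  have a finite integral, so the increments are summable at almost every point.\<close>

lemma AE_convergent_of_fast:
  assumes fast: "\<And>n. dist (u (Suc n)) (u n) \<le> (1/2) ^ n"
  shows "AE x in lborel. convergent (\<lambda>n. rep_L2 (u n) x)"
proof -
  define d where "d n x = rep_L2 (u (Suc n)) x - rep_L2 (u n) x" for n x
  have [measurable]: "d n \<in> borel_measurable borel" for n unfolding d_def[abs_def] by measurable
  have "(\<integral>\<^sup>+x. (\<Sum>n. ennreal (2 ^ n * (d n x)\<^sup>2)) \<partial>lborel) = (\<Sum>n. \<integral>\<^sup>+x. ennreal (2 ^ n * (d n x)\<^sup>2) \<partial>lborel)"
    by (rule nn_integral_suminf) measurable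
  also have "\<dots> \<le> (\<Sum>n. ennreal ((1/2) ^ n))"
  proof (intro suminf_le summableI)
    fix n
    have "(\<integral>\<^sup>+x. ennreal (2 ^ n * (d n x)\<^sup>2) \<partial>lborel) = ennreal (2 ^ n) * (\<integral>\<^sup>+x. ennreal ((d n x)\<^sup>2) \<partial>lborel)"
      by (simp add: ennreal_mult nn_integral_cmult)
    also have "\<dots> = ennreal (2 ^ n) * ennreal ((dist (u (Suc n)) (u n))\<^sup>2)"
      unfolding d_def nn_integral_rep_diff ..
    also have "\<dots> = ennreal (2 ^ n * (dist (u (Suc n)) (u n))\<^sup>2)" by (simp add: ennreal_mult)
    also have "\<dots> \<le> ennreal ((1/2) ^ n)"
    proof (rule ennreal_leI)
      have "2 ^ n * (dist (u (Suc n)) (u n))\<^sup>2 \<le> 2 ^ n * ((1/2) ^ n)\<^sup>2"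
        using fast[of n] by (intro mult_left_mono power_mono) auto
      also have "\<dots> = (1/2) ^ n" by (simp add: power_one_over power2_eq_square)
      finally show "2 ^ n * (dist (u (Suc n)) (u n))\<^sup>2 \<le> (1/2) ^ n" .
    qed
    finally show "(\<integral>\<^sup>+x. ennreal (2 ^ n * (d n x)\<^sup>2) \<partial>lborel) \<le> ennreal ((1/2) ^ n)" .
  qed
  also have "\<dots> = ennreal (\<Sum>n. (1/2) ^ n)" by (rule suminf_ennreal2) auto
  finally have "(\<integral>\<^sup>+x. (\<Sum>n. ennreal (2 ^ n * (d n x)\<^sup>2)) \<partial>lborel) \<noteq> \<infinity>"
    by (auto simp: top_unique)
  then have "AE x in lborel. (\<Sum>n. ennreal (2 ^ n * (d n x)\<^sup>2)) \<noteq> \<infinity>"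
    by (intro nn_integral_PInf_AE) auto
  then show ?thesis
  proof eventually_elim
    case (elim x)
    then have "summable (\<lambda>n. 2 ^ n * (d n x)\<^sup>2)" by (intro summable_suminf_not_top) auto
    then have "summable (\<lambda>n. d n x)" by (rule summable_of_weighted_squares)
    then have "convergent (\<lambda>n. \<Sum>k<n. d k x)" by (simp add: summable_iff_convergent)
    then have "convergent (\<lambda>n. rep_L2 (u n) x - rep_L2 (u 0) x)"
      unfolding d_def sum_lessThan_telescope[of "\<lambda>k. rep_L2 (u k) x"] .
    then obtain L where "(\<lambda>n. rep_L2 (u n) x - rep_L2 (u 0) x) \<longlonglongrightarrow> L" by (auto simp: convergent_def)
    from tendsto_add[OF this tendsto_const[of "rep_L2 (u 0) x"]] show ?case by (auto simp: convergent_def)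
  qed
qed

lemma Cauchy_fast_subsequence:
  fixes u :: "nat \<Rightarrow> 'b::metric_space"
  assumes "Cauchy u"
  obtains r :: "nat \<Rightarrow> nat" where "strict_mono r" "\<And>n i j. i \<ge> r n \<Longrightarrow> j \<ge> r n \<Longrightarrow> dist (u i) (u j) < (1/2) ^ n"
proof -
  have "\<exists>N. \<forall>i\<ge>N. \<forall>j\<ge>N. dist (u i) (u j) < (1/2) ^ n" for n :: nat
    using assms by (intro metric_CauchyD) auto
  then obtain N where N: "\<And>n i j. i \<ge> N n \<Longrightarrow> j \<ge> N n \<Longrightarrow> dist (u i) (u j) < (1/2) ^ n" by metis
  \<comment> \<open>The sum is at least N n, and the extra n makes the sequence strictly
    increasing.\<close>
  define r where "r n = (\<Sum>k\<le>n. N k) + n" for n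
  have "strict_mono r" unfolding strict_mono_Suc_iff by (simp add: r_def)
  moreover have "N n \<le> r n" for n
    unfolding r_def by (intro trans_le_add1 member_le_sum) auto
  ultimately show ?thesis using that[of r] N by (meson order_trans)
qed

text \<open>Riesz-Fischer: the pointwise limit along a fast subsequence is a norm limit by Fatou.
  The almost everywhere subsequence belongs to the conclusion because support conditions and
  difference quotients are read off from it.\<close>

lemma L2_Cauchy_limit:
  fixes u :: "nat \<Rightarrow> 'a::euclidean_space L2"
  assumes "Cauchy u"
  obtains v r where "u \<longlonglongrightarrow> v" "strict_mono r" "AE x in lborel. (\<lambda>n. rep_L2 (u (r n)) x) \<longlonglongrightarrow> rep_L2 v x"
proof -
  obtain r :: "nat \<Rightarrow> nat" where r: "strict_mono r"
    and fast: "\<And>n i j. i \<ge> r n \<Longrightarrow> j \<ge> r n \<Longrightarrow> dist (u i) (u j) < (1/2) ^ n"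
    using Cauchy_fast_subsequence[OF assms] by blast
  define f where "f n = rep_L2 (u (r n))" for n
  define g where "g x = lim (\<lambda>n. f n x)" for x
  have [measurable]: "f n \<in> borel_measurable borel" for n unfolding f_def by measurable
  have [measurable]: "g \<in> borel_measurable borel" unfolding g_def[abs_def] by measurable
  have rmono: "m \<le> n \<Longrightarrow> r m \<le> r n" for m n using r by (simp add: strict_mono_less_eq)
  have "AE x in lborel. convergent (\<lambda>n. f n x)"
    unfolding f_def
  proof (rule AE_convergent_of_fast)
    show "dist (u (r (Suc n))) (u (r n)) \<le> (1/2) ^ n" for n
      using fast[of n "r (Suc n)" "r n"] rmono[of n "Suc n"] by simp
  qed
  then have lim: "AE x in lborel. (\<lambda>n. f n x) \<longlonglongrightarrow> g x"
    by eventually_elim (simp add: g_def convergent_LIMSEQ_iff)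
  have bound: "(\<integral>\<^sup>+x. ennreal ((g x - f n x)\<^sup>2) \<partial>lborel) \<le> ennreal (((1/2) ^ n)\<^sup>2)" for n
  proof -
    have "(\<integral>\<^sup>+x. ennreal ((g x - f n x)\<^sup>2) \<partial>lborel)
        = (\<integral>\<^sup>+x. liminf (\<lambda>k. ennreal ((f k x - f n x)\<^sup>2)) \<partial>lborel)"
    proof (intro nn_integral_cong_AE, use lim in eventually_elim)
      case (elim x)
      have "(\<lambda>k. ennreal ((f k x - f n x)\<^sup>2)) \<longlonglongrightarrow> ennreal ((g x - f n x)\<^sup>2)"
        by (intro tendsto_intros elim)
      then show ?case by (intro lim_imp_Liminf[symmetric]) auto
    qed
    also have "\<dots> \<le> liminf (\<lambda>k. \<integral>\<^sup>+x. ennreal ((f k x - f n x)\<^sup>2) \<partial>lborel)"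
      by (rule nn_integral_liminf) measurable
    also have "\<dots> \<le> ennreal (((1/2) ^ n)\<^sup>2)"
    proof (rule Liminf_le)
      show "\<forall>\<^sub>F k in sequentially. (\<integral>\<^sup>+x. ennreal ((f k x - f n x)\<^sup>2) \<partial>lborel) \<le> ennreal (((1/2) ^ n)\<^sup>2)"
        unfolding eventually_sequentially f_def nn_integral_rep_diff
      proof (intro exI allI impI ennreal_leI power_mono)
        fix k assume "n \<le> k"
        then show "dist (u (r k)) (u (r n)) \<le> (1/2) ^ n"
          using fast[of n "r k" "r n"] rmono by simp
      qed simp
    qed simp
    finally show ?thesis .
  qed
  have sq_diff: "sq_integrable (\<lambda>x. g x - f n x)" for n
    unfolding sq_integrable_def
  proof
    show "integrable lborel (\<lambda>x. (g x - f n x)\<^sup>2)"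
      using order_le_less_trans[OF bound[of n], of \<infinity>] by (simp add: integrable_iff_bounded)
  qed simp
  have sq: "sq_integrable g"
    using sq_integrable_add[OF sq_diff[of 0], of "f 0"] by (simp add: f_def sq_integrable_rep)
  define v where "v = abs_L2 g"
  have v: "AE x in lborel. rep_L2 v x = g x" unfolding v_def by (rule AE_rep_abs[OF sq])
  have close: "dist v (u (r n)) \<le> (1/2) ^ n" for n
  proof -
    have "ennreal ((dist v (u (r n)))\<^sup>2) = (\<integral>\<^sup>+x. ennreal ((g x - f n x)\<^sup>2) \<partial>lborel)"
      unfolding nn_integral_rep_diff[symmetric] f_def
      by (intro nn_integral_cong_AE, use v in eventually_elim) simp
    also have "\<dots> \<le> ennreal (((1/2) ^ n)\<^sup>2)" by (rule bound)
    finally have "(dist v (u (r n)))\<^sup>2 \<le> ((1/2) ^ n)\<^sup>2" by (subst (asm) ennreal_le_iff) auto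
    then show ?thesis by (rule power2_le_imp_le) simp
  qed
  have "(\<lambda>n. (1/2::real) ^ n) \<longlonglongrightarrow> 0" by (intro LIMSEQ_power_zero) auto
  then have "(\<lambda>n. dist (u (r n)) v) \<longlonglongrightarrow> 0"
    by (rule Lim_null_comparison[rotated]) (use close in \<open>auto simp: dist_commute\<close>)
  then have "(u \<circ> r) \<longlonglongrightarrow> v" unfolding o_def by (rule iffD2[OF tendsto_dist_iff])
  then have "u \<longlonglongrightarrow> v"
    using Cauchy_converges_subseq[OF assms r] by blast
  moreover have "AE x in lborel. (\<lambda>n. rep_L2 (u (r n)) x) \<longlonglongrightarrow> rep_L2 v x"
    using lim v by eventually_elim (simp add: f_def)
  ultimately show ?thesis using that r by blast
qed

lemma L2_AE_subsequence:
  fixes u :: "nat \<Rightarrow> 'a::euclidean_space L2"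
  assumes "u \<longlonglongrightarrow> v"
  obtains r where "strict_mono r" "AE x in lborel. (\<lambda>n. rep_L2 (u (r n)) x) \<longlonglongrightarrow> rep_L2 v x"
  using L2_Cauchy_limit[OF LIMSEQ_imp_Cauchy[OF assms]] LIMSEQ_unique[OF assms] by metis

lemma complete_L2: "Topological_Spaces.complete (UNIV :: 'a::euclidean_space L2 set)"
  unfolding complete_def using L2_Cauchy_limit by (metis UNIV_I)

lemma L2_on_iff: "u \<in> L2_on \<Omega> \<longleftrightarrow> (AE x in lborel. x \<notin> \<Omega> \<longrightarrow> rep_L2 u x = 0)"
  by (simp add: L2_on_def)

lemma hilbert_L2_on: "hilbert (L2_on \<Omega>)"
proof
  show "subspace (L2_on \<Omega>)"
    unfolding subspace_def
  proof (intro conjI ballI allI)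
    show "0 \<in> L2_on \<Omega>" unfolding L2_on_iff using AE_rep_zero by eventually_elim simp
    show "u + v \<in> L2_on \<Omega>" if "u \<in> L2_on \<Omega>" "v \<in> L2_on \<Omega>" for u v
      using that AE_rep_add[of u v] unfolding L2_on_iff by eventually_elim simp
    show "c *\<^sub>R u \<in> L2_on \<Omega>" if "u \<in> L2_on \<Omega>" for c u
      using that AE_rep_scale[of c u] unfolding L2_on_iff by eventually_elim simp
  qed
  have "closed (L2_on \<Omega>)"
    unfolding closed_sequential_limits
  proof (intro allI impI, elim conjE)
    fix u v assume u: "\<forall>n. u n \<in> L2_on \<Omega>" and lim: "u \<longlonglongrightarrow> v"
    obtain r where r: "AE x in lborel. (\<lambda>n. rep_L2 (u (r n)) x) \<longlonglongrightarrow> rep_L2 v x"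
      using L2_AE_subsequence[OF lim] by blast
    have "AE x in lborel. \<forall>n. x \<notin> \<Omega> \<longrightarrow> rep_L2 (u (r n)) x = 0"
      using u unfolding L2_on_iff AE_all_countable by blast
    then show "v \<in> L2_on \<Omega>" unfolding L2_on_iff using r
      by eventually_elim (auto simp: LIMSEQ_const_iff)
  qed
  then show "Topological_Spaces.complete (L2_on \<Omega>)"
    using complete_L2 complete_closed_subset by blast
qed

section \<open>The fractional Dirichlet form\<close>

text \<open>A square root of the Gagliardo integrand: halving the exponent in the denominator turns
  the double integral into an inner product over the doubled space.\<close>

definition diff_quot :: "real \<Rightarrow> 'a::euclidean_space L2 \<Rightarrow> 'a \<times> 'a \<Rightarrow> real" where
  "diff_quot s u p = (rep_L2 u (fst p) - rep_L2 u (snd p)) / norm (fst p - snd p) powr ((real DIM('a) + 2 * s) / 2)"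

lemma measurable_diff_quot [measurable]: "diff_quot s u \<in> borel_measurable borel"
proof -
  have "diff_quot s u \<in> borel_measurable (borel \<Otimes>\<^sub>M borel)"
    unfolding diff_quot_def[abs_def] by measurable
  then show ?thesis by (simp add: borel_prod)
qed

lemma gagliardo_diff_quot: "gagliardo_integrand s u v = (\<lambda>p. diff_quot s u p * diff_quot s v p)"
proof
  fix p :: "'a \<times> 'a"
  have "norm (fst p - snd p) powr (real DIM('a) + 2 * s)
      = norm (fst p - snd p) powr ((real DIM('a) + 2 * s) / 2) * norm (fst p - snd p) powr ((real DIM('a) + 2 * s) / 2)"
    unfolding powr_add[symmetric] by simp
  then show "gagliardo_integrand s u v p = diff_quot s u p * diff_quot s v p"
    by (simp add: gagliardo_integrand_def diff_quot_def split_beta)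
qed

lemma frac_sobolev_iff: "u \<in> frac_sobolev s \<longleftrightarrow> sq_integrable (diff_quot s u)"
  by (simp add: frac_sobolev_def gagliardo_diff_quot sq_integrable_def lborel_prod power2_eq_square)

text \<open>Meaningful on \<open>frac_sobolev s\<close>, where it is linear and the form is the
  inner product of u and v plus a constant times that of their images.\<close>

definition J :: "real \<Rightarrow> 'a::euclidean_space L2 \<Rightarrow> ('a \<times> 'a) L2" where
  "J s u = abs_L2 (diff_quot s u)"

text \<open>For a null set N both N x R^N and R^N x N are null in the product.\<close>

lemma AE_lborel_pair:
  fixes P :: "'a::euclidean_space \<Rightarrow> bool"
  assumes "AE x in lborel. P x"
  shows "AE p in lborel. P (fst p) \<and> P (snd p)"
proof -
  from assms obtain N where N: "{x. \<not> P x} \<subseteq> N" "N \<in> null_sets lborel"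
    by (auto elim!: AE_E simp: null_sets_def)
  have "N \<times> UNIV \<in> null_sets (lborel \<Otimes>\<^sub>M (lborel :: 'a measure))"
    using N by (intro lborel.times_in_null_sets1) auto
  then have "AE p in lborel. p \<notin> N \<times> (UNIV :: 'a set)" unfolding lborel_prod by (rule AE_not_in)
  moreover have "UNIV \<times> N \<in> null_sets ((lborel :: 'a measure) \<Otimes>\<^sub>M lborel)"
    using N by (intro lborel.times_in_null_sets2) auto
  then have "AE p in lborel. p \<notin> (UNIV :: 'a set) \<times> N" unfolding lborel_prod by (rule AE_not_in)
  ultimately have "AE p in lborel. p \<notin> N \<times> (UNIV :: 'a set) \<and> p \<notin> (UNIV :: 'a set) \<times> N"
    by (rule AE_conjI)
  then show ?thesis by (rule AE_mp, intro AE_I2) (use N in auto)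
qed

lemma AE_diff_quot_add: "AE p in lborel. diff_quot s (u + v) p = diff_quot s u p + diff_quot s v p"
  using AE_lborel_pair[OF AE_rep_add[of u v]]
  by eventually_elim (simp add: diff_quot_def add_divide_distrib[symmetric] algebra_simps)

lemma AE_diff_quot_scale: "AE p in lborel. diff_quot s (c *\<^sub>R u) p = c * diff_quot s u p"
  using AE_lborel_pair[OF AE_rep_scale[of c u]]
  by eventually_elim (simp add: diff_quot_def algebra_simps)

lemma sq_integrable_cong_AE:
  assumes "sq_integrable f" "g \<in> borel_measurable borel" "AE x in lborel. g x = f x"
  shows "sq_integrable g"
proof -
  have "integrable lborel (\<lambda>x. (g x)\<^sup>2) = integrable lborel (\<lambda>x. (f x)\<^sup>2)"
    using assms by (intro integrable_cong_AE) (auto simp: sq_integrable_def)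
  then show ?thesis using assms by (simp add: sq_integrable_def)
qed

lemma
  assumes "u \<in> frac_sobolev s" "v \<in> frac_sobolev s"
  shows frac_sobolev_add: "u + v \<in> frac_sobolev s" and J_add: "J s (u + v) = J s u + J s v"
proof -
  have sq: "sq_integrable (diff_quot s u)" "sq_integrable (diff_quot s v)" using assms by (auto simp: frac_sobolev_iff)
  have "sq_integrable (diff_quot s (u + v))"
    by (rule sq_integrable_cong_AE[OF sq_integrable_add[OF sq] _ AE_diff_quot_add]) measurable
  then show "u + v \<in> frac_sobolev s" by (simp add: frac_sobolev_iff)
  show "J s (u + v) = J s u + J s v"
    using sq \<open>sq_integrable (diff_quot s (u + v))\<close> AE_diff_quot_add
    by (simp add: J_def plus_L2.abs_eq L2_rel_refl) (intro abs_eqI sq_integrable_add)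
qed

lemma
  assumes "u \<in> frac_sobolev s"
  shows frac_sobolev_scale: "c *\<^sub>R u \<in> frac_sobolev s" and J_scale: "J s (c *\<^sub>R u) = c *\<^sub>R J s u"
proof -
  have sq: "sq_integrable (diff_quot s u)" using assms by (auto simp: frac_sobolev_iff)
  have "sq_integrable (diff_quot s (c *\<^sub>R u))"
    by (rule sq_integrable_cong_AE[OF sq_integrable_scale[OF sq] _ AE_diff_quot_scale]) measurable
  then show "c *\<^sub>R u \<in> frac_sobolev s" by (simp add: frac_sobolev_iff)
  show "J s (c *\<^sub>R u) = c *\<^sub>R J s u"
    using sq \<open>sq_integrable (diff_quot s (c *\<^sub>R u))\<close> AE_diff_quot_scale
    by (simp add: J_def scaleR_L2.abs_eq L2_rel_refl) (intro abs_eqI sq_integrable_scale)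
qed

text \<open>Norm limits give almost everywhere limits along nested subsequences, for the functions
  and then for their quotients, and the two limits agree pointwise. This is the closedness of the
  form.\<close>

lemma J_closed_graph:
  assumes u: "\<And>n. u n \<in> frac_sobolev s" and lim: "u \<longlonglongrightarrow> v" and limJ: "(\<lambda>n. J s (u n)) \<longlonglongrightarrow> w"
  shows "v \<in> frac_sobolev s" "J s v = w"
proof -
  obtain r where r: "strict_mono r" "AE x in lborel. (\<lambda>n. rep_L2 (u (r n)) x) \<longlonglongrightarrow> rep_L2 v x"
    using L2_AE_subsequence[OF lim] by blast
  have "((\<lambda>n. J s (u n)) \<circ> r) \<longlonglongrightarrow> w" using limJ r(1) by (rule LIMSEQ_subseq_LIMSEQ)
  then obtain r' where r': "strict_mono r'"
    "AE p in lborel. (\<lambda>n. rep_L2 (((\<lambda>n. J s (u n)) \<circ> r) (r' n)) p) \<longlonglongrightarrow> rep_L2 w p"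
    using L2_AE_subsequence by blast
  have rep: "AE p in lborel. \<forall>n. rep_L2 (J s (u n)) p = diff_quot s (u n) p"
    unfolding AE_all_countable J_def using u by (auto simp: frac_sobolev_iff intro: AE_rep_abs)
  have AE: "AE p in lborel. diff_quot s v p = rep_L2 w p"
    using AE_lborel_pair[OF r(2)] r'(2) rep
  proof eventually_elim
    case (elim p)
    have "(\<lambda>n. diff_quot s (u (r (r' n))) p) \<longlonglongrightarrow> diff_quot s v p"
      unfolding diff_quot_def divide_inverse
      using elim(1) LIMSEQ_subseq_LIMSEQ[OF _ r'(1), unfolded o_def]
      by (intro tendsto_mult tendsto_diff tendsto_const) auto
    moreover have "(\<lambda>n. diff_quot s (u (r (r' n))) p) \<longlonglongrightarrow> rep_L2 w p" using elim(2,3) by (simp add: o_def)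
    ultimately show ?case by (rule LIMSEQ_unique)
  qed
  have sq: "sq_integrable (diff_quot s v)"
    by (rule sq_integrable_cong_AE[OF sq_integrable_rep _ AE]) measurable
  then show "v \<in> frac_sobolev s" by (simp add: frac_sobolev_iff)
  show "J s v = w"
    using abs_eqI[OF sq sq_integrable_rep AE] by (simp add: J_def abs_rep)
qed

lemma H0s_eq: "H0s \<Omega> s = frac_sobolev s \<inter> L2_on \<Omega>"
  by (auto simp: H0s_def L2_on_def)

lemma frac_const_pos: "0 < s \<Longrightarrow> s < 1 \<Longrightarrow> 0 < frac_const N s"
  unfolding frac_const_def by (intro divide_pos_pos mult_pos_pos Gamma_real_pos) auto

lemma dirichlet_form_eq:
  fixes u v :: "'a::euclidean_space L2"
  assumes [measurable]: "\<Omega> \<in> sets borel" and uv: "u \<in> H0s \<Omega> s" "v \<in> H0s \<Omega> s"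
  shows "dirichlet_form \<Omega> s u v = inner u v + frac_const DIM('a) s / 2 * inner (J s u) (J s v)"
proof -
  have "(LINT x:\<Omega>|lborel. rep_L2 u x * rep_L2 v x) = (LINT x|lborel. rep_L2 u x * rep_L2 v x)"
    unfolding set_lebesgue_integral_def
  proof (rule integral_cong_AE)
    show "AE x in lborel. indicator \<Omega> x *\<^sub>R (rep_L2 u x * rep_L2 v x) = rep_L2 u x * rep_L2 v x"
      using uv(1) unfolding H0s_eq Int_iff L2_on_iff by (auto elim!: eventually_mono simp: indicator_def)
  qed measurable
  moreover have "(\<integral>p. gagliardo_integrand s u v p \<partial>(lborel \<Otimes>\<^sub>M lborel)) = inner (J s u) (J s v)"
    using uv by (simp add: gagliardo_diff_quot lborel_prod J_def inner_abs H0s_eq frac_sobolev_iff)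
  ultimately show ?thesis by (simp add: dirichlet_form_def inner_rep)
qed

locale fractional =
  fixes \<Omega> :: "'a::euclidean_space set" and s :: real
  assumes measurable_Omega: "\<Omega> \<in> sets borel" and s_pos: "0 < s" and s_less: "s < 1"
begin

definition c :: real where "c = frac_const DIM('a) s / 2"

lemma c_pos: "0 < c" using frac_const_pos[OF s_pos s_less] by (simp add: c_def)

lemma form_eq: "u \<in> H0s \<Omega> s \<Longrightarrow> v \<in> H0s \<Omega> s \<Longrightarrow>
    dirichlet_form \<Omega> s u v = inner u v + c * inner (J s u) (J s v)"
  using dirichlet_form_eq[OF measurable_Omega] by (simp add: c_def)

sublocale L: hilbert "L2_on \<Omega>" by (rule hilbert_L2_on)

lemma H0s_L2_on: "u \<in> H0s \<Omega> s \<Longrightarrow> u \<in> L2_on \<Omega>" by (simp add: H0s_eq)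

lemma H0s_frac: "u \<in> H0s \<Omega> s \<Longrightarrow> u \<in> frac_sobolev s" by (simp add: H0s_eq)

lemma frac_sobolev_zero: "(0 :: 'a L2) \<in> frac_sobolev s"
proof -
  have "sq_integrable (diff_quot s (0 :: 'a L2))"
  proof (rule sq_integrable_cong_AE[OF sq_integrable_zero])
    show "AE p in lborel. diff_quot s (0 :: 'a L2) p = 0"
      using AE_lborel_pair[OF AE_rep_zero] by eventually_elim (simp add: diff_quot_def)
  qed measurable
  then show ?thesis by (simp add: frac_sobolev_iff)
qed

lemma subspace_H0s: "subspace (H0s \<Omega> s)"
  unfolding subspace_def H0s_eq
  by (auto intro: frac_sobolev_zero frac_sobolev_add frac_sobolev_scale)

sublocale a: semi_form "H0s \<Omega> s" "dirichlet_form \<Omega> s"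
proof
  show "subspace (H0s \<Omega> s)" by (rule subspace_H0s)
  show "dirichlet_form \<Omega> s (x + y) z = dirichlet_form \<Omega> s x z + dirichlet_form \<Omega> s y z"
    if "x \<in> H0s \<Omega> s" "y \<in> H0s \<Omega> s" "z \<in> H0s \<Omega> s" for x y z
    using that subspace_add[OF subspace_H0s, of x y]
    by (simp add: form_eq J_add H0s_frac inner_add_left algebra_simps)
  show "dirichlet_form \<Omega> s (r *\<^sub>R x) z = r * dirichlet_form \<Omega> s x z"
    if "x \<in> H0s \<Omega> s" "z \<in> H0s \<Omega> s" for r x z
    using that subspace_scale[OF subspace_H0s, of x r]
    by (simp add: form_eq J_scale H0s_frac algebra_simps)
  show "dirichlet_form \<Omega> s x y = dirichlet_form \<Omega> s y x" if "x \<in> H0s \<Omega> s" "y \<in> H0s \<Omega> s" for x y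
    using that by (simp add: form_eq inner_commute)
  show "0 \<le> dirichlet_form \<Omega> s x x" if "x \<in> H0s \<Omega> s" for x
    using that c_pos by (simp add: form_eq)
qed

lemma inner_le_form: "u \<in> H0s \<Omega> s \<Longrightarrow> inner u u \<le> dirichlet_form \<Omega> s u u"
  using c_pos by (simp add: form_eq)

lemma J_diff: "u \<in> H0s \<Omega> s \<Longrightarrow> v \<in> H0s \<Omega> s \<Longrightarrow> J s (u - v) = J s u - J s v"
  using J_add[of "u - v" s v] a.mem_diff[of u v] H0s_frac by simp

text \<open>A sequence that is Cauchy for the form is Cauchy in both components u and
  \<open>J s u\<close>; the closed graph of \<open>J\<close> reassembles the two limits.\<close>

lemma form_complete: "a.form_complete"
  unfolding a.form_complete_def
proof (intro allI impI)
  fix f :: "nat \<Rightarrow> 'a L2"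
  assume f: "\<forall>n. f n \<in> H0s \<Omega> s"
    and cau: "\<forall>e>0. \<exists>N. \<forall>m\<ge>N. \<forall>n\<ge>N. dirichlet_form \<Omega> s (f m - f n) (f m - f n) < e"
  interpret P: hilbert "UNIV :: ('a \<times> 'a) L2 set"
    by unfold_locales (auto simp: complete_L2)
  have ineq: "inner (f m - f n) (f m - f n) \<le> dirichlet_form \<Omega> s (f m - f n) (f m - f n)"
    "c * inner (J s (f m) - J s (f n)) (J s (f m) - J s (f n)) \<le> dirichlet_form \<Omega> s (f m - f n) (f m - f n)"
    for m n
    using f c_pos by (auto simp: form_eq J_diff)
  have "Cauchy f"
  proof (rule L.Cauchy_inner)
    fix e :: real assume "e > 0"
    with cau obtain N where "\<forall>m\<ge>N. \<forall>n\<ge>N. dirichlet_form \<Omega> s (f m - f n) (f m - f n) < e" by blast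
    then show "\<exists>N. \<forall>m\<ge>N. \<forall>n\<ge>N. inner (f m - f n) (f m - f n) < e"
      using ineq(1) by (meson order_le_less_trans)
  qed
  moreover have "Cauchy (\<lambda>n. J s (f n))"
  proof (rule P.Cauchy_inner)
    fix e :: real assume "e > 0"
    then have "c * e > 0" using c_pos by simp
    with cau obtain N where "\<forall>m\<ge>N. \<forall>n\<ge>N. dirichlet_form \<Omega> s (f m - f n) (f m - f n) < c * e" by blast
    then have "\<forall>m\<ge>N. \<forall>n\<ge>N. c * inner (J s (f m) - J s (f n)) (J s (f m) - J s (f n)) < c * e"
      using ineq(2) by (meson order_le_less_trans)
    then show "\<exists>N. \<forall>m\<ge>N. \<forall>n\<ge>N. inner (J s (f m) - J s (f n)) (J s (f m) - J s (f n)) < e"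
      using c_pos by auto
  qed
  ultimately obtain v w where v: "f \<longlonglongrightarrow> v" and w: "(\<lambda>n. J s (f n)) \<longlonglongrightarrow> w"
    using L2_Cauchy_limit by metis
  have vf: "v \<in> frac_sobolev s" "J s v = w"
    using J_closed_graph[OF _ v w] f H0s_frac by auto
  have "v \<in> L2_on \<Omega>" using L.H_limit[of f v] f H0s_L2_on v by blast
  with vf have vH: "v \<in> H0s \<Omega> s" by (simp add: H0s_eq)
  have "(\<lambda>n. inner (f n - v) (f n - v) + c * inner (J s (f n) - w) (J s (f n) - w))
      \<longlonglongrightarrow> inner (v - v) (v - v) + c * inner (w - w) (w - w)"
    by (intro tendsto_intros v w)
  then have "(\<lambda>n. dirichlet_form \<Omega> s (f n - v) (f n - v)) \<longlonglongrightarrow> 0"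
    using f vH vf(2) by (simp add: form_eq J_diff)
  then show "\<exists>x\<in>H0s \<Omega> s. (\<lambda>n. dirichlet_form \<Omega> s (f n - x) (f n - x)) \<longlonglongrightarrow> 0"
    using vH by blast
qed

end

section \<open>Density of the fractional Sobolev space\<close>

text \<open>The shell index is the floor of log 2 r, split by sign so that both families are indexed
  by natural numbers.\<close>

lemma dyadic_shell:
  fixes r :: real
  assumes "0 < r"
  obtains (inner) j :: nat where "2 powr (- real j - 1) \<le> r" "r \<le> 2 powr (- real j)"
    | (outer) j :: nat where "2 powr real j \<le> r" "r \<le> 2 powr (real j + 1)"
proof -
  define n where "n = \<lfloor>log 2 r\<rfloor>"
  have n: "of_int n \<le> log 2 r" "log 2 r < of_int n + 1" by (auto simp: n_def)
  then have p: "2 powr (of_int n) \<le> r" "r \<le> 2 powr (of_int n + 1)"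
    using assms by (auto simp: le_log_iff log_less_iff less_imp_le)
  show ?thesis
  proof (cases "n < 0")
    case True
    define j where "j = nat (- n - 1)"
    have "real j = - real_of_int n - 1" using True by (simp add: j_def)
    then have "- real j - 1 = of_int n" "- real j = of_int n + 1" by simp_all
    then show ?thesis using p inner[of j] by (simp only:)
  next
    case False
    define j where "j = nat n"
    have "real j = real_of_int n" using False by (simp add: j_def)
    then show ?thesis using p outer[of j] by simp
  qed
qed

text \<open>A Levy-type weight: up to the factor L^2 it dominates the squared difference quotient of
  a function with values in [0, 1] and Lipschitz constant L >= 1.\<close>

definition riesz_kernel :: "real \<Rightarrow> 'a::euclidean_space \<Rightarrow> real" where
  "riesz_kernel s z = min 1 ((norm z)\<^sup>2) / norm z powr (real DIM('a) + 2 * s)"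

lemma measurable_riesz_kernel [measurable]: "riesz_kernel s \<in> borel_measurable borel"
  unfolding riesz_kernel_def[abs_def] by measurable

lemma riesz_kernel_nonneg: "0 \<le> riesz_kernel s z"
  by (simp add: riesz_kernel_def)

text \<open>Kernel bound times volume is of order 2^((2s-2)j) at radius 2^(-j) and 2^(-2sj) at
  radius 2^j. The first geometric series converges by s < 1, the second by s > 0. Balls replace the
  shells for their explicit volume.\<close>

lemma nn_integral_riesz_kernel_finite:
  assumes s: "0 < s" "s < 1"
  shows "(\<integral>\<^sup>+z. ennreal (riesz_kernel s (z :: 'a::euclidean_space)) \<partial>lborel) < \<infinity>"
proof -
  let ?N = "real DIM('a)"
  define q where "q = ?N + 2 * s"
  have q: "q > 0" using s by (simp add: q_def add_nonneg_pos)
  \<comment> \<open>Shell bounds: for \<open>A\<close> the numerator is taken at the outer radius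
    2^(-j) and the denominator at the inner radius 2^(-j-1); for \<open>B\<close> the numerator is 1
    and the inner radius 2^j.\<close>
  define A where "A j = 2 powr (- 2 * real j) * 2 powr ((real j + 1) * q)" for j :: nat
  define B where "B j = 2 powr (- real j * q)" for j :: nat
  define V where "V = unit_ball_vol ?N"
  let ?t = "\<lambda>j z. ennreal (A j) * indicator (cball (0 :: 'a) (2 powr (- real j))) z
        + ennreal (B j) * indicator (cball (0 :: 'a) (2 powr (real j + 1))) z"
  have AB: "0 \<le> A j" "0 \<le> B j" for j by (auto simp: A_def B_def)
  have pt: "ennreal (riesz_kernel s z) \<le> (\<Sum>j. ?t j z)" for z :: 'a
  proof (cases "z = 0")
    case True
    then show ?thesis by (simp add: riesz_kernel_def)
  next
    case False
    then have "0 < norm z" by simp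
    then have "\<exists>j. ennreal (riesz_kernel s z) \<le> ?t j z"
    proof (cases rule: dyadic_shell)
      case (inner j)
      have "riesz_kernel s z \<le> (norm z)\<^sup>2 * norm z powr (- q)"
        unfolding riesz_kernel_def q_def[symmetric] powr_minus_divide by (simp add: divide_right_mono)
      also have "\<dots> \<le> (2 powr (- real j))\<^sup>2 * (2 powr (- real j - 1)) powr (- q)"
        using inner q by (intro mult_mono power_mono powr_mono2') auto
      also have "\<dots> = A j"
        by (simp add: A_def powr_powr power2_eq_square powr_add[symmetric] algebra_simps)
      finally have "ennreal (riesz_kernel s z) \<le> ennreal (A j) * indicator (cball 0 (2 powr (- real j))) z"
        using inner by (simp add: ennreal_leI)
      then show ?thesis by (intro exI[of _ j]) (auto intro: order_trans)
    next
      case (outer j)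
      have "riesz_kernel s z \<le> 1 * norm z powr (- q)"
        unfolding riesz_kernel_def q_def[symmetric] powr_minus_divide by (simp add: divide_right_mono)
      also have "\<dots> \<le> 1 * (2 powr real j) powr (- q)"
        using outer q by (intro mult_mono powr_mono2') auto
      also have "\<dots> = B j" by (simp add: B_def powr_powr)
      finally have "ennreal (riesz_kernel s z) \<le> ennreal (B j) * indicator (cball 0 (2 powr (real j + 1))) z"
        using outer by (simp add: ennreal_leI)
      then show ?thesis by (intro exI[of _ j]) (metis add.commute add_increasing2 zero_le)
    qed
    then obtain j where "ennreal (riesz_kernel s z) \<le> ?t j z" by blast
    also have "\<dots> = (\<Sum>i\<in>{j}. ?t i z)" by simp
    also have "\<dots> \<le> (\<Sum>j. ?t j z)" by (rule sum_le_suminf) (auto intro: summableI)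
    finally show ?thesis .
  qed
  have vol: "emeasure lborel (cball (0 :: 'a) (2 powr x)) = ennreal (V * 2 powr (x * ?N))" for x
  proof -
    have "(2 powr x) ^ DIM('a) = 2 powr (x * ?N)" by (simp add: powr_realpow[symmetric] powr_powr)
    then show ?thesis by (simp add: emeasure_cball V_def)
  qed
  have [measurable]: "cball (0 :: 'a) r \<in> sets borel" for r by simp
  have V0: "0 \<le> V" by (simp add: V_def)
  let ?u = "\<lambda>j. V * 2 powr q * (2 powr (2 * s - 2)) ^ j + V * 2 powr ?N * (2 powr (- 2 * s)) ^ j"
  have int: "(\<integral>\<^sup>+z. ?t j z \<partial>lborel) = ennreal (?u j)" for j
  proof -
    have "(\<integral>\<^sup>+z. ?t j z \<partial>lborel)
        = (\<integral>\<^sup>+z. ennreal (A j) * indicator (cball (0 :: 'a) (2 powr (- real j))) z \<partial>lborel)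
        + (\<integral>\<^sup>+z. ennreal (B j) * indicator (cball (0 :: 'a) (2 powr (real j + 1))) z \<partial>lborel)"
      by (rule nn_integral_add; measurable)
    also have "\<dots> = ennreal (A j) * ennreal (V * 2 powr (- real j * ?N))
        + ennreal (B j) * ennreal (V * 2 powr ((real j + 1) * ?N))"
      by (subst (1 2) nn_integral_cmult_indicator) (auto simp: vol)
    also have "\<dots> = ennreal (A j * (V * 2 powr (- real j * ?N)) + B j * (V * 2 powr ((real j + 1) * ?N)))"
      using AB V0 by (simp add: ennreal_mult'' ennreal_plus)
    also have "A j * (V * 2 powr (- real j * ?N)) = V * (2 powr (- 2 * real j + (real j + 1) * q - real j * ?N))"
      by (simp add: A_def powr_add[symmetric] mult.left_commute mult.assoc)
    also have "- 2 * real j + (real j + 1) * q - real j * ?N = q + (2 * s - 2) * real j"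
      by (simp add: q_def algebra_simps)
    also have "2 powr (q + (2 * s - 2) * real j) = 2 powr q * (2 powr (2 * s - 2)) ^ j"
      by (simp add: powr_add powr_powr[symmetric] powr_realpow)
    also have "B j * (V * 2 powr ((real j + 1) * ?N)) = V * (2 powr (- real j * q + (real j + 1) * ?N))"
      by (simp add: B_def powr_add[symmetric] mult.left_commute)
    also have "- real j * q + (real j + 1) * ?N = ?N + (- 2 * s) * real j"
      by (simp add: q_def algebra_simps)
    also have "2 powr (?N + (- 2 * s) * real j) = 2 powr ?N * (2 powr (- 2 * s)) ^ j"
      unfolding powr_add powr_powr[symmetric] by (simp add: powr_realpow)
    finally show ?thesis by (simp add: mult.assoc)
  qed
  have lt1: "2 powr (2 * s - 2) < (1::real)" "2 powr (- 2 * s) < (1::real)"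
    using s powr_less_mono[of "2 * s - 2" 0 2] powr_less_mono[of "- 2 * s" 0 2] by auto
  have summ: "summable ?u"
    using lt1 by (intro summable_add summable_mult summable_geometric) auto
  have "(\<integral>\<^sup>+z. ennreal (riesz_kernel s (z :: 'a)) \<partial>lborel) \<le> (\<integral>\<^sup>+z. (\<Sum>j. ?t j z) \<partial>lborel)"
    by (intro nn_integral_mono pt)
  also have "\<dots> = (\<Sum>j. \<integral>\<^sup>+z. ?t j z \<partial>lborel)" by (rule nn_integral_suminf) measurable
  also have "\<dots> = (\<Sum>j. ennreal (?u j))" by (simp add: int)
  also have "\<dots> = ennreal (\<Sum>j. ?u j)" using summ V0 by (intro suminf_ennreal2) auto
  also have "\<dots> < \<infinity>" by simp
  finally show ?thesis .
qed

lemma nn_integral_riesz_kernel_translate: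
  "(\<integral>\<^sup>+y. ennreal (riesz_kernel s ((x :: 'a) - y)) \<partial>lborel) = (\<integral>\<^sup>+z. ennreal (riesz_kernel s (z :: 'a::euclidean_space)) \<partial>lborel)"
proof -
  have "(\<integral>\<^sup>+y. ennreal (riesz_kernel s (x - y)) \<partial>lborel) = (\<integral>\<^sup>+y. ennreal (riesz_kernel s (- x + y)) \<partial>lborel)"
    by (intro nn_integral_cong) (simp add: riesz_kernel_def norm_minus_commute add.commute)
  also have "\<dots> = (\<integral>\<^sup>+z. ennreal (riesz_kernel s z) \<partial>distr lborel borel ((+) (- x)))"
    by (subst nn_integral_distr) auto
  finally show ?thesis by (simp add: lborel_distr_plus)
qed

lemma sq_integrable_bounded_support:
  assumes "f \<in> borel_measurable borel" "\<And>x. \<bar>f x\<bar> \<le> 1" "\<And>x. x \<notin> \<Omega> \<Longrightarrow> f x = 0" "bounded \<Omega>"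
    "\<Omega> \<in> sets borel"
  shows "sq_integrable f"
  unfolding sq_integrable_def
proof
  show "f \<in> borel_measurable lborel" using assms by simp
  have "integrable lborel (indicator \<Omega> :: _ \<Rightarrow> real)"
    using assms emeasure_bounded_finite[of \<Omega>] by (intro integrable_real_indicator) auto
  then show "integrable lborel (\<lambda>x. (f x)\<^sup>2)"
  proof (rule Bochner_Integration.integrable_bound)
    show "AE x in lborel. norm ((f x)\<^sup>2) \<le> norm (indicator \<Omega> x :: real)"
    proof (rule AE_I2)
      fix x
      have "\<bar>f x\<bar>\<^sup>2 \<le> 1\<^sup>2" by (intro power_mono assms) auto
      then show "norm ((f x)\<^sup>2) \<le> norm (indicator \<Omega> x :: real)"
        using assms(3)[of x] by (auto simp: indicator_def)
    qed
  qed (use assms in simp)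
qed

section \<open>Lipschitz cutoffs in the form domain\<close>

locale fractional_domain = fractional \<Omega> s for \<Omega> :: "'a::euclidean_space set" and s +
  assumes open_Omega: "open \<Omega>" and bounded_Omega: "bounded \<Omega>"
begin

text \<open>The difference of values vanishes unless one of the points lies in \<Omega>. Charging
  the kernel to that point, Tonelli bounds the double integral by twice L^2 times the kernel
  integral times the volume of \<Omega>.\<close>

lemma lipschitz_in_H0s:
  fixes f :: "'a \<Rightarrow> real"
  assumes f01: "\<And>x. 0 \<le> f x" "\<And>x. f x \<le> 1" and supp: "\<And>x. x \<notin> \<Omega> \<Longrightarrow> f x = 0"
    and lip: "\<And>x y. \<bar>f x - f y\<bar> \<le> L * norm (x - y)" and L: "1 \<le> L"
    and f [measurable]: "f \<in> borel_measurable borel"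
  shows "sq_integrable f" "abs_L2 f \<in> H0s \<Omega> s"
proof -
  note [measurable] = measurable_Omega
  show sq: "sq_integrable f"
    by (rule sq_integrable_bounded_support[OF f _ supp bounded_Omega measurable_Omega])
      (use f01 in \<open>auto simp: abs_le_iff intro: order_trans[of _ 0]\<close>)
  have rep: "AE x in lborel. rep_L2 (abs_L2 f) x = f x" by (rule AE_rep_abs[OF sq])
  define g where "g p = (f (fst p) - f (snd p)) / norm (fst p - snd p) powr ((real DIM('a) + 2 * s) / 2)" for p
  have gm: "g \<in> borel_measurable (borel \<Otimes>\<^sub>M borel)" unfolding g_def[abs_def] by measurable
  have bd: "(g (x, y))\<^sup>2 \<le> L\<^sup>2 * (indicator \<Omega> x * riesz_kernel s (x - y)) + L\<^sup>2 * (indicator \<Omega> y * riesz_kernel s (x - y))" for x y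
  proof (cases "x \<notin> \<Omega> \<and> y \<notin> \<Omega>")
    case True
    then show ?thesis using supp by (simp add: g_def)
  next
    case False
    have "(f x - f y)\<^sup>2 \<le> L\<^sup>2 * min 1 ((norm (x - y))\<^sup>2)"
    proof -
      have "\<bar>f x - f y\<bar>\<^sup>2 \<le> (L * norm (x - y))\<^sup>2" using lip by (intro power_mono) auto
      moreover have "\<bar>f x - f y\<bar>\<^sup>2 \<le> L\<^sup>2"
      proof (rule power_mono)
        \<comment> \<open>Values in [0, 1] differ by at most 1 <= L, so one constant serves both
          regimes of the kernel.\<close>
        show "\<bar>f x - f y\<bar> \<le> L" using f01[of x] f01[of y] L by linarith
      qed simp
      ultimately show ?thesis by (simp add: power_mult_distrib min_def)
    qed
    then have "(g (x, y))\<^sup>2 \<le> L\<^sup>2 * riesz_kernel s (x - y)"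
      by (simp add: g_def riesz_kernel_def power_divide power2_eq_square[of "_ powr _"] powr_add[symmetric] divide_right_mono)
    moreover have "0 \<le> L\<^sup>2 * riesz_kernel s (x - y)" by (simp add: riesz_kernel_nonneg)
    moreover have "P \<le> indicator \<Omega> x * k + indicator \<Omega> y * k" if "P \<le> k" "0 \<le> k" for P k :: real
      using that False by (auto simp: indicator_def)
    ultimately have "(g (x, y))\<^sup>2 \<le> indicator \<Omega> x * (L\<^sup>2 * riesz_kernel s (x - y))
        + indicator \<Omega> y * (L\<^sup>2 * riesz_kernel s (x - y))" by blast
    then show ?thesis by (simp only: mult.left_commute)
  qed
  let ?k = "\<integral>\<^sup>+z. ennreal (riesz_kernel s (z :: 'a)) \<partial>lborel"
  have fin: "emeasure lborel \<Omega> < \<infinity>" by (rule emeasure_bounded_finite[OF bounded_Omega])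
  let ?h = "\<lambda>x y. ennreal (L\<^sup>2) * (indicator \<Omega> x * ennreal (riesz_kernel s (x - y)))"
  have hm [measurable]: "(\<lambda>(x, y). ?h x y) \<in> borel_measurable (lborel \<Otimes>\<^sub>M lborel)"
    "(\<lambda>(x, y). ?h y x) \<in> borel_measurable (lborel \<Otimes>\<^sub>M lborel)"
    by measurable
  have I1: "(\<integral>\<^sup>+x. (\<integral>\<^sup>+y. ?h x y \<partial>lborel) \<partial>lborel) = ennreal (L\<^sup>2) * (?k * emeasure lborel \<Omega>)"
    by (simp add: nn_integral_cmult nn_integral_riesz_kernel_translate nn_integral_multc mult.commute)
  have "(\<integral>\<^sup>+p. ennreal ((g p)\<^sup>2) \<partial>(lborel \<Otimes>\<^sub>M lborel))
      \<le> (\<integral>\<^sup>+p. ((\<lambda>(x, y). ?h x y) p + (\<lambda>(x, y). ?h y x) p) \<partial>(lborel \<Otimes>\<^sub>M lborel))"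
  proof (rule nn_integral_mono)
    fix p :: "'a \<times> 'a"
    obtain x y where p: "p = (x, y)" by force
    have "ennreal ((g p)\<^sup>2) \<le> ennreal (L\<^sup>2 * (indicator \<Omega> x * riesz_kernel s (x - y)) + L\<^sup>2 * (indicator \<Omega> y * riesz_kernel s (x - y)))"
      unfolding p by (intro ennreal_leI bd)
    also have "\<dots> = ?h x y + ?h y x"
    proof -
      have "riesz_kernel s (y - x) = riesz_kernel s (x - y)" by (simp add: riesz_kernel_def norm_minus_commute)
      then show ?thesis
        by (simp add: ennreal_plus ennreal_mult'' riesz_kernel_nonneg ennreal_indicator)
    qed
    finally show "ennreal ((g p)\<^sup>2) \<le> (\<lambda>(x, y). ?h x y) p + (\<lambda>(x, y). ?h y x) p" by (simp add: p)
  qed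
  also have "\<dots> = (\<integral>\<^sup>+p. (\<lambda>(x, y). ?h x y) p \<partial>(lborel \<Otimes>\<^sub>M lborel)) + (\<integral>\<^sup>+p. (\<lambda>(x, y). ?h y x) p \<partial>(lborel \<Otimes>\<^sub>M lborel))"
    by (rule nn_integral_add) measurable
  also have "(\<integral>\<^sup>+p. (\<lambda>(x, y). ?h x y) p \<partial>(lborel \<Otimes>\<^sub>M lborel)) = (\<integral>\<^sup>+x. (\<integral>\<^sup>+y. ?h x y \<partial>lborel) \<partial>lborel)"
    by (subst lborel.nn_integral_fst[symmetric]) auto
  also have "(\<integral>\<^sup>+p. (\<lambda>(x, y). ?h y x) p \<partial>(lborel \<Otimes>\<^sub>M lborel)) = (\<integral>\<^sup>+y. (\<integral>\<^sup>+x. ?h y x \<partial>lborel) \<partial>lborel)"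
    by (subst lborel_pair.nn_integral_snd[symmetric]) auto
  also have "(\<integral>\<^sup>+x. (\<integral>\<^sup>+y. ?h x y \<partial>lborel) \<partial>lborel) + (\<integral>\<^sup>+y. (\<integral>\<^sup>+x. ?h y x \<partial>lborel) \<partial>lborel) < \<infinity>"
    unfolding I1 using fin nn_integral_riesz_kernel_finite[OF s_pos s_less, where 'a='a]
    by (simp add: ennreal_mult_less_top)
  finally have "sq_integrable g"
    unfolding sq_integrable_def using gm
    by (simp add: lborel_prod borel_prod integrable_iff_bounded)
  moreover have "AE p in lborel. diff_quot s (abs_L2 f) p = g p"
    using AE_lborel_pair[OF rep] by eventually_elim (simp add: diff_quot_def g_def)
  ultimately have "sq_integrable (diff_quot s (abs_L2 f))"
    by (rule sq_integrable_cong_AE[OF _ measurable_diff_quot])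
  moreover have "abs_L2 f \<in> L2_on \<Omega>"
    unfolding L2_on_iff using rep by eventually_elim (use supp in auto)
  ultimately show "abs_L2 f \<in> H0s \<Omega> s" by (simp add: H0s_eq frac_sobolev_iff)
qed

text \<open>The cutoffs min 1 ((n+1) d), with d the distance to the complement of \<open>U\<close>,
  are Lipschitz, vanish outside \<open>U\<close> and converge to its indicator; each is an
  admissible test function.\<close>

lemma integral_open_zero:
  assumes f: "f \<in> L2_on \<Omega>" and orth: "\<And>v. v \<in> H0s \<Omega> s \<Longrightarrow> inner f v = 0"
    and U: "open U" "U \<subseteq> \<Omega>"
  shows "(LINT x|lborel. rep_L2 f x * indicator U x) = 0"
proof (cases "U = {}")
  case False
  note [measurable] = measurable_Omega borel_open[OF U(1)]
  \<comment> \<open>The distance to the empty set is 0 by convention, which would make the cutoffs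
    vanish; boundedness of \<open>U\<close> excludes that case.\<close>
  have "- U \<noteq> {}" using U bounded_Omega by (metis bounded_subset Compl_empty_eq double_compl not_bounded_UNIV)
  have cl: "closed (- U)" by (intro closed_Compl U(1))
  define g where "g n x = min 1 (real (Suc n) * infdist x (- U))" for n x
  have cont: "continuous_on UNIV (g n)" for n unfolding g_def by (intro continuous_intros)
  have gm [measurable]: "g n \<in> borel_measurable borel" for n
    using cont by (rule borel_measurable_continuous_onI)
  have g0: "g n x = 0" if "x \<notin> U" for n x using that by (simp add: g_def)
  have g01: "0 \<le> g n x" "g n x \<le> 1" for n x by (auto simp: g_def infdist_nonneg)
  have lip: "\<bar>g n x - g n y\<bar> \<le> real (Suc n) * norm (x - y)" for n x y
  proof -
    have "\<bar>infdist x (- U) - infdist y (- U)\<bar> \<le> norm (x - y)"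
      using infdist_triangle_abs[of x "- U" y] by (simp add: dist_norm)
    then have "real (Suc n) * \<bar>infdist x (- U) - infdist y (- U)\<bar> \<le> real (Suc n) * norm (x - y)"
      by (intro mult_left_mono) auto
    moreover have "\<bar>g n x - g n y\<bar> \<le> \<bar>real (Suc n) * infdist x (- U) - real (Suc n) * infdist y (- U)\<bar>"
    proof -
      have "\<bar>min 1 a - min 1 b\<bar> \<le> \<bar>a - b\<bar>" for a b :: real by (auto simp: min_def abs_if)
      then show ?thesis unfolding g_def .
    qed
    moreover have "\<bar>real (Suc n) * infdist x (- U) - real (Suc n) * infdist y (- U)\<bar>
        = real (Suc n) * \<bar>infdist x (- U) - infdist y (- U)\<bar>"
      by (simp only: right_diff_distrib[symmetric] abs_mult abs_of_nat)
    ultimately show ?thesis by linarith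
  qed
  have sqg: "sq_integrable (g n)" and gH: "abs_L2 (g n) \<in> H0s \<Omega> s" for n
    using lipschitz_in_H0s[OF g01 _ lip _ gm, of n] g0 U(2) by (auto simp: subset_iff)
  have "(LINT x|lborel. rep_L2 f x * g n x) = 0" for n
  proof -
    have "inner f (abs_L2 (g n)) = (LINT x|lborel. rep_L2 f x * g n x)"
      using inner_abs[OF sq_integrable_rep[of f] sqg[of n]] by (simp add: abs_rep)
    then show ?thesis using orth[OF gH] by simp
  qed
  moreover have "(\<lambda>n. LINT x|lborel. rep_L2 f x * g n x) \<longlonglongrightarrow> (LINT x|lborel. rep_L2 f x * indicator U x)"
  proof (rule integral_dominated_convergence[where w="\<lambda>x. \<bar>rep_L2 f x * indicator \<Omega> x\<bar>"])
    have "sq_integrable (indicator \<Omega> :: 'a \<Rightarrow> real)"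
      by (rule sq_integrable_bounded_support[OF _ _ _ bounded_Omega measurable_Omega])
        (auto simp: indicator_def)
    then show "integrable lborel (\<lambda>x. \<bar>rep_L2 f x * indicator \<Omega> x\<bar>)"
      using sq_integrable_mult[OF sq_integrable_rep] by (intro integrable_abs) auto
    show "AE x in lborel. (\<lambda>n. rep_L2 f x * g n x) \<longlonglongrightarrow> rep_L2 f x * indicator U x"
    proof (intro AE_I2 tendsto_mult tendsto_const)
      fix x
      show "(\<lambda>n. g n x) \<longlonglongrightarrow> indicator U x"
      proof (cases "x \<in> U")
        case True
        then have pos: "infdist x (- U) > 0"
          using infdist_pos_not_in_closed[OF cl \<open>- U \<noteq> {}\<close>, of x] by simp
        then obtain k :: nat where k: "1 < real k * infdist x (- U)"
          using reals_Archimedean3 by blast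
        have "\<forall>\<^sub>F n in sequentially. g n x = 1"
          unfolding eventually_sequentially
        proof (intro exI[of _ k] allI impI)
          fix n assume "k \<le> n"
          then have "real k * infdist x (- U) \<le> real (Suc n) * infdist x (- U)"
            using pos by (intro mult_right_mono) auto
          then show "g n x = 1" using k by (simp add: g_def)
        qed
        then show ?thesis using True by (simp add: tendsto_eventually)
      next
        case False
        then show ?thesis using g0 by simp
      qed
    qed
    show "AE x in lborel. norm (rep_L2 f x * g n x) \<le> \<bar>rep_L2 f x * indicator \<Omega> x\<bar>" for n
    proof (rule AE_I2)
      fix x
      show "norm (rep_L2 f x * g n x) \<le> \<bar>rep_L2 f x * indicator \<Omega> x\<bar>"
      proof (cases "x \<in> U")
        case True
        then have "x \<in> \<Omega>" using U by blast
        then show ?thesis using g01[of n x] by (simp add: abs_mult mult_left_le)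
      next
        case False
        then show ?thesis using g0 by simp
      qed
    qed
  qed measurable
  ultimately show ?thesis by (simp add: LIMSEQ_const_iff)
qed simp

text \<open>The positive and negative parts of f on \<Omega> are densities of finite measures that
  agree on open sets, an intersection-stable generator. The measures coincide, hence so do the
  densities almost everywhere.\<close>

lemma H0s_dense:
  assumes f: "f \<in> L2_on \<Omega>" and orth: "\<And>v. v \<in> H0s \<Omega> s \<Longrightarrow> inner f v = 0"
  shows "f = 0"
proof -
  note [measurable] = measurable_Omega
  define h where "h x = rep_L2 f x * indicator \<Omega> x" for x
  have [measurable]: "h \<in> borel_measurable borel" unfolding h_def[abs_def] by measurable
  have "sq_integrable (indicator \<Omega> :: 'a \<Rightarrow> real)"
    by (rule sq_integrable_bounded_support[OF _ _ _ bounded_Omega measurable_Omega])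
      (auto simp: indicator_def)
  then have hi: "integrable lborel h"
    using sq_integrable_mult[OF sq_integrable_rep] unfolding h_def[abs_def] by blast
  have zero: "(LINT x|lborel. h x * indicator U x) = 0" if "open U" for U
  proof -
    have "(\<lambda>x. h x * indicator U x) = (\<lambda>x. rep_L2 f x * indicator (U \<inter> \<Omega>) x)"
      by (auto simp: h_def indicator_def)
    then show ?thesis using integral_open_zero[OF f orth, of "U \<inter> \<Omega>"] open_Int[OF that open_Omega] by simp
  qed
  define M1 where "M1 = density lborel (\<lambda>x. ennreal (max 0 (h x)))"
  define M2 where "M2 = density lborel (\<lambda>x. ennreal (max 0 (- h x)))"
  have ip: "integrable lborel (\<lambda>x. max 0 (h x) * indicator U x)" "integrable lborel (\<lambda>x. max 0 (- h x) * indicator U x)"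
    if [measurable]: "U \<in> sets borel" for U
    by (rule Bochner_Integration.integrable_bound[OF hi], measurable, auto simp: indicator_def)+
  have em: "emeasure M1 U = ennreal (LINT x|lborel. max 0 (h x) * indicator U x)"
    "emeasure M2 U = ennreal (LINT x|lborel. max 0 (- h x) * indicator U x)"
    if [measurable]: "U \<in> sets borel" for U
    unfolding M1_def M2_def
    by (subst emeasure_density; simp flip: nn_integral_eq_integral[OF ip(1)[OF that]] nn_integral_eq_integral[OF ip(2)[OF that]];
      intro nn_integral_cong; simp add: indicator_def)+
  have "M1 = M2"
  proof (rule measure_eqI_generator_eq[where E="{U. open U}" and \<Omega>=UNIV and A="\<lambda>_. UNIV"])
    show "Int_stable {U :: 'a set. open U}" by (auto simp: Int_stable_def)
    fix U :: "'a set" assume "U \<in> {U. open U}"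
    then have U: "open U" "U \<in> sets borel" by auto
    have "(LINT x|lborel. max 0 (h x) * indicator U x) - (LINT x|lborel. max 0 (- h x) * indicator U x)
        = (LINT x|lborel. max 0 (h x) * indicator U x - max 0 (- h x) * indicator U x)"
      using ip[OF U(2)] by simp
    also have "(\<lambda>x. max 0 (h x) * indicator U x - max 0 (- h x) * indicator U x) = (\<lambda>x. h x * indicator U x)"
      by (auto simp: indicator_def max_def)
    finally show "emeasure M1 U = emeasure M2 U" using zero[OF U(1)] em[OF U(2)] by simp
  next
    show "sets M1 = sigma_sets UNIV {U. open U}" "sets M2 = sigma_sets UNIV {U. open U}"
      by (auto simp: M1_def M2_def borel_def)
    show "emeasure M1 UNIV \<noteq> \<infinity>" by (simp add: em)
  qed auto
  then have "AE x in lborel. ennreal (max 0 (h x)) = ennreal (max 0 (- h x))"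
    unfolding M1_def M2_def 
    by (intro sigma_finite_measure.density_unique[OF lborel.sigma_finite_measure_axioms]) auto
  then have "AE x in lborel. rep_L2 f x = rep_L2 0 x"
    using f[unfolded L2_on_iff] AE_rep_zero
  proof eventually_elim
    case (elim x)
    from elim(1) have "max 0 (h x) = max 0 (- h x)" by (subst (asm) ennreal_inj) auto
    then have "h x = 0" by (auto simp: max_def split: if_splits)
    then show ?case using elim by (auto simp: h_def indicator_def split: if_splits)
  qed
  then show ?thesis by (rule L2_eqI)
qed

section \<open>The operator of the fractional Dirichlet form\<close>

lemma A_op_iff: "(u, f) \<in> A_op \<Omega> s \<longleftrightarrow> u \<in> H0s \<Omega> s \<and> f \<in> L2_on \<Omega> \<and>
    (\<forall>v\<in>H0s \<Omega> s. dirichlet_form \<Omega> s u v = inner f v)"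
  by (simp add: A_op_def)

text \<open>The case k = 1 gives surjectivity of I + A, the case k = 0 the inverse of A. The added
  term is dominated by k times the form, so completeness persists.\<close>

lemma resolvent_exists:
  assumes f: "f \<in> L2_on \<Omega>" and k: "0 \<le> k"
  obtains u where "u \<in> H0s \<Omega> s" "\<And>v. v \<in> H0s \<Omega> s \<Longrightarrow> dirichlet_form \<Omega> s u v + k * inner u v = inner f v"
proof -
  interpret b: semi_form "H0s \<Omega> s" "\<lambda>u v. dirichlet_form \<Omega> s u v + k * inner u v"
  proof
    show "dirichlet_form \<Omega> s x y + k * inner x y = dirichlet_form \<Omega> s y x + k * inner y x"
      if "x \<in> H0s \<Omega> s" "y \<in> H0s \<Omega> s" for x y
      using a.sym[OF that] by (simp add: inner_commute)
  qed (use k a.nonneg in \<open>simp_all add: a.add a.scale inner_add_left algebra_simps subspace_H0s\<close>)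
  have "b.form_complete"
    unfolding b.form_complete_def
  proof (intro allI impI)
    fix g :: "nat \<Rightarrow> 'a L2"
    let ?d = "\<lambda>x. dirichlet_form \<Omega> s x x"
    assume g: "\<forall>n. g n \<in> H0s \<Omega> s"
      and cau: "\<forall>e>0. \<exists>N. \<forall>m\<ge>N. \<forall>n\<ge>N. ?d (g m - g n) + k * inner (g m - g n) (g m - g n) < e"
    have le: "?d x \<le> ?d x + k * inner x x" for x using k by simp
    obtain x where x: "x \<in> H0s \<Omega> s" "(\<lambda>n. ?d (g n - x)) \<longlonglongrightarrow> 0"
    proof (rule a.form_completeD[OF form_complete])
      show "g n \<in> H0s \<Omega> s" for n using g by blast
      fix e :: real assume "e > 0"
      with cau obtain N where "\<forall>m\<ge>N. \<forall>n\<ge>N. ?d (g m - g n) + k * inner (g m - g n) (g m - g n) < e" by blast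
      then show "\<exists>N. \<forall>m\<ge>N. \<forall>n\<ge>N. ?d (g m - g n) < e" using le by (meson order_le_less_trans)
    qed (use that in blast)
    have "(\<lambda>n. (1 + k) * ?d (g n - x)) \<longlonglongrightarrow> 0" using tendsto_mult_right_zero[OF x(2)] .
    then have "(\<lambda>n. ?d (g n - x) + k * inner (g n - x) (g n - x)) \<longlonglongrightarrow> 0"
    proof (rule Lim_null_comparison[rotated], intro always_eventually allI)
      fix n
      have gx: "g n - x \<in> H0s \<Omega> s" using g x by simp
      have "k * inner (g n - x) (g n - x) \<le> k * ?d (g n - x)"
        using inner_le_form[OF gx] k by (intro mult_left_mono)
      then show "norm (?d (g n - x) + k * inner (g n - x) (g n - x)) \<le> (1 + k) * ?d (g n - x)"
        using b.nonneg[OF gx] by (simp add: distrib_right)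
    qed
    then show "\<exists>x\<in>H0s \<Omega> s. (\<lambda>n. ?d (g n - x) + k * inner (g n - x) (g n - x)) \<longlonglongrightarrow> 0" using x by blast
  qed
  then show ?thesis
  proof (rule b.riesz[of "inner f" "norm f"])
    fix v assume v: "v \<in> H0s \<Omega> s"
    have "\<bar>inner f v\<bar> \<le> norm f * norm v" by (rule Cauchy_Schwarz_ineq2)
    also have "\<dots> \<le> norm f * sqrt (dirichlet_form \<Omega> s v v + k * inner v v)"
      unfolding norm_eq_sqrt_inner[of v] using inner_le_form[OF v] k
      by (intro mult_left_mono real_sqrt_le_mono add_increasing2) auto
    finally show "\<bar>inner f v\<bar> \<le> norm f * sqrt (dirichlet_form \<Omega> s v v + k * inner v v)" .
  qed (use that in \<open>auto simp: inner_add_right\<close>)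
qed

sublocale A: positive_selfadjoint "L2_on \<Omega>" "A_op \<Omega> s"
proof
  fix x y x' y' f r
  show "x \<in> L2_on \<Omega>" "y \<in> L2_on \<Omega>" if "(x, y) \<in> A_op \<Omega> s"
    using that H0s_L2_on by (auto simp: A_op_iff)
  show "(x + x', y + y') \<in> A_op \<Omega> s" if "(x, y) \<in> A_op \<Omega> s" "(x', y') \<in> A_op \<Omega> s"
    using that by (auto simp: A_op_iff a.add inner_add_left)
  show "(r *\<^sub>R x, r *\<^sub>R y) \<in> A_op \<Omega> s" if "(x, y) \<in> A_op \<Omega> s"
    using that by (auto simp: A_op_iff a.scale)
  show "inner y x' = inner x y'" if "(x, y) \<in> A_op \<Omega> s" "(x', y') \<in> A_op \<Omega> s"
    using that a.sym[of x x'] by (auto simp: A_op_iff inner_commute[of x])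
  show "0 \<le> inner y x" if "(x, y) \<in> A_op \<Omega> s"
  proof -
    have x: "x \<in> H0s \<Omega> s" and "dirichlet_form \<Omega> s x x = inner y x" using that by (auto simp: A_op_iff)
    then show ?thesis using a.nonneg[OF x] by simp
  qed
  show "\<exists>x y. (x, y) \<in> A_op \<Omega> s \<and> x + y = f" if f: "f \<in> L2_on \<Omega>"
  proof -
    obtain u where u: "u \<in> H0s \<Omega> s"
      "\<And>v. v \<in> H0s \<Omega> s \<Longrightarrow> dirichlet_form \<Omega> s u v + 1 * inner u v = inner f v"
      using resolvent_exists[OF f, of 1] by auto
    have "dirichlet_form \<Omega> s u v = inner (f - u) v" if "v \<in> H0s \<Omega> s" for v
      using u(2)[OF that] by (simp add: inner_diff_left)
    then have "(u, f - u) \<in> A_op \<Omega> s" using u f H0s_L2_on by (auto simp: A_op_iff)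
    then show ?thesis by (intro exI[of _ u] exI[of _ "f - u"]) auto
  qed
  show "y = 0" if "(0, y) \<in> A_op \<Omega> s"
  proof (rule H0s_dense)
    show "inner y v = 0" if "v \<in> H0s \<Omega> s" for v
      using \<open>(0, y) \<in> A_op \<Omega> s\<close> that a.scale[of v v 0] a.scale[of 0 v 0] by (auto simp: A_op_iff)
  qed (use that in \<open>auto simp: A_op_iff\<close>)
qed

end

section \<open>Tikhonov regularization in a Hilbert space\<close>

text \<open>Weighted Young inequality for p = t/\<beta> and q = \<alpha>/(1-\<beta>), whose convex
  combination with weights \<beta> and 1-\<beta> is exactly \<alpha> + t. Undoing the normalization
  produces the constant \<beta>^\<beta> (1-\<beta>)^(1-\<beta>).\<close>

lemma filter_bound:
  assumes b: "0 < \<beta>" "\<beta> \<le> 1" and a: "0 < \<alpha>" and t: "0 \<le> t"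
  shows "\<alpha> * t powr \<beta> / (\<alpha> + t) \<le> c_const \<beta> * \<alpha> powr \<beta>"
proof (cases "\<beta> = 1 \<or> t = 0")
  case True
  then show ?thesis
  proof
    assume "\<beta> = 1"
    then show ?thesis using a t by (simp add: c_const_def field_simps)
  next
    assume "t = 0"
    then show ?thesis using a b by (simp add: c_const_def)
  qed
next
  case False
  then have b1: "\<beta> < 1" and t0: "0 < t" using b t by auto
  define p q where "p = t / \<beta>" and "q = \<alpha> / (1 - \<beta>)"
  have pq: "0 < p" "0 < q" using b b1 t0 a by (auto simp: p_def q_def)
  have "p powr \<beta> * q powr (1 - \<beta>) \<le> \<beta> * p + (1 - \<beta>) * q"
    using b b1 pq by (intro Youngs_inequality_0) auto
  also have "\<dots> = \<alpha> + t" using b b1 by (simp add: p_def q_def)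
  finally have "t powr \<beta> * \<alpha> powr (1 - \<beta>) \<le> (\<alpha> + t) * (\<beta> powr \<beta> * (1 - \<beta>) powr (1 - \<beta>))"
    using b b1 t0 a by (simp add: p_def q_def powr_divide divide_simps mult.commute)
  then have "t powr \<beta> * \<alpha> powr (1 - \<beta>) * \<alpha> powr \<beta> \<le> (\<alpha> + t) * c_const \<beta> * \<alpha> powr \<beta>"
    using b1 by (intro mult_right_mono) (auto simp: c_const_def)
  moreover have "t powr \<beta> * \<alpha> powr (1 - \<beta>) * \<alpha> powr \<beta> = \<alpha> * t powr \<beta>"
    using a by (simp add: mult.assoc powr_add[symmetric])
  ultimately have "\<alpha> * t powr \<beta> \<le> (c_const \<beta> * \<alpha> powr \<beta>) * (\<alpha> + t)" by (simp only: mult_ac)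
  then show ?thesis using a t0 by (subst pos_divide_le_eq) auto
qed

locale hilbert_operator = hilbert H for H :: "'h::real_inner set" +
  fixes B :: "'h \<Rightarrow> 'h"
  assumes bounded_B: "bounded_linear_between H norm H norm B"
begin

lemma B_in [simp]: "x \<in> H \<Longrightarrow> B x \<in> H"
  and B_add: "x \<in> H \<Longrightarrow> y \<in> H \<Longrightarrow> B (x + y) = B x + B y"
  and B_scale: "x \<in> H \<Longrightarrow> B (c *\<^sub>R x) = c *\<^sub>R B x"
  using bounded_B unfolding bounded_linear_between_def by (simp_all add: image_subset_iff)

lemma B_bound: obtains C where "0 \<le> C" "\<And>x. x \<in> H \<Longrightarrow> norm (B x) \<le> C * norm x"
proof -
  obtain C where C: "\<And>x. x \<in> H \<Longrightarrow> norm (B x) \<le> C * norm x"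
    using bounded_B unfolding bounded_linear_between_def by blast
  have "norm (B x) \<le> \<bar>C\<bar> * norm x" if "x \<in> H" for x
    by (rule order_trans[OF C[OF that] mult_right_mono[OF abs_ge_self norm_ge_zero]])
  then show ?thesis using that[of "\<bar>C\<bar>"] by simp
qed

abbreviation Bs :: "'h \<Rightarrow> 'h" where "Bs \<equiv> adjoint_on H B"

lemma
  assumes y: "y \<in> H"
  shows Bs_in [simp]: "Bs y \<in> H" and inner_Bs: "x \<in> H \<Longrightarrow> inner (B x) y = inner x (Bs y)"
proof -
  obtain C where C: "0 \<le> C" "\<And>x. x \<in> H \<Longrightarrow> norm (B x) \<le> C * norm x" using B_bound by blast
  have "\<bar>inner (B v) y\<bar> \<le> (C * norm y) * norm v" if "v \<in> H" for v
  proof -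
    have "\<bar>inner (B v) y\<bar> \<le> norm (B v) * norm y" by (rule Cauchy_Schwarz_ineq2)
    also have "\<dots> \<le> (C * norm v) * norm y" using C that by (intro mult_right_mono) auto
    finally show ?thesis by (simp add: mult_ac)
  qed
  then obtain z where z: "z \<in> H" "\<And>v. v \<in> H \<Longrightarrow> inner z v = inner (B v) y"
    using riesz[of "\<lambda>v. inner (B v) y" "C * norm y"] by (auto simp: B_add B_scale inner_add_left)
  have "Bs y = z"
    unfolding adjoint_on_def
  proof (rule the_equality)
    show "z \<in> H \<and> (\<forall>x\<in>H. inner (B x) y = inner x z)" using z by (simp add: inner_commute)
    show "z' = z" if "z' \<in> H \<and> (\<forall>x\<in>H. inner (B x) y = inner x z')" for z'
      using that z by (intro eqI) (auto simp: inner_commute)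
  qed
  then show "Bs y \<in> H" "x \<in> H \<Longrightarrow> inner (B x) y = inner x (Bs y)"
    using z by (auto simp: inner_commute)
qed

lemma Bs_add: "x \<in> H \<Longrightarrow> y \<in> H \<Longrightarrow> Bs (x + y) = Bs x + Bs y"
  by (rule eqI) (auto simp: inner_commute[of "Bs _"] inner_commute[of "_ + _"] inner_add_right inner_Bs[symmetric])

lemma Bs_scale: "x \<in> H \<Longrightarrow> Bs (r *\<^sub>R x) = r *\<^sub>R Bs x"
  by (rule eqI) (auto simp: inner_commute[of "Bs _"] inner_commute[of "_ *\<^sub>R _"] inner_Bs[symmetric])

abbreviation BB :: "('h \<times> 'h) set" where "BB \<equiv> graph_on H (\<lambda>f. Bs (B f))"

sublocale BB: positive_selfadjoint H BB
proof
  fix x y x' y' f r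
  show "x \<in> H" "y \<in> H" if "(x, y) \<in> BB" using that by (auto simp: graph_on_def)
  show "(x + x', y + y') \<in> BB" if "(x, y) \<in> BB" "(x', y') \<in> BB"
    using that by (auto simp: graph_on_def B_add Bs_add)
  show "(r *\<^sub>R x, r *\<^sub>R y) \<in> BB" if "(x, y) \<in> BB"
    using that by (auto simp: graph_on_def B_scale Bs_scale)
  show "inner y x' = inner x y'" if "(x, y) \<in> BB" "(x', y') \<in> BB"
    using that inner_Bs[of "B x" x'] inner_Bs[of "B x'" x] by (auto simp: graph_on_def inner_commute)
  show "0 \<le> inner y x" if "(x, y) \<in> BB"
  proof -
    have x: "x \<in> H" "y = Bs (B x)" using that by (auto simp: graph_on_def)
    then have "inner y x = inner (B x) (B x)" using inner_Bs[of "B x" x] by (simp add: inner_commute)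
    then show ?thesis by simp
  qed
  show "y = 0" if "(0, y) \<in> BB"
    using that B_scale[of 0 0] Bs_scale[of 0 0] by (auto simp: graph_on_def)
  show "\<exists>x y. (x, y) \<in> BB \<and> x + y = f" if f: "f \<in> H"
  proof -
    obtain C where C: "0 \<le> C" "\<And>x. x \<in> H \<Longrightarrow> norm (B x) \<le> C * norm x" using B_bound by blast
    let ?a = "\<lambda>x v. inner x v + inner (B x) (B v)"
    \<comment> \<open>Surjectivity of I + B^*B: the form <x, v> + <B x, B v> lies between |x|^2 and
      (1 + C^2) |x|^2 on the diagonal, so Riesz applies.\<close>
    have sf: "semi_form H ?a"
    proof
      show "?a x y = ?a y x" for x y by (simp add: inner_commute)
    qed (simp_all add: subH inner_add_left B_add B_scale algebra_simps)
    have up: "?a x x \<le> (1 + C\<^sup>2) * inner x x" if "x \<in> H" for x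
    proof -
      have "(norm (B x))\<^sup>2 \<le> (C * norm x)\<^sup>2" using C that by (intro power_mono) auto
      then show ?thesis by (simp add: power_mult_distrib power2_norm_eq_inner distrib_right)
    qed
    obtain u where u: "u \<in> H" "\<And>v. v \<in> H \<Longrightarrow> ?a u v = inner f v"
      by (rule riesz_dominating_form[OF sf _ up, of "inner f" "norm f"])
        (auto simp: inner_add_right Cauchy_Schwarz_ineq2)
    have "u + Bs (B u) = f"
    proof (rule eqI)
      show "inner (u + Bs (B u)) v = inner f v" if "v \<in> H" for v
      proof -
        have "inner (Bs (B u)) v = inner (B u) (B v)"
          using inner_Bs[of "B u" v] u(1) that by (simp add: inner_commute)
        then show ?thesis using u(2)[OF that] by (simp add: inner_add_left)
      qed
    qed (use u f in auto)
    then show ?thesis using u by (intro exI[of _ u] exI[of _ "Bs (B u)"]) (auto simp: graph_on_def)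
  qed
qed

section \<open>Spectral calculus of B^*B and the regularized inverse\<close>

abbreviation EB :: "real \<Rightarrow> 'h \<Rightarrow> 'h" where "EB \<equiv> spectral_family_of H BB"

sublocale EB: spectral H EB
  by unfold_locales (rule BB.spectral_family_of(1))

lemma BB_SI: "x \<in> H \<Longrightarrow> (x, Bs (B x)) \<in> EB.SI (\<lambda>t. t)"
  using BB.spectral_family_of(2) by (auto simp: graph_on_def)

lemma EB_nonneg:
  assumes "x \<in> H" shows "AE t in EB.m x. 0 \<le> t"
proof (rule EB.SI_id_lower_bound[OF _ assms])
  show "0 * inner x x \<le> inner y x" if "(x, y) \<in> EB.SI (\<lambda>t. t)" for x y
    using that BB.T_pos unfolding BB.spectral_family_of(2)[symmetric] by simp
qed

text \<open>\<open>B\<^sup>*B\<close> is defined everywhere, so every spectral measure integrates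
  t^2, and t^\<beta> <= max 1 t. Hence every w lies in the domain of the power and
  \<open>op_apply\<close> has a genuine value.\<close>

lemma powr_SI:
  assumes w: "w \<in> H" and b: "0 < \<beta>" "\<beta> \<le> 1"
  shows "(w, op_apply (op_powr H BB \<beta>) w) \<in> EB.SI (\<lambda>t. t powr \<beta>)"
proof -
  have "(w, Bs (B w)) \<in> EB.SI (\<lambda>t. t)" using w by (rule BB_SI)
  then have int: "integrable (EB.m w) (\<lambda>t. t\<^sup>2)" by (auto simp: EB.SI_iff spectral_dom_def)
  have "integrable (EB.m w) (\<lambda>t. (t powr \<beta>)\<^sup>2)"
  proof (rule Bochner_Integration.integrable_bound)
    show "integrable (EB.m w) (\<lambda>t. 1 + t\<^sup>2)" using int w by auto
    show "AE t in EB.m w. norm ((t powr \<beta>)\<^sup>2) \<le> norm (1 + t\<^sup>2)"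
      using EB_nonneg[OF w]
    proof eventually_elim
      case (elim t)
      have "t powr \<beta> \<le> max 1 t"
      proof (cases "t \<le> 1")
        case True
        then show ?thesis using elim b powr_mono2[of \<beta> t 1] by simp
      next
        case False
        then show ?thesis using b powr_mono[of \<beta> 1 t] by simp
      qed
      then have "(t powr \<beta>)\<^sup>2 \<le> (max 1 t)\<^sup>2" by (intro power_mono) auto
      also have "\<dots> \<le> 1 + t\<^sup>2" by (auto simp: max_def)
      finally show ?case by simp
    qed
  qed measurable
  then have "w \<in> EB.dom (\<lambda>t. t powr \<beta>)" using w by (simp add: spectral_dom_def)
  then obtain y where y: "(w, y) \<in> EB.SI (\<lambda>t. t powr \<beta>)" using EB.SI_exists[of "\<lambda>t. t powr \<beta>"] by auto
  then show ?thesis using EB.op_apply_SI[OF _ y] by (simp add: op_powr_def)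
qed

text \<open>Symbol of (B^*B + \<alpha>)^-1, set to 0 on the negative half-line to be bounded on all
  of the line; the spectral measures do not charge that part.\<close>

definition filt :: "real \<Rightarrow> real \<Rightarrow> real" where
  "filt \<alpha> t = (if t < 0 then 0 else 1 / (\<alpha> + t))"

lemma bounded_borel_filt [simp]: "0 < \<alpha> \<Longrightarrow> bounded_borel (filt \<alpha>)"
  by (rule bounded_borelI[of _ "1 / \<alpha>"]) (auto simp: filt_def[abs_def] frac_le)

lemma bounded_borel_id_filt [simp]: "0 < \<alpha> \<Longrightarrow> bounded_borel (\<lambda>t. t * filt \<alpha> t)"
  by (rule bounded_borelI[of _ 1]) (auto simp: filt_def[abs_def])

definition Rs :: "real \<Rightarrow> 'h \<Rightarrow> 'h" where "Rs \<alpha> = EB.Phi (filt \<alpha>)"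

context
  fixes \<alpha> :: real
  assumes a: "0 < \<alpha>"
begin

lemma Rs_in [simp]: "x \<in> H \<Longrightarrow> Rs \<alpha> x \<in> H"
  using a by (simp add: Rs_def)

lemma Rs_add: "x \<in> H \<Longrightarrow> y \<in> H \<Longrightarrow> Rs \<alpha> (x + y) = Rs \<alpha> x + Rs \<alpha> y"
  using a by (simp add: Rs_def EB.Phi_add)

lemma Rs_scale: "x \<in> H \<Longrightarrow> Rs \<alpha> (r *\<^sub>R x) = r *\<^sub>R Rs \<alpha> x"
  using a by (simp add: Rs_def EB.Phi_scale)

text \<open>The symbols 1 - \<alpha> \<open>filt\<close> and t \<open>filt\<close> agree for t >= 0,
  hence almost everywhere.\<close>

lemma Rs_left: "x \<in> H \<Longrightarrow> Rs \<alpha> (Bs (B x) + \<alpha> *\<^sub>R x) = x"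
proof -
  assume x: "x \<in> H"
  have 1: "Rs \<alpha> (Bs (B x)) = EB.Phi (\<lambda>t. t * filt \<alpha> t) x"
    unfolding Rs_def using a x BB_SI by (intro EB.SI_Phi) auto
  have "x - \<alpha> *\<^sub>R Rs \<alpha> x = EB.Phi (\<lambda>t. 1 - \<alpha> * filt \<alpha> t) x"
  proof -
    have "\<alpha> *\<^sub>R Rs \<alpha> x = EB.Phi (\<lambda>t. \<alpha> * filt \<alpha> t) x"
      unfolding Rs_def using a x by (simp add: EB.Phi_fun_scale)
    then show ?thesis using a x by (simp add: EB.Phi_fun_diff EB.Phi_one)
  qed
  also have "\<dots> = EB.Phi (\<lambda>t. t * filt \<alpha> t) x"
  proof (rule EB.Phi_cong_AE)
    show "AE t in EB.m x. 1 - \<alpha> * filt \<alpha> t = t * filt \<alpha> t"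
      using EB_nonneg[OF x] by eventually_elim (use a in \<open>auto simp: filt_def field_simps\<close>)
  qed (use a x in auto)
  finally have "Rs \<alpha> (Bs (B x)) = x - \<alpha> *\<^sub>R Rs \<alpha> x" using 1 by simp
  then show ?thesis using x by (simp add: Rs_add Rs_scale)
qed

text \<open>Follows from the left inverse by symmetry of both factors, tested against v.\<close>

lemma Rs_right: "x \<in> H \<Longrightarrow> Bs (B (Rs \<alpha> x)) + \<alpha> *\<^sub>R Rs \<alpha> x = x"
proof (rule eqI)
  fix v assume x: "x \<in> H" and v: "v \<in> H"
  have sym: "inner (Bs (B (Rs \<alpha> x))) v = inner (Rs \<alpha> x) (Bs (B v))"
    using inner_Bs[of "B (Rs \<alpha> x)" v] inner_Bs[of "B v" "Rs \<alpha> x"] x v by (simp add: inner_commute)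
  have "inner (Bs (B (Rs \<alpha> x)) + \<alpha> *\<^sub>R Rs \<alpha> x) v = inner (Rs \<alpha> x) (Bs (B v) + \<alpha> *\<^sub>R v)"
    by (simp add: inner_add_left inner_add_right sym)
  also have "\<dots> = inner x (Rs \<alpha> (Bs (B v) + \<alpha> *\<^sub>R v))"
    unfolding Rs_def using a x v by (intro EB.Phi_sym) auto
  finally show "inner (Bs (B (Rs \<alpha> x)) + \<alpha> *\<^sub>R Rs \<alpha> x) v = inner x v" using v by (simp add: Rs_left)
qed (use a in auto)

lemma bias_bound:
  assumes w: "w \<in> H" and b: "0 < \<beta>" "\<beta> \<le> 1"
  shows "(norm (\<alpha> *\<^sub>R Rs \<alpha> (op_apply (op_powr H BB \<beta>) w)))\<^sup>2 \<le> (c_const \<beta> * \<alpha> powr \<beta>)\<^sup>2 * (norm w)\<^sup>2"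
proof -
  define y where "y = op_apply (op_powr H BB \<beta>) w"
  have wy: "(w, y) \<in> EB.SI (\<lambda>t. t powr \<beta>)" unfolding y_def by (rule powr_SI[OF w b])
  \<comment> \<open>The filter bound without its factor \<alpha>, hence the division by \<alpha>;
    the factor in front of \<open>Rs\<close> restores it.\<close>
  have bd: "\<bar>t powr \<beta> * filt \<alpha> t\<bar> \<le> c_const \<beta> * \<alpha> powr \<beta> / \<alpha>" for t
    using filter_bound[OF b a, of t] a by (auto simp: filt_def c_const_def field_simps)
  have bb: "bounded_borel (\<lambda>t. t powr \<beta> * filt \<alpha> t)"
    by (rule bounded_borelI[OF _ bd]) (use bounded_borel_measurable[OF bounded_borel_filt[OF a]] in measurable)
  have "Rs \<alpha> y = EB.Phi (\<lambda>t. t powr \<beta> * filt \<alpha> t) w"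
    unfolding Rs_def using a by (intro EB.SI_Phi[OF _ wy _ bb]) auto
  then have "inner (Rs \<alpha> y) (Rs \<alpha> y) = EB.Q (\<lambda>t. (t powr \<beta> * filt \<alpha> t)\<^sup>2) w"
    by (simp add: EB.norm_Phi[OF bb w])
  also have "\<dots> \<le> (c_const \<beta> * \<alpha> powr \<beta> / \<alpha>)\<^sup>2 * inner w w"
  proof -
    have "\<bar>(t powr \<beta> * filt \<alpha> t)\<^sup>2\<bar> \<le> (c_const \<beta> * \<alpha> powr \<beta> / \<alpha>)\<^sup>2" for t
      using power_mono[OF bd[of t], of 2] by simp
    then show ?thesis
      using EB.Q_bound[OF w bounded_borel_measurable[OF bounded_borel_power2[OF bb]]] abs_le_D1 by blast
  qed
  finally have "\<alpha>\<^sup>2 * inner (Rs \<alpha> y) (Rs \<alpha> y) \<le> \<alpha>\<^sup>2 * ((c_const \<beta> * \<alpha> powr \<beta> / \<alpha>)\<^sup>2 * inner w w)"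
    by (rule mult_left_mono) simp
  then show ?thesis
    using a by (simp add: y_def[symmetric] power_mult_distrib power2_norm_eq_inner power_divide)
qed

text \<open>Testing the normal equation with its solution x gives |B x|^2 + \<alpha> |x|^2 = <e, B
  x> <= |e|^2/4 + |B x|^2. The terms |B x|^2 cancel, which is the origin of the 4.\<close>

lemma noise_bound:
  assumes e: "e \<in> H"
  shows "(norm (Rs \<alpha> (Bs e)))\<^sup>2 \<le> (norm e)\<^sup>2 / (4 * \<alpha>)"
proof -
  define x where "x = Rs \<alpha> (Bs e)"
  have x: "x \<in> H" using e by (simp add: x_def)
  have "inner (Bs (B x) + \<alpha> *\<^sub>R x) x = inner (Bs e) x" unfolding x_def using e by (simp add: Rs_right)
  have "(norm (B x))\<^sup>2 + \<alpha> * (norm x)\<^sup>2 = inner e (B x)"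
  proof -
    have "inner (Bs (B x)) x = inner (B x) (B x)" "inner (Bs e) x = inner e (B x)"
      using inner_Bs[of "B x" x] inner_Bs[of e x] x e by (simp_all add: inner_commute)
    with \<open>inner (Bs (B x) + \<alpha> *\<^sub>R x) x = inner (Bs e) x\<close> show ?thesis
      by (simp add: inner_add_left power2_norm_eq_inner)
  qed
  also have "\<dots> \<le> norm e * norm (B x)" by (rule norm_cauchy_schwarz)
  also have "\<dots> \<le> (norm e)\<^sup>2 / 4 + (norm (B x))\<^sup>2"
    using zero_le_power2[of "norm e / 2 - norm (B x)"] by (simp add: power2_diff power_divide)
  finally show ?thesis using a by (simp add: x_def field_simps)
qed

section \<open>The abstract Tikhonov functional and its error\<close>

definition J :: "'h \<Rightarrow> 'h \<Rightarrow> real" where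
  "J y z = 1 / 2 * (norm (B z - y))\<^sup>2 + \<alpha> / 2 * (norm z)\<^sup>2"

text \<open>Completing the square at the solution of the normal equation; that equation is the
  vanishing of the cross terms.\<close>

lemma J_expand:
  assumes y: "y \<in> H" and z: "z \<in> H"
  shows "J y z = J y (Rs \<alpha> (Bs y)) + 1 / 2 * (norm (B (z - Rs \<alpha> (Bs y))))\<^sup>2 + \<alpha> / 2 * (norm (z - Rs \<alpha> (Bs y)))\<^sup>2"
proof -
  define u where "u = Rs \<alpha> (Bs y)"
  define h where "h = z - u"
  have H: "u \<in> H" "h \<in> H" using y z by (auto simp: u_def h_def)
  have zz: "z = u + h" by (simp add: h_def)
  have "inner (Bs (B u) + \<alpha> *\<^sub>R u) h = inner (Bs y) h" unfolding u_def using y by (simp add: Rs_right)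
  moreover have "inner (Bs (B u)) h = inner (B u) (B h)" "inner (Bs y) h = inner y (B h)"
    using inner_Bs[of "B u" h] inner_Bs[of y h] H y by (simp_all add: inner_commute)
  ultimately have "inner (B u) (B h) + \<alpha> * inner u h = inner y (B h)"
    by (simp add: inner_add_left)
  then show ?thesis
    unfolding u_def[symmetric] h_def[symmetric] J_def power2_norm_eq_inner
    using H by (simp add: zz B_add inner_simps inner_commute field_simps)
qed

lemma J_minimal:
  assumes "y \<in> H" "z \<in> H"
  shows "J y (Rs \<alpha> (Bs y)) \<le> J y z" and "J y z \<le> J y (Rs \<alpha> (Bs y)) \<Longrightarrow> z = Rs \<alpha> (Bs y)"
proof -
  show "J y (Rs \<alpha> (Bs y)) \<le> J y z" using J_expand[OF assms] a by simp
  assume "J y z \<le> J y (Rs \<alpha> (Bs y))"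
  moreover have "0 \<le> 1 / 2 * (norm (B (z - Rs \<alpha> (Bs y))))\<^sup>2" by simp
  ultimately have "\<alpha> / 2 * (norm (z - Rs \<alpha> (Bs y)))\<^sup>2 \<le> 0" using J_expand[OF assms] by linarith
  then have "(norm (z - Rs \<alpha> (Bs y)))\<^sup>2 \<le> 0" using a by (simp add: mult_le_0_iff)
  then show "z = Rs \<alpha> (Bs y)" by simp
qed

lemma error_decomposition:
  assumes "z \<in> H" "e \<in> H"
  shows "Rs \<alpha> (Bs (B z + e)) - z = Rs \<alpha> (Bs e) - \<alpha> *\<^sub>R Rs \<alpha> z"
proof -
  have "Rs \<alpha> (Bs (B z)) = z - \<alpha> *\<^sub>R Rs \<alpha> z"
    using Rs_left[OF assms(1)] assms by (simp add: Rs_add Rs_scale eq_diff_eq)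
  moreover have "Rs \<alpha> (Bs (B z + e)) = Rs \<alpha> (Bs (B z)) + Rs \<alpha> (Bs e)"
    using assms by (simp add: Bs_add Rs_add)
  ultimately show ?thesis by simp
qed

text \<open>Bias and noise are separated by |p - q|^2 <= 2|p|^2 + 2|q|^2 for each single e, before
  any expectation is taken.\<close>

lemma error_bound:
  assumes w: "w \<in> H" and b: "0 < \<beta>" "\<beta> \<le> 1" and e: "e \<in> H"
    and z: "z = op_apply (op_powr H BB \<beta>) w" "z \<in> H"
  shows "(norm (Rs \<alpha> (Bs (B z + e)) - z))\<^sup>2
    \<le> 2 * (c_const \<beta>)\<^sup>2 * (norm w)\<^sup>2 * \<alpha> powr (2 * \<beta>) + (norm e)\<^sup>2 / (2 * \<alpha>)"
proof -
  let ?p = "Rs \<alpha> (Bs e)" and ?q = "\<alpha> *\<^sub>R Rs \<alpha> z"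
  have "(norm (?p - ?q))\<^sup>2 \<le> 2 * (norm ?p)\<^sup>2 + 2 * (norm ?q)\<^sup>2"
  proof -
    have "?p \<in> H" "?q \<in> H" using e z(2) by auto
    then show ?thesis
      using semi_form.parallelogram[OF semi_form_inner, of ?p ?q] inner_ge_zero[of "?p + ?q"]
      unfolding power2_norm_eq_inner by linarith
  qed
  moreover have "(norm ?q)\<^sup>2 \<le> (c_const \<beta> * \<alpha> powr \<beta>)\<^sup>2 * (norm w)\<^sup>2"
    unfolding z(1) by (rule bias_bound[OF w b])
  moreover have "(\<alpha> powr \<beta>)\<^sup>2 = \<alpha> powr (2 * \<beta>)"
    by (simp add: power2_eq_square powr_add[symmetric])
  ultimately show ?thesis
    unfolding error_decomposition[OF z(2) e]
    using noise_bound[OF e] by (simp add: power_mult_distrib field_simps)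
qed

text \<open>Serves the measurability of the error as a function of the noise; the noise bound
  applied to differences is a Lipschitz estimate.\<close>

lemma noise_continuous:
  "continuous_on H (\<lambda>e. Rs \<alpha> (Bs e))"
proof (rule continuous_on_sequentiallyI)
  fix f e assume f: "\<forall>n. f n \<in> H" and e: "e \<in> H" and lim: "f \<longlonglongrightarrow> e"
  have bound: "norm (Rs \<alpha> (Bs (f n)) - Rs \<alpha> (Bs e)) \<le> sqrt (1 / (4 * \<alpha>)) * norm (f n - e)" for n
  proof -
    have fn: "f n \<in> H" using f by blast
    have eq: "Rs \<alpha> (Bs (f n - e)) = Rs \<alpha> (Bs (f n)) - Rs \<alpha> (Bs e)"
      using Rs_add[of "Bs (f n - e)" "Bs e"] Bs_add[of "f n - e" e] fn e by simp
    have "(norm (Rs \<alpha> (Bs (f n - e))))\<^sup>2 \<le> (norm (f n - e))\<^sup>2 / (4 * \<alpha>)"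
      by (rule noise_bound) (use fn e in simp)
    then have "sqrt ((norm (Rs \<alpha> (Bs (f n - e))))\<^sup>2) \<le> sqrt ((norm (f n - e))\<^sup>2 / (4 * \<alpha>))"
      by (rule real_sqrt_le_mono)
    then show ?thesis using a by (simp add: eq real_sqrt_divide real_sqrt_mult)
  qed
  have "(\<lambda>n. sqrt (1 / (4 * \<alpha>)) * norm (f n - e)) \<longlonglongrightarrow> 0"
    using lim by (intro tendsto_mult_right_zero tendsto_norm_zero LIM_zero)
  then have "(\<lambda>n. Rs \<alpha> (Bs (f n)) - Rs \<alpha> (Bs e)) \<longlonglongrightarrow> 0"
    by (rule Lim_null_comparison[rotated]) (use bound in auto)
  then show "(\<lambda>n. Rs \<alpha> (Bs (f n))) \<longlonglongrightarrow> Rs \<alpha> (Bs e)" by (rule LIM_zero_cancel)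
qed

end

end

section \<open>The inverse square root of the operator of the form\<close>

context fractional_domain
begin

abbreviation EA :: "real \<Rightarrow> 'a L2 \<Rightarrow> 'a L2" where
  "EA \<equiv> spectral_family_of (L2_on \<Omega>) (A_op \<Omega> s)"

sublocale EA: spectral "L2_on \<Omega>" EA
  by unfold_locales (rule A.spectral_family_of(1))

text \<open>The form dominates the inner product of L2, that is A >= I.\<close>

lemma EA_ge_one:
  assumes "x \<in> L2_on \<Omega>" shows "AE t in EA.m x. 1 \<le> t"
proof (rule EA.SI_id_lower_bound[OF _ assms])
  fix x y assume "(x, y) \<in> EA.SI (\<lambda>t. t)"
  then have "(x, y) \<in> A_op \<Omega> s" unfolding A.spectral_family_of(2)[symmetric] .
  then have "x \<in> H0s \<Omega> s" "dirichlet_form \<Omega> s x x = inner y x" by (auto simp: A_op_iff)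
  then show "1 * inner x x \<le> inner y x" using inner_le_form[of x] by simp
qed

text \<open>The symbol of A^(-1/2), cut off below 1, where the spectral measures have no mass; the
  cutoff makes it bounded.\<close>

definition inv_sqrt :: "real \<Rightarrow> real" where "inv_sqrt t = (if t < 1 then 0 else t powr (- 1 / 2))"

lemma bounded_borel_inv_sqrt [simp]: "bounded_borel inv_sqrt"
proof (rule bounded_borelI)
  show "inv_sqrt \<in> borel_measurable borel" unfolding inv_sqrt_def[abs_def] by measurable
  show "\<bar>inv_sqrt t\<bar> \<le> 1" for t using powr_mono[of "- 1 / 2" 0 t] by (auto simp: inv_sqrt_def)
qed

definition S :: "'a L2 \<Rightarrow> 'a L2" where "S = EA.Phi inv_sqrt"

lemma S_in [simp]: "x \<in> L2_on \<Omega> \<Longrightarrow> S x \<in> L2_on \<Omega>"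
  by (simp add: S_def)

lemma S_sym: "x \<in> L2_on \<Omega> \<Longrightarrow> y \<in> L2_on \<Omega> \<Longrightarrow> inner (S x) y = inner x (S y)"
  by (simp add: S_def EA.Phi_sym)

lemma S_add: "x \<in> L2_on \<Omega> \<Longrightarrow> y \<in> L2_on \<Omega> \<Longrightarrow> S (x + y) = S x + S y"
  by (simp add: S_def EA.Phi_add)

lemma S_scale: "x \<in> L2_on \<Omega> \<Longrightarrow> S (r *\<^sub>R x) = r *\<^sub>R S x"
  by (simp add: S_def EA.Phi_scale)

lemma S_diff: "x \<in> L2_on \<Omega> \<Longrightarrow> y \<in> L2_on \<Omega> \<Longrightarrow> S (x - y) = S x - S y"
  using S_add[of "x - y" y] by simp

lemma A_powr_minus_half: "x \<in> L2_on \<Omega> \<Longrightarrow> A_powr \<Omega> s (- 1 / 2) x = S x"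
proof -
  assume x: "x \<in> L2_on \<Omega>"
  have "EA.SI (\<lambda>t. t powr (- 1 / 2)) = EA.SI inv_sqrt"
  proof (rule EA.SI_cong)
    show "AE t in EA.m x. t powr (- 1 / 2) = inv_sqrt t" if "x \<in> L2_on \<Omega>" for x
      using EA_ge_one[OF that] by eventually_elim (simp add: inv_sqrt_def)
  qed (use bounded_borel_measurable[OF bounded_borel_inv_sqrt] in auto)
  then show ?thesis
    unfolding A_powr_def op_powr_def S_def
    using EA.op_apply_SI[OF bounded_borel_measurable EA.SI_bounded[OF bounded_borel_inv_sqrt x]] by simp
qed

lemma Phi_ge_one: "x \<in> L2_on \<Omega> \<Longrightarrow> EA.Phi (indicator {1..}) x = x"
proof -
  assume x: "x \<in> L2_on \<Omega>"
  have "EA.Phi (indicator {1..}) x = EA.Phi (\<lambda>_. 1) x"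
  proof (rule EA.Phi_cong_AE)
    show "AE t in EA.m x. indicator {1..} t = 1"
      using EA_ge_one[OF x] by eventually_elim simp
  qed (use x in auto)
  then show ?thesis using x by (simp add: EA.Phi_one)
qed

text \<open>On symbols, t times the square of \<open>inv_sqrt\<close> is the indicator of t >= 1,
  which acts as the identity.\<close>

lemma SS_inverse:
  assumes "(u, f) \<in> A_op \<Omega> s" shows "S (S f) = u"
proof -
  have H: "u \<in> L2_on \<Omega>" "f \<in> L2_on \<Omega>" using assms A.T_H by blast+
  have fn: "(\<lambda>t. t * (inv_sqrt t * inv_sqrt t)) = indicator {1..}"
    by (auto simp: inv_sqrt_def powr_add[symmetric] powr_minus_divide indicator_def)
  have "S (S f) = EA.Phi (\<lambda>t. inv_sqrt t * inv_sqrt t) f" using H by (simp add: S_def EA.Phi_mult)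
  also have "\<dots> = EA.Phi (\<lambda>t. t * (inv_sqrt t * inv_sqrt t)) u"
    using assms A.spectral_family_of(2) by (intro EA.SI_Phi) (auto simp: fn)
  also have "\<dots> = u" unfolding fn by (rule Phi_ge_one[OF H(1)])
  finally show ?thesis .
qed

lemma
  assumes f: "f \<in> L2_on \<Omega>"
  shows SS_in: "S (S f) \<in> H0s \<Omega> s"
    and form_SS: "v \<in> H0s \<Omega> s \<Longrightarrow> dirichlet_form \<Omega> s (S (S f)) v = inner f v"
    and SS_A: "(S (S f), f) \<in> A_op \<Omega> s"
proof -
  obtain u where "u \<in> H0s \<Omega> s" "\<And>v. v \<in> H0s \<Omega> s \<Longrightarrow> dirichlet_form \<Omega> s u v + 0 * inner u v = inner f v"
    using resolvent_exists[OF f, of 0] by auto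
  then have u: "(u, f) \<in> A_op \<Omega> s" using f by (simp add: A_op_iff)
  then show "(S (S f), f) \<in> A_op \<Omega> s" using SS_inverse by simp
  then show "S (S f) \<in> H0s \<Omega> s" "v \<in> H0s \<Omega> s \<Longrightarrow> dirichlet_form \<Omega> s (S (S f)) v = inner f v"
    by (auto simp: A_op_iff)
qed

text \<open>S (x - y) = 0 puts the pair (0, x - y) into \<open>A_op\<close>, which is
  single-valued.\<close>

lemma S_inj: "x \<in> L2_on \<Omega> \<Longrightarrow> y \<in> L2_on \<Omega> \<Longrightarrow> S x = S y \<Longrightarrow> x = y"
proof -
  assume a: "x \<in> L2_on \<Omega>" "y \<in> L2_on \<Omega>" "S x = S y"
  have "S (x - y) = 0" using a by (simp add: S_diff)
  moreover have "S 0 = 0" using S_scale[of 0 0] by simp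
  ultimately have "x - y = 0" using SS_A[of "x - y"] A.T_single[of "x - y"] a by simp
  then show ?thesis by simp
qed

text \<open>The preimages are truncations of A^(1/2) z; \<open>S\<close> maps them to spectral cuts
  of z, which converge to z.\<close>

lemma S_range_dense:
  assumes z: "z \<in> L2_on \<Omega>"
  obtains f where "\<And>n::nat. f n \<in> L2_on \<Omega>" "(\<lambda>n. S (f n)) \<longlonglongrightarrow> z"
proof -
  define g where "g t = (if t < 1 then 0 else t powr (1 / 2))" for t :: real
  have g: "g \<in> borel_measurable borel" unfolding g_def[abs_def] by measurable
  define f where "f n = EA.Phi (\<lambda>t. g t * EA.cut g n t) z" for n
  have "S (f n) = EA.Phi (EA.cut g n) z" for n
  proof -
    have "S (f n) = EA.Phi (\<lambda>t. inv_sqrt t * (g t * EA.cut g n t)) z"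
      unfolding S_def f_def using z g by (intro EA.Phi_mult) auto
    also have "\<dots> = EA.Phi (EA.cut g n) z"
    proof (rule EA.Phi_cong_AE)
      show "AE t in EA.m z. inv_sqrt t * (g t * EA.cut g n t) = EA.cut g n t"
        using EA_ge_one[OF z]
        by eventually_elim (simp add: inv_sqrt_def g_def mult.assoc[symmetric] powr_add[symmetric])
    qed (use z g in auto)
    finally show ?thesis .
  qed
  then have "(\<lambda>n. S (f n)) \<longlonglongrightarrow> z" using EA.Phi_cut_tendsto[OF g z] by simp
  moreover have "f n \<in> L2_on \<Omega>" for n using z g by (simp add: f_def)
  ultimately show ?thesis using that by blast
qed

lemma norm_S_le: "x \<in> L2_on \<Omega> \<Longrightarrow> inner (S x) (S x) \<le> inner x x"
proof -
  assume x: "x \<in> L2_on \<Omega>"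
  have "\<bar>(inv_sqrt t)\<^sup>2\<bar> \<le> 1" for t
    using powr_mono[of "- 1 / 2" 0 t] by (auto simp: inv_sqrt_def power_le_one)
  then show ?thesis
    using EA.Q_bound[OF x, of "\<lambda>t. (inv_sqrt t)\<^sup>2" 1] bounded_borel_measurable[OF bounded_borel_power2[OF bounded_borel_inv_sqrt]]
      EA.norm_Phi[OF bounded_borel_inv_sqrt x] by (simp add: S_def)
qed

text \<open>
  \<open>S\<close> maps its own range isometrically into the form domain because \<open>S S\<close> inverts the operator;
  completeness of the form domain extends this to all of \<open>L\<^sup>2(\<Omega>)\<close>.
\<close>

lemma
  assumes z: "z \<in> L2_on \<Omega>"
  shows S_in_H0s: "S z \<in> H0s \<Omega> s"
    and form_S: "z' \<in> L2_on \<Omega> \<Longrightarrow> S z' \<in> H0s \<Omega> s \<Longrightarrow> dirichlet_form \<Omega> s (S z) (S z') = inner z z'"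
proof -
  obtain f where f: "\<And>n::nat. f n \<in> L2_on \<Omega>" and lim: "(\<lambda>n. S (f n)) \<longlonglongrightarrow> z"
    using S_range_dense[OF z] by blast
  define u where "u n = S (S (f n))" for n
  have uH: "u n \<in> H0s \<Omega> s" for n unfolding u_def by (rule SS_in[OF f])
  have form_u: "dirichlet_form \<Omega> s (u m - u n) (u m - u n)
      = inner (S (f m) - S (f n)) (S (f m) - S (f n))" for m n
  proof -
    have e: "u m - u n = S (S (f m - f n))" using f by (simp add: u_def S_diff)
    have "dirichlet_form \<Omega> s (u m - u n) (u m - u n) = inner (f m - f n) (u m - u n)"
      unfolding e using f by (intro form_SS SS_in) auto
    also have "\<dots> = inner (S (f m - f n)) (S (f m - f n))"
      unfolding e using f by (simp add: S_sym)
    finally show ?thesis using f by (simp add: S_diff)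
  qed
  have "Cauchy (\<lambda>n. S (f n))" using lim by (rule LIMSEQ_imp_Cauchy)
  then have cau: "\<exists>N. \<forall>m\<ge>N. \<forall>n\<ge>N. dirichlet_form \<Omega> s (u m - u n) (u m - u n) < e" if "e > 0" for e
  proof -
    have "sqrt e > 0" using \<open>e > 0\<close> by simp
    with \<open>Cauchy (\<lambda>n. S (f n))\<close> obtain N where
      N: "\<And>m n. m \<ge> N \<Longrightarrow> n \<ge> N \<Longrightarrow> dist (S (f m)) (S (f n)) < sqrt e"
      using metric_CauchyD by metis
    have "dirichlet_form \<Omega> s (u m - u n) (u m - u n) < e" if "m \<ge> N" "n \<ge> N" for m n
    proof -
      have "(norm (S (f m) - S (f n)))\<^sup>2 < (sqrt e)\<^sup>2"
        using N[OF that] unfolding dist_norm by (intro power_strict_mono) auto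
      then show ?thesis using \<open>e > 0\<close> by (simp add: form_u power2_norm_eq_inner)
    qed
    then show ?thesis by blast
  qed
  obtain v where v: "v \<in> H0s \<Omega> s" "(\<lambda>n. dirichlet_form \<Omega> s (u n - v) (u n - v)) \<longlonglongrightarrow> 0"
    using a.form_completeD[OF form_complete uH cau] by blast
  have norm_lim: "(\<lambda>n. norm (x n)) \<longlonglongrightarrow> 0" if "\<And>n. inner (x n) (x n) \<le> y n" "y \<longlonglongrightarrow> (0::real)"
    for x :: "nat \<Rightarrow> 'a L2" and y
  proof -
    have "(\<lambda>n. inner (x n) (x n)) \<longlonglongrightarrow> 0"
      by (rule Lim_null_comparison[OF _ that(2)]) (use that(1) in auto)
    from tendsto_real_sqrt[OF this] show ?thesis by (simp add: norm_eq_sqrt_inner)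
  qed
  have "(\<lambda>n. norm (u n - v)) \<longlonglongrightarrow> 0"
    using inner_le_form uH v by (intro norm_lim[OF _ v(2)]) auto
  then have "u \<longlonglongrightarrow> v" by (simp add: LIM_zero_iff tendsto_norm_zero_iff)
  \<comment> \<open>The form limit v is also a limit in L2. There u tends to S z because
    \<open>S\<close> is a contraction, so v = S z.\<close>
  moreover have "u \<longlonglongrightarrow> S z"
  proof -
    have "(\<lambda>n. inner (S (f n) - z) (S (f n) - z)) \<longlonglongrightarrow> inner (z - z) (z - z)"
      by (intro tendsto_intros lim)
    then have "(\<lambda>n. norm (u n - S z)) \<longlonglongrightarrow> 0"
    proof (intro norm_lim)
      show "inner (u n - S z) (u n - S z) \<le> inner (S (f n) - z) (S (f n) - z)" for n
        using norm_S_le[of "S (f n) - z"] f z by (simp add: u_def S_diff)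
    qed simp
    then show ?thesis by (simp add: LIM_zero_iff tendsto_norm_zero_iff)
  qed
  ultimately have vS: "v = S z" by (rule LIMSEQ_unique)
  then show "S z \<in> H0s \<Omega> s" using v by simp
  \<comment> \<open>Membership of S z' is assumed since the first conclusion is at hand for z only;
    applied to z', it discharges this premise.\<close>
  assume z': "z' \<in> L2_on \<Omega>" "S z' \<in> H0s \<Omega> s"
  have "(\<lambda>n. dirichlet_form \<Omega> s (u n) (S z')) \<longlonglongrightarrow> dirichlet_form \<Omega> s (S z) (S z')"
    using a.tendsto_form[OF uH v(1) z'(2) v(2)] vS by simp
  moreover have "dirichlet_form \<Omega> s (u n) (S z') = inner (S (f n)) z'" for n
    unfolding u_def using form_SS[OF f z'(2)] f z' by (simp add: S_sym)
  moreover have "(\<lambda>n. inner (S (f n)) z') \<longlonglongrightarrow> inner z z'" by (intro tendsto_intros lim)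
  ultimately show "dirichlet_form \<Omega> s (S z) (S z') = inner z z'" using LIMSEQ_unique by fastforce
qed

lemma H0s_norm_S: "z \<in> L2_on \<Omega> \<Longrightarrow> H0s_norm \<Omega> s (S z) = norm z"
  by (simp add: H0s_norm_def form_S S_in_H0s norm_eq_sqrt_inner)

text \<open>The vector z represents v -> a(u, S v). Tested with S v it yields <v, S z> = a(u, S S v)
  = <v, u>, because S S inverts the operator of the form.\<close>

lemma S_surj:
  assumes u: "u \<in> H0s \<Omega> s"
  obtains z where "z \<in> L2_on \<Omega>" "S z = u"
proof -
  have "\<bar>dirichlet_form \<Omega> s u (S v)\<bar> \<le> sqrt (dirichlet_form \<Omega> s u u) * norm v" if v: "v \<in> L2_on \<Omega>" for v
    using a.abs_le_sqrt[OF u S_in_H0s[OF v]] v by (simp add: form_S S_in_H0s norm_eq_sqrt_inner)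
  then obtain z where z: "z \<in> L2_on \<Omega>" "\<And>v. v \<in> L2_on \<Omega> \<Longrightarrow> inner z v = dirichlet_form \<Omega> s u (S v)"
    using L.riesz[of "\<lambda>v. dirichlet_form \<Omega> s u (S v)" "sqrt (dirichlet_form \<Omega> s u u)"] u
    by (auto simp: S_add S_scale a.add_right a.scale_right S_in_H0s)
  have "S z = u"
  proof (rule L.eqI)
    fix v assume v: "v \<in> L2_on \<Omega>"
    have "inner v (S z) = dirichlet_form \<Omega> s (S (S v)) (S z)"
      using form_SS[OF v] z v S_in_H0s by simp
    also have "\<dots> = inner (S v) z" using z v by (intro form_S S_in_H0s) auto
    also have "\<dots> = dirichlet_form \<Omega> s u (S (S v))" using z(2)[of "S v"] v by (simp add: inner_commute)
    also have "\<dots> = inner v u" using form_SS[OF v u] a.sym[OF u SS_in[OF v]] by simp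
    finally show "inner (S z) v = inner u v" by (simp add: inner_commute)
  qed (use z u H0s_L2_on in auto)
  with z that show ?thesis by blast
qed

text \<open>The product of t^(1/2) and \<open>inv_sqrt\<close> is the indicator of t >= 1, so S z
  lies in the domain of A^(1/2). Applying \<open>S\<close> to the value there returns S z, and
  injectivity identifies the value as z.\<close>

lemma A_powr_half: "z \<in> L2_on \<Omega> \<Longrightarrow> A_powr \<Omega> s (1 / 2) (S z) = z"
proof -
  assume z: "z \<in> L2_on \<Omega>"
  let ?p = "\<lambda>t::real. t powr (1 / 2)"
  have fn: "(\<lambda>t. ?p t * inv_sqrt t) = indicator {1..}"
    by (auto simp: inv_sqrt_def powr_add[symmetric] indicator_def)
  have "(\<lambda>t. (inv_sqrt t)\<^sup>2 * (?p t)\<^sup>2) = (\<lambda>t. (indicator {1..} t)\<^sup>2)"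
    unfolding fn[symmetric] by (simp add: power_mult_distrib mult.commute)
  then have "integrable (EA.m (S z)) (\<lambda>t. (?p t)\<^sup>2)"
    unfolding S_def using z by (subst EA.integrable_m_Phi) auto
  then have "S z \<in> EA.dom ?p" using z by (simp add: spectral_dom_def)
  then obtain y where y: "(S z, y) \<in> EA.SI ?p" using EA.SI_exists[of ?p] by auto
  then have yH: "y \<in> L2_on \<Omega>" by (simp add: EA.SI_iff)
  have "S y = EA.Phi (\<lambda>t. ?p t * inv_sqrt t) (S z)"
    unfolding S_def by (rule EA.SI_Phi) (use y in \<open>auto simp: fn S_def\<close>)
  also have "\<dots> = S z" unfolding fn using z by (simp add: Phi_ge_one)
  finally have "y = z" using S_inj[OF yH z] by simp
  then show ?thesis
    unfolding A_powr_def op_powr_def using EA.op_apply_SI[OF _ y] by simp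
qed

section \<open>Transport to the fractional Tikhonov problem\<close>

context
  fixes K :: "'a L2 \<Rightarrow> 'a L2"
  assumes K: "bounded_linear_between (H0s \<Omega> s) (H0s_norm \<Omega> s) (L2_on \<Omega>) norm K"
begin

lemma B_op_eq: "f \<in> L2_on \<Omega> \<Longrightarrow> B_op \<Omega> s K f = K (S f)"
  by (simp add: B_op_def A_powr_minus_half[simplified])

lemma bounded_B_op: "bounded_linear_between (L2_on \<Omega>) norm (L2_on \<Omega>) norm (B_op \<Omega> s K)"
proof -
  have K': "\<And>u. u \<in> H0s \<Omega> s \<Longrightarrow> K u \<in> L2_on \<Omega>"
    "\<And>u v. u \<in> H0s \<Omega> s \<Longrightarrow> v \<in> H0s \<Omega> s \<Longrightarrow> K (u + v) = K u + K v"
    "\<And>r u. u \<in> H0s \<Omega> s \<Longrightarrow> K (r *\<^sub>R u) = r *\<^sub>R K u"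
    and "\<exists>C. \<forall>u\<in>H0s \<Omega> s. norm (K u) \<le> C * H0s_norm \<Omega> s u"
    using K unfolding bounded_linear_between_def by (simp_all add: image_subset_iff)
  then obtain C where C: "\<And>u. u \<in> H0s \<Omega> s \<Longrightarrow> norm (K u) \<le> C * H0s_norm \<Omega> s u" by blast
  show ?thesis
    unfolding bounded_linear_between_def
  proof (intro conjI ballI allI exI[of _ C])
    show "B_op \<Omega> s K ` L2_on \<Omega> \<subseteq> L2_on \<Omega>" using K' S_in_H0s by (auto simp: B_op_eq)
  qed (use C K' S_in_H0s in \<open>auto simp: B_op_eq S_add S_scale H0s_norm_S[symmetric]\<close>)
qed

interpretation T: hilbert_operator "L2_on \<Omega>" "B_op \<Omega> s K"
  by unfold_locales (rule bounded_B_op)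

text \<open>\<open>S\<close> is an isometric bijection of L2(\<Omega>) onto the form domain that
  carries the abstract functional to the given one, so existence and uniqueness transfer.\<close>

lemma minimizer_unique:
  assumes a: "0 < \<alpha>" and y: "y \<in> L2_on \<Omega>"
  shows "is_minimizer (H0s \<Omega> s) (tikhonov \<Omega> s K \<alpha> y) v \<longleftrightarrow> v = S (T.Rs \<alpha> (T.Bs y))"
proof -
  have tik: "tikhonov \<Omega> s K \<alpha> y (S z) = T.J \<alpha> y z" if "z \<in> L2_on \<Omega>" for z
    using that by (simp add: tikhonov_def T.J_def[OF a] B_op_eq H0s_norm_S)
  define z0 where "z0 = T.Rs \<alpha> (T.Bs y)"
  have z0: "z0 \<in> L2_on \<Omega>" using a y by (simp add: z0_def)
  show ?thesis
    unfolding z0_def[symmetric]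
  proof
    assume m: "is_minimizer (H0s \<Omega> s) (tikhonov \<Omega> s K \<alpha> y) v"
    then have "v \<in> H0s \<Omega> s" by (simp add: is_minimizer_def)
    then obtain z where z: "z \<in> L2_on \<Omega>" "v = S z" using S_surj by metis
    have "tikhonov \<Omega> s K \<alpha> y v \<le> tikhonov \<Omega> s K \<alpha> y (S z0)"
      using m S_in_H0s[OF z0] by (simp add: is_minimizer_def)
    then have "z = z0" using T.J_minimal(2)[OF a y z(1)] z z0 by (simp add: tik z0_def)
    then show "v = S z0" using z by simp
  next
    assume v: "v = S z0"
    show "is_minimizer (H0s \<Omega> s) (tikhonov \<Omega> s K \<alpha> y) v"
      unfolding is_minimizer_def v
    proof (intro conjI ballI)
      show "S z0 \<in> H0s \<Omega> s" by (rule S_in_H0s[OF z0])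
      fix u assume "u \<in> H0s \<Omega> s"
      then obtain z where z: "z \<in> L2_on \<Omega>" "u = S z" using S_surj by metis
      then show "tikhonov \<Omega> s K \<alpha> y (S z0) \<le> tikhonov \<Omega> s K \<alpha> y u"
        using T.J_minimal(1)[OF a y z(1)] z0 by (simp add: tik z0_def)
    qed
  qed
qed

lemma tikhonov_minimizer_eq:
  "0 < \<alpha> \<Longrightarrow> y \<in> L2_on \<Omega> \<Longrightarrow> tikhonov_minimizer \<Omega> s K \<alpha> y = S (T.Rs \<alpha> (T.Bs y))"
  unfolding tikhonov_minimizer_def by (rule the_equality) (simp_all add: minimizer_unique)

text \<open>For each outcome the isometry \<open>S\<close> turns the form norm of the error into the
  abstract error. The resulting bound is integrated with total mass 1 and the second moment of the
  noise.\<close>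

lemma expected_error:
  fixes M :: "'p measure"
  assumes u0: "u0 \<in> H0s \<Omega> s" and b: "0 < \<beta>" "\<beta> \<le> 1" and w: "w \<in> L2_on \<Omega>"
    and source: "A_powr \<Omega> s (1 / 2) u0 = BB_powr \<Omega> s K \<beta> w"
    and M: "prob_space M" and noise: "noise M \<Omega> \<delta> \<eta>" and a: "0 < \<alpha>"
  defines "err \<equiv> \<lambda>\<omega>. (H0s_norm \<Omega> s (tikhonov_minimizer \<Omega> s K \<alpha> (K u0 + \<eta> \<omega>) - u0))\<^sup>2"
  shows "\<forall>\<omega>\<in>space M. \<exists>!v. is_minimizer (H0s \<Omega> s) (tikhonov \<Omega> s K \<alpha> (K u0 + \<eta> \<omega>)) v"
    and "integrable M err"
    and "(\<integral>\<omega>. err \<omega> \<partial>M)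
      \<le> 2 * (c_const \<beta>)\<^sup>2 * (norm w)\<^sup>2 * \<alpha> powr (2 * \<beta>) + \<delta>\<^sup>2 / (2 * \<alpha>)"
proof -
  interpret M: prob_space M by (rule M)
  have \<eta>: "\<eta> \<in> borel_measurable M" "\<And>\<omega>. \<omega> \<in> space M \<Longrightarrow> \<eta> \<omega> \<in> L2_on \<Omega>"
    "integrable M (\<lambda>\<omega>. (norm (\<eta> \<omega>))\<^sup>2)" "(\<integral>\<omega>. (norm (\<eta> \<omega>))\<^sup>2 \<partial>M) \<le> \<delta>\<^sup>2"
    using noise by (auto simp: noise_def)
  obtain z0 where z0: "z0 \<in> L2_on \<Omega>" "S z0 = u0" using S_surj[OF u0] by blast
  have z0_source: "z0 = op_apply (op_powr (L2_on \<Omega>) T.BB \<beta>) w"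
    using source A_powr_half[OF z0(1)] z0(2) by (simp add: BB_powr_def)
  have Ku0: "K u0 = B_op \<Omega> s K z0" using z0 by (simp add: B_op_eq)
  have y: "K u0 + \<eta> \<omega> \<in> L2_on \<Omega>" if "\<omega> \<in> space M" for \<omega>
    using \<eta>(2)[OF that] z0 by (simp add: Ku0)
  show "\<forall>\<omega>\<in>space M. \<exists>!v. is_minimizer (H0s \<Omega> s) (tikhonov \<Omega> s K \<alpha> (K u0 + \<eta> \<omega>)) v"
    using minimizer_unique[OF a y] by simp
  have err_eq: "err \<omega> = (norm (T.Rs \<alpha> (T.Bs (B_op \<Omega> s K z0 + \<eta> \<omega>)) - z0))\<^sup>2" if "\<omega> \<in> space M" for \<omega>
  proof -
    have "err \<omega> = (H0s_norm \<Omega> s (S (T.Rs \<alpha> (T.Bs (K u0 + \<eta> \<omega>))) - S z0))\<^sup>2"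
      using z0(2) by (simp add: err_def tikhonov_minimizer_eq[OF a y[OF that]])
    also have "\<dots> = (norm (T.Rs \<alpha> (T.Bs (K u0 + \<eta> \<omega>)) - z0))\<^sup>2"
      using y[OF that] a z0(1) by (simp add: S_diff[symmetric] H0s_norm_S)
    finally show ?thesis unfolding Ku0 .
  qed
  let ?A = "2 * (c_const \<beta>)\<^sup>2 * (norm w)\<^sup>2 * \<alpha> powr (2 * \<beta>)"
  have bound: "err \<omega> \<le> ?A + (norm (\<eta> \<omega>))\<^sup>2 / (2 * \<alpha>)" if "\<omega> \<in> space M" for \<omega>
    unfolding err_eq[OF that] by (rule T.error_bound[OF a w b \<eta>(2)[OF that] z0_source z0(1)])
  \<comment> \<open>By the error decomposition the error is a continuous function of the noise on
    the subspace in which the noise takes its values.\<close>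
  have meas: "err \<in> borel_measurable M"
  proof -
    let ?g = "\<lambda>e. (norm (T.Rs \<alpha> (T.Bs e) - \<alpha> *\<^sub>R T.Rs \<alpha> z0))\<^sup>2"
    have "?g \<in> borel_measurable (restrict_space borel (L2_on \<Omega>))"
      by (intro borel_measurable_continuous_on_restrict continuous_intros T.noise_continuous[OF a])
    moreover have "\<eta> \<in> measurable M (restrict_space borel (L2_on \<Omega>))"
      using \<eta>(1,2) by (intro measurable_restrict_space2) auto
    ultimately have "(\<lambda>\<omega>. ?g (\<eta> \<omega>)) \<in> borel_measurable M"
      by (rule measurable_compose[rotated])
    moreover have "err \<omega> = ?g (\<eta> \<omega>)" if "\<omega> \<in> space M" for \<omega>
      unfolding err_eq[OF that] T.error_decomposition[OF a z0(1) \<eta>(2)[OF that]] ..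
    ultimately show ?thesis by (simp cong: measurable_cong)
  qed
  have int: "integrable M (\<lambda>\<omega>. ?A + (norm (\<eta> \<omega>))\<^sup>2 / (2 * \<alpha>))" using \<eta>(3) by auto
  show err_int: "integrable M err"
    by (rule Bochner_Integration.integrable_bound[OF int meas])
      (use bound in \<open>force simp: err_def\<close>)
  have "(\<integral>\<omega>. err \<omega> \<partial>M) \<le> (\<integral>\<omega>. ?A + (norm (\<eta> \<omega>))\<^sup>2 / (2 * \<alpha>) \<partial>M)"
    by (intro integral_mono err_int int bound)
  also have "\<dots> = ?A + (\<integral>\<omega>. (norm (\<eta> \<omega>))\<^sup>2 \<partial>M) / (2 * \<alpha>)"
    using \<eta>(3) by (simp add: M.prob_space)
  also have "\<dots> \<le> ?A + \<delta>\<^sup>2 / (2 * \<alpha>)" using \<eta>(4) a by (intro add_left_mono divide_right_mono) auto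
  finally show "(\<integral>\<omega>. err \<omega> \<partial>M) \<le> ?A + \<delta>\<^sup>2 / (2 * \<alpha>)" .
qed

end

end

theorem theorem3p4:
  fixes \<Omega> :: "'a::euclidean_space set" and s :: real and K :: "'a L2 \<Rightarrow> 'a L2"
  assumes "bounded \<Omega>" and "lipschitz_domain \<Omega>"
    and "0 < s" and "s < 1"
    and "bounded_linear_between (H0s \<Omega> s) (H0s_norm \<Omega> s) (L2_on \<Omega>) norm K"
  shows "bounded_linear_between (L2_on \<Omega>) norm (L2_on \<Omega>) norm (B_op \<Omega> s K) \<and>
    (\<forall>u\<^sub>0 \<beta> w. u\<^sub>0 \<in> H0s \<Omega> s \<and> 0 < \<beta> \<and> \<beta> \<le> 1 \<and> w \<in> L2_on \<Omega> \<and>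
        A_powr \<Omega> s (1 / 2) u\<^sub>0 = BB_powr \<Omega> s K \<beta> w \<longrightarrow>
      (let C\<^sub>1 = 2 * (c_const \<beta>)\<^sup>2 * (norm w)\<^sup>2; C\<^sub>2 = 1 / 2 in
       \<forall>(M :: 'p measure) \<delta> \<eta>. prob_space M \<and> 0 < \<delta> \<and> noise M \<Omega> \<delta> \<eta> \<longrightarrow>
         (\<forall>\<alpha>>0.
           let y = (\<lambda>\<omega>. K u\<^sub>0 + \<eta> \<omega>);
               u = (\<lambda>\<omega>. tikhonov_minimizer \<Omega> s K \<alpha> (y \<omega>))
           in (\<forall>\<omega>\<in>space M. \<exists>!v. is_minimizer (H0s \<Omega> s) (tikhonov \<Omega> s K \<alpha> (y \<omega>)) v) \<and>
              integrable M (\<lambda>\<omega>. (H0s_norm \<Omega> s (u \<omega> - u\<^sub>0))\<^sup>2) \<and>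
              (\<integral>\<omega>. (H0s_norm \<Omega> s (u \<omega> - u\<^sub>0))\<^sup>2 \<partial>M)
                \<le> 2 * (c_const \<beta>)\<^sup>2 * (norm w)\<^sup>2 * \<alpha> powr (2 * \<beta>) + \<delta>\<^sup>2 / (2 * \<alpha>) \<and>
              (\<integral>\<omega>. (H0s_norm \<Omega> s (u \<omega> - u\<^sub>0))\<^sup>2 \<partial>M)
                \<le> C\<^sub>1 * \<alpha> powr (2 * \<beta>) + C\<^sub>2 * (\<delta>\<^sup>2 / \<alpha>))))"
proof -
  interpret fractional_domain \<Omega> s
    using assms by unfold_locales (auto simp: lipschitz_domain_def)
  show ?thesis
    unfolding Let_def
  proof (intro conjI allI impI, rule bounded_B_op[OF assms(5)])
    fix u\<^sub>0 \<beta> w and M :: "'p measure" and \<delta> \<eta> and \<alpha> :: real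
    assume src: "u\<^sub>0 \<in> H0s \<Omega> s \<and> 0 < \<beta> \<and> \<beta> \<le> 1 \<and> w \<in> L2_on \<Omega> \<and>
        A_powr \<Omega> s (1 / 2) u\<^sub>0 = BB_powr \<Omega> s K \<beta> w"
      and nse: "prob_space M \<and> 0 < \<delta> \<and> noise M \<Omega> \<delta> \<eta>" and a: "0 < \<alpha>"
    have *: "u\<^sub>0 \<in> H0s \<Omega> s" "0 < \<beta>" "\<beta> \<le> 1" "w \<in> L2_on \<Omega>"
      "A_powr \<Omega> s (1 / 2) u\<^sub>0 = BB_powr \<Omega> s K \<beta> w" "prob_space M" "noise M \<Omega> \<delta> \<eta>"
      using src nse by auto
    note main = expected_error[OF assms(5) * a]
    show "\<forall>\<omega>\<in>space M. \<exists>!v. is_minimizer (H0s \<Omega> s) (tikhonov \<Omega> s K \<alpha> (K u\<^sub>0 + \<eta> \<omega>)) v"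
      by (rule main(1))
    show "integrable M (\<lambda>\<omega>. (H0s_norm \<Omega> s (tikhonov_minimizer \<Omega> s K \<alpha> (K u\<^sub>0 + \<eta> \<omega>) - u\<^sub>0))\<^sup>2)"
      by (rule main(2))
    show "(\<integral>\<omega>. (H0s_norm \<Omega> s (tikhonov_minimizer \<Omega> s K \<alpha> (K u\<^sub>0 + \<eta> \<omega>) - u\<^sub>0))\<^sup>2 \<partial>M)
        \<le> 2 * (c_const \<beta>)\<^sup>2 * (norm w)\<^sup>2 * \<alpha> powr (2 * \<beta>) + \<delta>\<^sup>2 / (2 * \<alpha>)"
      by (rule main(3))
    then show "(\<integral>\<omega>. (H0s_norm \<Omega> s (tikhonov_minimizer \<Omega> s K \<alpha> (K u\<^sub>0 + \<eta> \<omega>) - u\<^sub>0))\<^sup>2 \<partial>M)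
        \<le> 2 * (c_const \<beta>)\<^sup>2 * (norm w)\<^sup>2 * \<alpha> powr (2 * \<beta>) + 1 / 2 * (\<delta>\<^sup>2 / \<alpha>)"
      by simp
  qed
qed

end
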